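(* Let $\kappa,\eta>0$, $M>20$ and $\beta\in(0,1)$. Then there is some $f_{\kappa,\eta,\beta}>0$ such that for every $f\in(0,f_{\kappa,\eta,\beta})$ every resonance $z$ of $H_{\kappa,\eta,f}$ either has absolute value between $f^{\frac{2}{3\beta}}$ and $f^{\beta/2}$, or is contained in the set $$\Big\{ z: |z|>f^{\beta/2};\ |\arg z+2\pi/3|<|z|^{-1}(1+|z|^{-1/2})\,M f\log(f^{-1}+|z|)\ \text{ or }\ |\arg z|<|z|^{-3/2}Mf\log(f^{-1}+|z|)\Big\}.$$
   Context: For $\kappa,\eta,f>0$, $H_{\kappa,\eta,f}=p^2+fx+\frac1\eta(\delta_\kappa+\delta_{-\kappa})$ denotes the self-adjoint realization in $L^2(\mathbb R)$, where $p=-i\frac{d}{dx}$ and $\delta_{\pm\kappa}$ is the delta function at $\pm\kappa$ (functions in the domain are continuous, with jump condition $u'(\pm\kappa+0)-u'(\pm\kappa-0)=\eta^{-1}u(\pm\kappa)$, and $H_{\kappa,\eta,f}u=-u''+fxu\in L^2$ away from $\pm\kappa$). The resonances of $H_{\kappa,\eta,f}$ are the poles in the lower half plane of the meromorphic continuation in $z$, from the upper half plane across the real axis, of the Green's functions $(H_{\kappa,\eta,f}-z)^{-1}(x,y)$. They are exactly the zeros of the entire function $$D_f(z)=1+\frac{\alpha_++\alpha_-}{\eta\mathcal W}+\frac{\beta_+(\beta_--\beta_+)}{\eta^2\mathcal W^2},$$ where $A(x)=\frac1{2\pi}\int_{-\infty}^\infty e^{i(tx+t^3/3)}dt$ is the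 Airy function (extended to an entire function), $\omega=e^{2\pi i/3}$, $\zeta_\pm=-zf^{-2/3}\pm\kappa f^{1/3}$, $\alpha_\pm=A(\omega\zeta_\pm)A(\zeta_\pm)$, $\beta_\pm=A(\omega\zeta_\mp)A(\zeta_\pm)$ and $\mathcal W=f^{1/3}e^{-i\pi/6}/(2\pi)$. Here $\arg z\in(-\pi,\pi]$. *)

theory Defs
  imports "HOL-Complex_Analysis.Complex_Analysis"
begin

(* Elements of L^2(R) are represented by Borel functions; equality almost everywhere is
   handled where it matters (see stark_op below). *)
definition L2 :: "(real \<Rightarrow> complex) set" where
  "L2 = {u \<in> borel_measurable lborel. integrable lborel (\<lambda>x. (cmod (u x))\<^sup>2)}"

(* The graph of the self-adjoint operator H = p^2 + f x + (1/eta)(delta_kappa + delta_(-kappa)):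
   "stark_op kappa eta f u h" says that u, taken as its continuous representative, lies in the
   domain of H and that H u = h in L^2.  The integral identity says that u' is locally
   absolutely continuous on each component of the complement of {kappa, -kappa}, with
   -u'' + f x u = h almost everywhere there. *)
definition stark_op ::
    "real \<Rightarrow> real \<Rightarrow> real \<Rightarrow> (real \<Rightarrow> complex) \<Rightarrow> (real \<Rightarrow> complex) \<Rightarrow> bool" where
  "stark_op \<kappa> \<eta> f u h \<longleftrightarrow>
     u \<in> L2 \<and> h \<in> L2 \<and> continuous_on UNIV u \<and>
     (\<exists>u'. (\<forall>x. x \<notin> {\<kappa>, -\<kappa>} \<longrightarrow> (u has_vector_derivative u' x) (at x)) \<and>
           (\<forall>a b. a \<le> b \<longrightarrow> {a..b} \<inter> {\<kappa>, -\<kappa>} = {} \<longrightarrow>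
              u' b - u' a = (LINT x:{a..b}|lborel. complex_of_real (f * x) * u x - h x)) \<and>
           (\<forall>s\<in>{\<kappa>, -\<kappa>}. \<exists>l r. (u' \<longlongrightarrow> l) (at_left s) \<and> (u' \<longlongrightarrow> r) (at_right s) \<and>
              r - l = u s / complex_of_real \<eta>))"

(* G is the continuous integral kernel of the resolvent (H - z)^(-1): for every g in L^2, the
   function u = integral of G(.,y) g(y) dy lies in the domain of H and satisfies H u = z u + g.
   For non-real z, H - z is injective, so this says u = (H - z)^(-1) g; continuity makes the
   pointwise values G x y unique. *)
definition green_function ::
    "real \<Rightarrow> real \<Rightarrow> real \<Rightarrow> complex \<Rightarrow> (real \<Rightarrow> real \<Rightarrow> complex) \<Rightarrow> bool" where
  "green_function \<kappa> \<eta> f z G \<longleftrightarrow>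
     continuous_on UNIV (\<lambda>(x, y). G x y) \<and>
     (\<forall>g\<in>L2. (\<forall>x. integrable lborel (\<lambda>y. G x y * g y)) \<and>
        (let u = (\<lambda>x. LINT y|lborel. G x y * g y)
         in stark_op \<kappa> \<eta> f u (\<lambda>x. z * u x + g x)))"

(* F is the meromorphic continuation of w |-> (H - w)^(-1)(x,y) from the upper half plane. *)
definition resonances :: "real \<Rightarrow> real \<Rightarrow> real \<Rightarrow> complex set" where
  "resonances \<kappa> \<eta> f =
     {z. Im z < 0 \<and>
         (\<exists>G x y F. (\<forall>w. Im w > 0 \<longrightarrow> green_function \<kappa> \<eta> f w (G w)) \<and>
                    F meromorphic_on UNIV \<and> (\<forall>w. Im w > 0 \<longrightarrow> F w = G w x y) \<and>
                    is_pole F z)}"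

end

theory Submission
  imports Defs "HOL-Probability.Characteristic_Functions" "HOL-Real_Asymp.Real_Asymp"
begin

text \<open>
  Testing a Green function of the perturbed operator against Airy solutions of the unperturbed equation
  (Lagrange's identity, the boundary terms at infinity vanishing by square integrability) gives a
  Lippmann--Schwinger equation; Cramer's rule then shows that a pole of the continued Green function is a
  zero of a \<open>2 \<times> 2\<close> determinant in Airy functions. Writing \<open>\<rho>\<^sup>2 = \<bar>z\<bar>\<close>, the asymptotics of the Airy
  function turn this determinant into \<open>F + \<i> * E * N\<close>, where \<open>E\<close> is exponentially large or small
  unless \<open>arg z\<close> is close to \<open>- 2 * pi / 3\<close> or \<open>0\<close>, while \<open>F\<close> and \<open>N\<close> are bounded above and below by powers of
  \<open>1 / f + \<bar>z\<bar>\<close>. The delicate point is the lower bound for \<open>N\<close> near the positive real axis: there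
  \<open>N\<close> is only of the order of \<open>Re (sqrt (- z))\<close>, and the factor \<open>ln (1 / f)\<close> in the angular condition is
  what lifts this above the error terms. For \<open>\<bar>z\<bar>\<close> below \<open>f powr (2 / 3)\<close> the determinant is
  evaluated directly near the origin.
\<close>

section \<open>The Airy function\<close>

text \<open>The exponents \<open>2 / 3 * k ^ 3 / f\<close> at the two delta points are large, but
  since \<open>kp\<^sup>2 - km\<^sup>2 = 2 * \<kappa> * f\<close> their difference stays close to
  \<open>2 * \<kappa> * sqrt (- z)\<close> as \<open>f\<close> tends to 0. So a single exponential,
  \<open>Xm\<^sup>2\<close>, carries the singular behaviour, and the ratio \<open>q\<close> lies in
  the closed unit disc wherever it is estimated. Zeros are excluded by size alone: a margin of
  \<open>6 * ln T\<close> in the exponent, with \<open>T = 1 / f + \<bar>z\<bar>\<close>, beats all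
  polynomial factors. The real part of \<open>sqrt (- z) ^ 3\<close> is
  \<open>\<bar>z\<bar> powr (3/2) * sin (3/2 * Arg z)\<close>, which in the lower half plane
  vanishes or tends to 0 exactly at the two rays of the theorem. Asking for a margin of order
  \<open>f * ln T\<close> and dividing by \<open>\<bar>z\<bar> powr (3/2)\<close> gives the angular
  widths. Near \<open>- 2 * pi / 3\<close> the shift of \<open>- z\<close> by
  \<open>\<kappa> * f\<close> moves the cube by an amount of order
  \<open>\<kappa> * f * sqrt \<bar>z\<bar>\<close>, whence the larger width there. The number 20
  leaves room for all constants. No Airy function is expanded near the ray of its zeros; there the
  connection formula replaces it by two rotated ones.\<close>

text \<open>The power series in \<open>z ^ 3\<close> below solve the Airy equation when \<open>\<mu> = 6\<close> and, after multiplication by \<open>z\<close>, when \<open>\<mu> = 12\<close>.\<close>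

fun airy_coeff :: "real \<Rightarrow> nat \<Rightarrow> complex" where
  "airy_coeff \<mu> 0 = 1"
| "airy_coeff \<mu> (Suc n) = airy_coeff \<mu> n / of_real ((real n + 1) * (9 * real n + \<mu>))"

definition airy_series :: "real \<Rightarrow> complex \<Rightarrow> complex" where
  "airy_series \<mu> x = (\<Sum>n. airy_coeff \<mu> n * x ^ n)"

lemma airy_coeff_bound:
  assumes "\<mu> \<ge> 1"
  shows "cmod (airy_coeff \<mu> n) \<le> 1 / fact n"
proof (induction n)
  case (Suc n)
  have "cmod (airy_coeff \<mu> (Suc n)) = cmod (airy_coeff \<mu> n) / ((real n + 1) * (9 * real n + \<mu>))"
    using assms by (simp add: norm_divide norm_mult del: of_real_mult of_real_add)
  also have "\<dots> \<le> (1 / fact n) / ((real n + 1) * 1)"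
    using assms Suc by (intro frac_le mult_left_mono mult_pos_pos) auto
  finally show ?case by (simp add: field_simps)
qed simp

lemma summable_airy:
  assumes "\<mu> \<ge> 1"
  shows "summable (\<lambda>n. airy_coeff \<mu> n * x ^ n)"
proof (rule summable_comparison_test')
  show "summable (\<lambda>n. (cmod x ^ n) /\<^sub>R fact n)"
    by (rule summable_exp_generic)
  show "cmod (airy_coeff \<mu> n * x ^ n) \<le> (cmod x ^ n) /\<^sub>R fact n" if "n \<ge> 0" for n
    using mult_right_mono[OF airy_coeff_bound[OF assms, of n], of "cmod x ^ n"]
    by (simp add: norm_mult norm_power field_simps)
qed

definition airy_series' :: "real \<Rightarrow> complex \<Rightarrow> complex" where
  "airy_series' \<mu> x = (\<Sum>n. diffs (airy_coeff \<mu>) n * x ^ n)"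

definition airy_series'' :: "real \<Rightarrow> complex \<Rightarrow> complex" where
  "airy_series'' \<mu> x = (\<Sum>n. diffs (diffs (airy_coeff \<mu>)) n * x ^ n)"

lemma airy_series_deriv:
  assumes "\<mu> \<ge> 1"
  shows "(airy_series \<mu> has_field_derivative airy_series' \<mu> x) (at x)"
    and "(airy_series' \<mu> has_field_derivative airy_series'' \<mu> x) (at x)"
proof -
  show "(airy_series \<mu> has_field_derivative airy_series' \<mu> x) (at x)"
    unfolding airy_series_def[abs_def] airy_series'_def
    by (rule termdiffs_strong_converges_everywhere[OF summable_airy[OF assms]])
  show "(airy_series' \<mu> has_field_derivative airy_series'' \<mu> x) (at x)"
    unfolding airy_series'_def[abs_def] airy_series''_def
    by (rule termdiffs_strong_converges_everywhere[OF termdiff_converges_all[OF summable_airy[OF assms]]])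
qed

text \<open>The second derivative of \<open>g (z ^ 3)\<close> is
  \<open>6 * z * g' + 9 * z ^ 4 * g''\<close>, that of \<open>z * g (z ^ 3)\<close> is
  \<open>12 * z ^ 2 * g' + 9 * z ^ 5 * g''\<close>. Airy's equation divided by a power of
  \<open>z\<close> is therefore this equation at \<open>x = z ^ 3\<close>, with \<open>\<mu>\<close>
  equal to 6 or 12.\<close>

lemma airy_series_ode:
  assumes "\<mu> \<ge> 1"
  shows "of_real \<mu> * airy_series' \<mu> x + 9 * x * airy_series'' \<mu> x = airy_series \<mu> x"
proof -
  let ?c = "airy_coeff \<mu>"
  note s0 = summable_airy[OF assms, of x]
  have s1: "summable (\<lambda>n. diffs ?c n * x ^ n)"
    by (rule termdiff_converges_all[OF summable_airy[OF assms]])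
  have s2: "summable (\<lambda>n. diffs (diffs ?c) n * x ^ n)"
    by (rule termdiff_converges_all[OF termdiff_converges_all[OF summable_airy[OF assms]]])
  have "(\<lambda>n. of_nat n * diffs ?c n * x ^ (n - 1)) sums airy_series'' \<mu> x"
    unfolding airy_series''_def using diffs_equiv[OF s2] by (simp add: mult.assoc)
  hence "(\<lambda>n. (9 * x) * (of_nat n * diffs ?c n * x ^ (n - 1))) sums (9 * x * airy_series'' \<mu> x)"
    by (rule sums_mult)
  moreover have "(\<lambda>n. of_real \<mu> * (diffs ?c n * x ^ n)) sums (of_real \<mu> * airy_series' \<mu> x)"
    unfolding airy_series'_def by (intro sums_mult summable_sums s1)
  ultimately have "(\<lambda>n. of_real \<mu> * (diffs ?c n * x ^ n) + (9 * x) * (of_nat n * diffs ?c n * x ^ (n - 1)))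
      sums (of_real \<mu> * airy_series' \<mu> x + 9 * x * airy_series'' \<mu> x)"
    by (intro sums_add)
  moreover have "of_real \<mu> * (diffs ?c n * x ^ n) + (9 * x) * (of_nat n * diffs ?c n * x ^ (n - 1)) = ?c n * x ^ n" for n
  proof -
    have nz: "of_real ((real n + 1) * (9 * real n + \<mu>)) \<noteq> (0::complex)"
      using assms by (simp only: of_real_eq_0_iff) (auto simp: add_eq_0_iff)
    have "of_real \<mu> * (diffs ?c n * x ^ n) + (9 * x) * (of_nat n * diffs ?c n * x ^ (n - 1))
        = diffs ?c n * (of_real \<mu> + 9 * of_nat n) * x ^ n"
      \<comment> \<open>The exponent \<open>n - 1\<close> truncates at \<open>n = 0\<close>, where
        the factor \<open>of_nat n\<close> vanishes.\<close>
      by (cases n) (auto simp: algebra_simps)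
    also have "diffs ?c n * (of_real \<mu> + 9 * of_nat n) = ?c (Suc n) * of_real ((real n + 1) * (9 * real n + \<mu>))"
      by (simp add: diffs_def del: airy_coeff.simps) (simp add: algebra_simps)?
    also have "\<dots> = ?c n" using nz by (simp only: airy_coeff.simps) simp
    finally show ?thesis .
  qed
  ultimately show ?thesis
    using sums_unique[of "\<lambda>n. ?c n * x ^ n"] by (simp add: airy_series_def)
qed

lemma airy_series_0: "airy_series \<mu> 0 = 1"
  unfolding airy_series_def using powser_zero[of "airy_coeff \<mu>"] by simp

definition "ay1 z = airy_series 6 (z ^ 3)"
definition "ay2 z = z * airy_series 12 (z ^ 3)"
definition "ay1' z = 3 * z ^ 2 * airy_series' 6 (z ^ 3)"
definition "ay2' z = airy_series 12 (z ^ 3) + 3 * z ^ 3 * airy_series' 12 (z ^ 3)"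

lemma ay_deriv:
  "(ay1 has_field_derivative ay1' z) (at z)" "(ay1' has_field_derivative z * ay1 z) (at z)"
  "(ay2 has_field_derivative ay2' z) (at z)" "(ay2' has_field_derivative z * ay2 z) (at z)"
proof -
  have D: "((\<lambda>z. airy_series \<mu> (z^3)) has_field_derivative airy_series' \<mu> (z^3) * (3 * z\<^sup>2)) (at z)"
    "((\<lambda>z. airy_series' \<mu> (z^3)) has_field_derivative airy_series'' \<mu> (z^3) * (3 * z\<^sup>2)) (at z)"
    if "\<mu> \<ge> 1" for \<mu>
    using that by (auto intro!: DERIV_chain2[OF airy_series_deriv(1)] DERIV_chain2[OF airy_series_deriv(2)] derivative_eq_intros)
  have "z * airy_series 6 (z^3) = z * (6 * airy_series' 6 (z^3) + 9 * z^3 * airy_series'' 6 (z^3))"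
    using airy_series_ode[of 6 "z^3"] by simp
  hence o6: "z * airy_series 6 (z^3) = 6 * z * airy_series' 6 (z^3) + 9 * z^4 * airy_series'' 6 (z^3)"
    by (simp add: eval_nat_numeral algebra_simps)
  have "z^2 * airy_series 12 (z^3) = z^2 * (12 * airy_series' 12 (z^3) + 9 * z^3 * airy_series'' 12 (z^3))"
    using airy_series_ode[of 12 "z^3"] by simp
  hence o12: "z^2 * airy_series 12 (z^3) = 12 * z^2 * airy_series' 12 (z^3) + 9 * z^5 * airy_series'' 12 (z^3)"
    by (simp add: eval_nat_numeral algebra_simps)
  show "(ay1 has_field_derivative ay1' z) (at z)"
    unfolding ay1_def[abs_def] ay1'_def using D(1)[of 6] by (simp add: mult_ac)
  show "(ay2 has_field_derivative ay2' z) (at z)"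
    unfolding ay2_def[abs_def] ay2'_def
    by (rule DERIV_cong[OF DERIV_mult[OF DERIV_ident D(1)]]) (auto simp: eval_nat_numeral algebra_simps)
  have p2: "((\<lambda>z. 3 * z\<^sup>2) has_field_derivative 6 * z) (at z)"
    and p3: "((\<lambda>z. 3 * z^3) has_field_derivative 9 * z\<^sup>2) (at z)"
    by (auto intro!: derivative_eq_intros)
  show "(ay1' has_field_derivative z * ay1 z) (at z)"
    unfolding ay1_def o6 ay1'_def[abs_def]
    by (rule DERIV_cong[OF DERIV_mult[OF p2 D(2)]]) (auto simp: eval_nat_numeral algebra_simps)
  have "z * ay2 z = airy_series' 12 (z^3) * (3 * z\<^sup>2) + (9 * z\<^sup>2 * airy_series' 12 (z^3) + airy_series'' 12 (z^3) * (3 * z\<^sup>2) * (3 * z^3))"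
    using o12 unfolding ay2_def by (simp add: eval_nat_numeral algebra_simps)
  thus "(ay2' has_field_derivative z * ay2 z) (at z)"
    unfolding ay2'_def[abs_def] using DERIV_add[OF D(1) DERIV_mult[OF p3 D(2)], of 12 12] by simp
qed

section \<open>Complex Gaussian integrals and moments of the Airy integrand\<close>

text \<open>A bound on the derivative alone is enough for dominated convergence: on the convex set
  \<open>S\<close> the mean value inequality carries it over to the difference quotients.\<close>

lemma has_field_derivative_integral:
  fixes f f' :: "complex \<Rightarrow> 'a \<Rightarrow> complex"
  assumes S: "open S" "convex S" "s \<in> S"
    and f: "\<And>z x. z \<in> S \<Longrightarrow> ((\<lambda>z. f z x) has_field_derivative f' z x) (at z)"
    and int: "\<And>z. z \<in> S \<Longrightarrow> integrable M (f z)"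
    and meas: "f' s \<in> borel_measurable M"
    and g: "integrable M g" "\<And>z x. z \<in> S \<Longrightarrow> norm (f' z x) \<le> g x"
  shows "((\<lambda>z. \<integral>x. f z x \<partial>M) has_field_derivative (\<integral>x. f' s x \<partial>M)) (at s)"
proof -
  have "((\<lambda>y. ((\<integral>x. f y x \<partial>M) - (\<integral>x. f s x \<partial>M)) / (y - s)) \<longlongrightarrow> (\<integral>x. f' s x \<partial>M)) (at s within S)"
    unfolding tendsto_at_iff_sequentially o_def
  proof (intro allI impI)
    fix X :: "nat \<Rightarrow> complex" assume X: "\<forall>i. X i \<in> S - {s}" "X \<longlonglongrightarrow> s"
    have "(\<lambda>i. \<integral>x. (f (X i) x - f s x) / (X i - s) \<partial>M) \<longlonglongrightarrow> (\<integral>x. f' s x \<partial>M)"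
    proof (rule integral_dominated_convergence[where w = g])
      show "f' s \<in> borel_measurable M" by fact
      show "(\<lambda>x. (f (X i) x - f s x) / (X i - s)) \<in> borel_measurable M" for i
        using X(1) S(3) borel_measurable_integrable[OF int] by auto
      show "integrable M g" by fact
      show "AE x in M. (\<lambda>i. (f (X i) x - f s x) / (X i - s)) \<longlonglongrightarrow> f' s x"
      proof (rule AE_I2)
        fix x
        have "((\<lambda>y. (f y x - f s x) / (y - s)) \<longlongrightarrow> f' s x) (at s within S)"
          using f[OF S(3), of x] at_within_open[OF S(3) S(1)] by (simp add: has_field_derivative_iff)
        thus "(\<lambda>i. (f (X i) x - f s x) / (X i - s)) \<longlonglongrightarrow> f' s x"
          using X unfolding tendsto_at_iff_sequentially o_def by blast
      qed
      show "AE x in M. norm ((f (X i) x - f s x) / (X i - s)) \<le> g x" for i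
      proof (rule AE_I2)
        fix x
        have "norm (f (X i) x - f s x) \<le> g x * norm (X i - s)"
          using field_differentiable_bound[OF S(2), of "\<lambda>z. f z x" "\<lambda>z. f' z x" "g x" s "X i"] X(1) S f g(2)
          by (auto intro: has_field_derivative_at_within simp: norm_minus_commute)
        thus "norm ((f (X i) x - f s x) / (X i - s)) \<le> g x"
          using X(1) by (auto simp: norm_divide divide_simps)
      qed
    qed
    moreover have "(\<integral>x. (f (X i) x - f s x) / (X i - s) \<partial>M) = ((\<integral>x. f (X i) x \<partial>M) - (\<integral>x. f s x \<partial>M)) / (X i - s)" for i
      using X(1) S(3) int by (subst integral_divide_zero) (auto intro!: Bochner_Integration.integral_diff)
    ultimately show "(\<lambda>i. ((\<integral>x. f (X i) x \<partial>M) - (\<integral>x. f s x \<partial>M)) / (X i - s)) \<longlonglongrightarrow> (\<integral>x. f' s x \<partial>M)"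
      using X(1) by auto
  qed
  thus ?thesis using at_within_open[OF S(3) S(1)] by (simp add: has_field_derivative_iff)
qed

lemma gauss_eq_normal_density:
  assumes "\<sigma> > 0"
  shows "exp (- \<sigma> * t\<^sup>2) = sqrt (pi / \<sigma>) * normal_density 0 (1 / sqrt (2 * \<sigma>)) t"
  using assms by (simp add: normal_density_def power_divide real_sqrt_divide field_simps)

lemma integrable_gauss_abs:
  assumes "\<sigma> > 0"
  shows "integrable lborel (\<lambda>t::real. \<bar>t\<bar> ^ n * exp (- \<sigma> * t\<^sup>2))"
proof -
  have "integrable lborel (\<lambda>t. sqrt (pi / \<sigma>) * (normal_density 0 (1 / sqrt (2 * \<sigma>)) t * \<bar>t - 0\<bar> ^ n))"
    using assms by (intro integrable_mult_right integrable_normal_moment_abs) auto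
  thus ?thesis unfolding gauss_eq_normal_density[OF assms] by (simp add: mult_ac)
qed

lemma integral_gauss_even:
  assumes "\<sigma> > 0"
  shows "(LINT t|lborel. t ^ (2 * k) * exp (- \<sigma> * t\<^sup>2)) = sqrt (pi / \<sigma>) * (fact (2 * k) / ((4 * \<sigma>) ^ k * fact k))"
proof -
  have "(LINT t|lborel. t ^ (2 * k) * exp (- \<sigma> * t\<^sup>2)) =
      (LINT t|lborel. sqrt (pi / \<sigma>) * (normal_density 0 (1 / sqrt (2 * \<sigma>)) t * (t - 0) ^ (2 * k)))"
    unfolding gauss_eq_normal_density[OF assms] by (simp add: mult_ac)
  also have "\<dots> = sqrt (pi / \<sigma>) * (fact (2 * k) / ((2 / (1 / sqrt (2 * \<sigma>))\<^sup>2) ^ k * fact k))"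
    by (subst integral_mult_right_zero, subst integral_normal_moment_even) (use assms in auto)
  finally show ?thesis using assms by (simp add: power_divide)
qed

lemma pow_gauss_tendsto:
  assumes "\<sigma> > 0"
  shows "((\<lambda>t::real. \<bar>t\<bar> ^ n * exp (- \<sigma> * t\<^sup>2)) \<longlongrightarrow> 0) at_top"
    and "((\<lambda>t::real. \<bar>t\<bar> ^ n * exp (- \<sigma> * t\<^sup>2)) \<longlongrightarrow> 0) at_bot"
proof -
  have "((\<lambda>t::real. t ^ n * exp (- \<sigma> * t\<^sup>2)) \<longlongrightarrow> 0) at_top"
    using assms by real_asymp
  thus 1: "((\<lambda>t::real. \<bar>t\<bar> ^ n * exp (- \<sigma> * t\<^sup>2)) \<longlongrightarrow> 0) at_top"
    by (rule Lim_transform_eventually) (use eventually_ge_at_top[of "0::real"] in eventually_elim, auto)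
  show "((\<lambda>t::real. \<bar>t\<bar> ^ n * exp (- \<sigma> * t\<^sup>2)) \<longlongrightarrow> 0) at_bot"
    unfolding at_bot_mirror filterlim_filtermap using 1 by simp
qed

text \<open>With \<open>\<gamma> = 1\<close> these are the moments of the Airy integrand on the steepest descent line through the saddle
  \<open>\<i> * s\<close>, where \<open>s\<^sup>2\<close> is the argument of the Airy function; \<open>\<gamma> = 0\<close> is the Gaussian comparison.\<close>

definition airy_kernel :: "real \<Rightarrow> nat \<Rightarrow> complex \<Rightarrow> real \<Rightarrow> complex" where
  "airy_kernel \<gamma> n s t = of_real t ^ n * exp (- s * (of_real t)\<^sup>2 + \<i> * of_real \<gamma> * of_real t ^ 3 / 3)"

definition airy_moment :: "real \<Rightarrow> nat \<Rightarrow> complex \<Rightarrow> complex" where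
  "airy_moment \<gamma> n s = (LINT t|lborel. airy_kernel \<gamma> n s t)"

lemma norm_airy_kernel: "cmod (airy_kernel \<gamma> n s t) = \<bar>t\<bar> ^ n * exp (- Re s * t\<^sup>2)"
proof -
  have "of_real t ^ 3 = complex_of_real (t^3)" "(of_real t)\<^sup>2 = complex_of_real (t\<^sup>2)" by simp_all
  thus ?thesis unfolding airy_kernel_def by (simp add: norm_mult norm_power del: of_real_power)
qed

lemma continuous_on_airy_kernel [continuous_intros]: "continuous_on A (airy_kernel \<gamma> n s)"
  unfolding airy_kernel_def[abs_def] by (intro continuous_intros) auto

lemma airy_kernel_measurable [measurable]: "airy_kernel \<gamma> n s \<in> borel_measurable borel"
  by (intro borel_measurable_continuous_onI continuous_intros)

lemma integrable_airy_kernel: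
  assumes "Re s > 0"
  shows "integrable lborel (airy_kernel \<gamma> n s)"
  by (rule Bochner_Integration.integrable_bound[OF integrable_gauss_abs[OF assms, of n]])
     (auto simp: norm_airy_kernel)

lemma airy_moment_deriv:
  assumes s: "Re s > 0"
  shows "(airy_moment \<gamma> n has_field_derivative - airy_moment \<gamma> (n + 2) s) (at s)"
proof -
  \<comment> \<open>This half plane stays away from \<open>Re z = 0\<close>, so that one Gaussian
    with exponent \<open>Re s / 2\<close> dominates at all its points.\<close>
  let ?S = "{z. Re z > Re s / 2}"
  have "((\<lambda>z. \<integral>t. airy_kernel \<gamma> n z t \<partial>lborel) has_field_derivative (\<integral>t. - airy_kernel \<gamma> (n + 2) s t \<partial>lborel)) (at s)"
  proof (rule has_field_derivative_integral[where S = ?S and f' = "\<lambda>z t. - airy_kernel \<gamma> (n+2) z t"])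
    show "open ?S" by (rule open_halfspace_Re_gt)
    show "convex ?S" by (rule convex_halfspace_Re_gt)
    show "integrable lborel (\<lambda>t. \<bar>t\<bar> ^ (n+2) * exp (- (Re s / 2) * t\<^sup>2))"
      by (rule integrable_gauss_abs) (use s in auto)
    show "norm (- airy_kernel \<gamma> (n+2) z t) \<le> \<bar>t\<bar> ^ (n+2) * exp (- (Re s / 2) * t\<^sup>2)" if "z \<in> ?S" for z t
      using that mult_right_mono[of "Re s / 2" "Re z" "t\<^sup>2"]
      by (auto simp: norm_airy_kernel simp del: power_Suc intro!: mult_left_mono)
    show "((\<lambda>z. airy_kernel \<gamma> n z t) has_field_derivative - airy_kernel \<gamma> (n+2) z t) (at z)" for z t
      unfolding airy_kernel_def by (auto intro!: derivative_eq_intros simp: power_add field_simps power2_eq_square)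
  qed (use s in \<open>auto intro!: integrable_airy_kernel\<close>)
  thus ?thesis by (simp add: airy_moment_def[abs_def])
qed

lemma integral_derivative_zero:
  fixes F f :: "real \<Rightarrow> complex"
  assumes "\<And>t. (F has_vector_derivative f t) (at t)" "\<And>t. isCont f t" "integrable lborel f"
    "(F \<longlongrightarrow> 0) at_top" "(F \<longlongrightarrow> 0) at_bot"
  shows "(LINT t|lborel. f t) = 0"
proof -
  have "(LBINT x=-\<infinity>..\<infinity>. f x) = 0 - 0"
  proof (rule interval_integral_FTC_integrable[where F = F])
    show "((F \<circ> real_of_ereal) \<longlongrightarrow> 0) (at_right (-\<infinity>))"
      using assms(5) unfolding at_right_MInf filterlim_filtermap by (simp add: o_def)
    show "((F \<circ> real_of_ereal) \<longlongrightarrow> 0) (at_left \<infinity>)"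
      using assms(4) unfolding at_left_PInf filterlim_filtermap by (simp add: o_def)
    show "set_integrable lborel (einterval (-\<infinity>) \<infinity>) f"
      using assms(3) by (simp add: set_integrable_def)
  qed (use assms in auto)
  thus ?thesis by (simp add: interval_lebesgue_integral_def set_lebesgue_integral_def)
qed

text \<open>Integration by parts: the \<open>t\<close>-derivative of
  \<open>airy_kernel \<gamma> n s\<close> integrates to zero. For \<open>\<gamma> = 1\<close> this
  expresses the moments 2 and 3 by the moments 0 and 1, for \<open>\<gamma> = 0\<close> it evaluates
  Gaussian moments. At \<open>n = 0\<close> the truncated index \<open>n - 1\<close> carries the
  coefficient 0.\<close>

lemma airy_moment_rec:
  assumes s: "Re s > 0"
  shows "\<i> * of_real \<gamma> * airy_moment \<gamma> (n + 2) s = 2 * s * airy_moment \<gamma> (n + 1) s - of_nat n * airy_moment \<gamma> (n - 1) s"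
proof -
  let ?f = "\<lambda>t. of_nat n * airy_kernel \<gamma> (n - 1) s t - 2 * s * airy_kernel \<gamma> (n + 1) s t + \<i> * of_real \<gamma> * airy_kernel \<gamma> (n + 2) s t"
  have [simp]: "integrable lborel (airy_kernel \<gamma> k s)" for k by (rule integrable_airy_kernel[OF s])
  have "(LINT t|lborel. ?f t) = 0"
  proof (rule integral_derivative_zero[where F = "airy_kernel \<gamma> n s"])
    show "(airy_kernel \<gamma> n s has_vector_derivative ?f t) (at t)" for t
    proof -
      define z where "z = complex_of_real t"
      define e where "e z = exp (- s * z\<^sup>2 + \<i> * of_real \<gamma> * z ^ 3 / 3)" for z
      have E: "(e has_field_derivative e z * (- 2 * s * z + \<i> * of_real \<gamma> * z\<^sup>2)) (at z)"
        unfolding e_def[abs_def] by (rule DERIV_fun_exp) (auto intro!: derivative_eq_intros simp: power2_eq_square field_simps)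
      have f: "?f t = of_nat n * (z ^ (n - 1) * e z) - 2 * s * (z ^ (n + 1) * e z) + \<i> * of_real \<gamma> * (z ^ (n + 2) * e z)"
        by (simp only: airy_kernel_def e_def z_def)
      have "((\<lambda>z. z ^ n * e z) has_field_derivative ?f t) (at z)"
        unfolding f by (rule DERIV_cong[OF DERIV_mult[OF DERIV_power[OF DERIV_ident] E]])
           (simp add: ring_distribs power_add power2_eq_square)
      from has_vector_derivative_real_field[OF this[unfolded z_def]] show ?thesis by (simp only: airy_kernel_def[abs_def] e_def)
    qed
    show "isCont ?f t" for t 
    proof -
      have "continuous_on UNIV ?f" by (intro continuous_on_add continuous_on_diff continuous_on_mult continuous_on_const continuous_on_airy_kernel)
      thus ?thesis by (simp add: continuous_on_eq_continuous_at)
    qed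
    show "integrable lborel ?f" by simp
    show "(airy_kernel \<gamma> n s \<longlongrightarrow> 0) at_top" "(airy_kernel \<gamma> n s \<longlongrightarrow> 0) at_bot"
      using pow_gauss_tendsto[OF s, of n] by (rule_tac tendsto_norm_zero_cancel, simp add: norm_airy_kernel)+
  qed
  also have "(LINT t|lborel. ?f t) = of_nat n * airy_moment \<gamma> (n - 1) s - 2 * s * airy_moment \<gamma> (n + 1) s + \<i> * of_real \<gamma> * airy_moment \<gamma> (n + 2) s"
    by (simp add: airy_moment_def)
  finally show ?thesis by (simp add: algebra_simps)
qed

lemma gauss_moments:
  assumes s: "Re s > 0"
  shows "airy_moment 0 1 s = 0" "airy_moment 0 3 s = 0" "airy_moment 0 2 s = airy_moment 0 0 s / (2 * s)"
  using airy_moment_rec[OF s, of 0 0] airy_moment_rec[OF s, of 0 1] airy_moment_rec[OF s, of 0 2] s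
  by (auto simp: field_simps numeral_2_eq_2 numeral_3_eq_3)

text \<open>The derivative formula and the second Gaussian moment give
  \<open>M' = - M / (2 * s)\<close>, so \<open>M * csqrt s\<close> is constant on the right half
  plane, where the principal root is holomorphic; the real integral at \<open>s = 1\<close> fixes
  the constant.\<close>

lemma gauss_integral_complex:
  assumes s: "Re s > 0"
  shows "airy_moment 0 0 s = of_real (sqrt pi) / csqrt s"
proof -
  let ?S = "{z. Re z > 0}"
  have nz: "z \<noteq> 0" "z \<notin> \<real>\<^sub>\<le>\<^sub>0" if "Re z > 0" for z using that by (auto simp: complex_nonpos_Reals_iff)
  have D: "((\<lambda>z. airy_moment 0 0 z * csqrt z) has_field_derivative 0) (at z)" if z: "Re z > 0" for z
  proof -
    have "((\<lambda>z. airy_moment 0 0 z * csqrt z) has_field_derivative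
      - airy_moment 0 2 z * csqrt z + inverse (2 * csqrt z) * airy_moment 0 0 z) (at z)"
      using DERIV_mult[OF airy_moment_deriv[OF z, of 0 0] has_field_derivative_csqrt[OF nz(2)[OF z]]]
      by (simp add: numeral_2_eq_2)
    moreover have "z = csqrt z * csqrt z" using power2_csqrt[of z] by (simp add: power2_eq_square)
    hence "- airy_moment 0 2 z * csqrt z + inverse (2 * csqrt z) * airy_moment 0 0 z = 0"
      using nz(1)[OF z] unfolding gauss_moments(3)[OF z]
      by (subst (2) \<open>z = _\<close>) (simp add: field_simps)
    ultimately show ?thesis by simp
  qed
  have "\<exists>c. \<forall>z\<in>?S. airy_moment 0 0 z * csqrt z = c"
    by (rule has_field_derivative_zero_constant)
       (use D convex_halfspace_Re_gt in \<open>auto intro: has_field_derivative_at_within\<close>)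
  then obtain c where c: "\<And>z. Re z > 0 \<Longrightarrow> airy_moment 0 0 z * csqrt z = c" by auto
  have "airy_moment 0 0 1 = (LINT t|lborel. complex_of_real (t ^ (2 * 0) * exp (- 1 * t\<^sup>2)))"
    unfolding airy_moment_def airy_kernel_def by (intro Bochner_Integration.integral_cong) (auto simp: exp_of_real[symmetric])
  also have "\<dots> = of_real (sqrt pi)"
    by (subst integral_complex_of_real, subst integral_gauss_even) auto
  finally have "c = of_real (sqrt pi)" using c[of 1] by simp
  thus ?thesis using c[OF s] nz(1)[OF s] by (simp add: field_simps)
qed

lemma airy_kernel_split:
  "airy_kernel \<gamma> n s t = of_real t ^ n * (exp (- s * (of_real t)\<^sup>2) * exp (\<i> * of_real \<gamma> * of_real t ^ 3 / 3))"
  by (simp only: airy_kernel_def mult_exp_exp)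

text \<open>Subtracting the third Gaussian moment, which is zero, removes the first-order term of
  \<open>exp (\<i> * t ^ 3 / 3)\<close>. The remainder \<open>t ^ 6 / 18\<close> gains the full
  factor \<open>Re s ^ 3\<close>; the crude bound \<open>\<bar>t\<bar> ^ 3 / 3\<close> would gain
  only its square root.\<close>

lemma airy_moment_0_estimate:
  assumes s: "Re s > 0"
  shows "cmod (airy_moment 1 0 s - airy_moment 0 0 s) \<le> sqrt (pi / Re s) * (5 / (48 * Re s ^ 3))"
proof -
  note [simp] = integrable_airy_kernel[OF s]
  have "airy_moment 1 0 s - airy_moment 0 0 s = airy_moment 1 0 s - airy_moment 0 0 s - \<i> / 3 * airy_moment 0 3 s"
    using gauss_moments(2)[OF s] by simp
  also have "\<dots> = (LINT t|lborel. airy_kernel 1 0 s t - airy_kernel 0 0 s t - \<i> / 3 * airy_kernel 0 3 s t)"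
    unfolding airy_moment_def by (simp add: Bochner_Integration.integral_diff)
  also have "cmod \<dots> \<le> (LINT t|lborel. t ^ (2 * 3) * exp (- Re s * t\<^sup>2) / 18)"
  proof (rule Bochner_Integration.integral_norm_bound_integral)
    show "integrable lborel (\<lambda>t. t ^ (2 * 3) * exp (- Re s * t\<^sup>2) / 18)"
      using integrable_gauss_abs[OF s, of "2 * 3"] by (simp add: power_even_abs)
    fix t :: real
    have "airy_kernel 1 0 s t - airy_kernel 0 0 s t - \<i> / 3 * airy_kernel 0 3 s t =
      exp (- s * (of_real t)\<^sup>2) * (iexp (t ^ 3 / 3) - (\<Sum>k\<le>1. (\<i> * of_real (t ^ 3 / 3)) ^ k / fact k))"
      by (simp add: airy_kernel_split algebra_simps)
    also have "cmod \<dots> \<le> exp (- Re s * t\<^sup>2) * (\<bar>t ^ 3 / 3\<bar> ^ Suc 1 / fact (Suc 1))"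
      unfolding norm_mult by (intro mult_mono iexp_approx1) (auto simp flip: of_real_power)
    also have "\<dots> = t ^ (2 * 3) * exp (- Re s * t\<^sup>2) / 18"
      by (simp add: power2_abs power_divide flip: power_mult)
    finally show "cmod (airy_kernel 1 0 s t - airy_kernel 0 0 s t - \<i> / 3 * airy_kernel 0 3 s t)
        \<le> t ^ (2 * 3) * exp (- Re s * t\<^sup>2) / 18" .
  qed simp
  also have "\<dots> = sqrt (pi / Re s) * (5 / (48 * Re s ^ 3))"
    unfolding integral_divide_zero integral_gauss_even[OF s] by (simp add: fact_numeral power_mult_distrib field_simps)
  finally show ?thesis .
qed

text \<open>The first Gaussian moment vanishes, so the zeroth-order remainder of the exponential
  suffices: in \<open>airy_V\<close> this moment stands beside the larger
  \<open>s * airy_moment 1 0 s\<close>.\<close>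

lemma airy_moment_1_estimate:
  assumes s: "Re s > 0"
  shows "cmod (airy_moment 1 1 s) \<le> sqrt (pi / Re s) * (1 / (4 * Re s ^ 2))"
proof -
  note [simp] = integrable_airy_kernel[OF s]
  have "airy_moment 1 1 s = airy_moment 1 1 s - airy_moment 0 1 s"
    using gauss_moments(1)[OF s] by simp
  also have "\<dots> = (LINT t|lborel. airy_kernel 1 1 s t - airy_kernel 0 1 s t)"
    unfolding airy_moment_def by (simp add: Bochner_Integration.integral_diff)
  also have "cmod \<dots> \<le> (LINT t|lborel. t ^ (2 * 2) * exp (- Re s * t\<^sup>2) / 3)"
  proof (rule Bochner_Integration.integral_norm_bound_integral)
    show "integrable lborel (\<lambda>t. t ^ (2 * 2) * exp (- Re s * t\<^sup>2) / 3)"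
      using integrable_gauss_abs[OF s, of "2 * 2"] by (simp add: power_even_abs)
    fix t :: real
    have "airy_kernel 1 1 s t - airy_kernel 0 1 s t =
      of_real t * exp (- s * (of_real t)\<^sup>2) * (iexp (t ^ 3 / 3) - (\<Sum>k\<le>0. (\<i> * of_real (t ^ 3 / 3)) ^ k / fact k))"
      by (simp add: airy_kernel_split algebra_simps)
    also have "cmod \<dots> \<le> \<bar>t\<bar> * exp (- Re s * t\<^sup>2) * (\<bar>t ^ 3 / 3\<bar> ^ Suc 0 / fact (Suc 0))"
      unfolding norm_mult by (intro mult_mono iexp_approx1) (auto simp flip: of_real_power)
    also have "\<dots> = t ^ (2 * 2) * exp (- Re s * t\<^sup>2) / 3"
    proof -
      have "\<bar>t\<bar> * \<bar>t ^ 3\<bar> = \<bar>t ^ 4\<bar>" by (simp add: eval_nat_numeral flip: abs_mult)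
      thus ?thesis by simp
    qed
    finally show "cmod (airy_kernel 1 1 s t - airy_kernel 0 1 s t) \<le> t ^ (2 * 2) * exp (- Re s * t\<^sup>2) / 3" .
  qed simp
  also have "\<dots> = sqrt (pi / Re s) * (1 / (4 * Re s ^ 2))"
    unfolding integral_divide_zero integral_gauss_even[OF s] by (simp add: fact_numeral power_mult_distrib field_simps)
  finally show ?thesis .
qed

section \<open>The entire Airy function and its integral representation\<close>

text \<open>On the shifted contour \<open>t + \<i> * s\<close> the Airy phase at the argument
  \<open>s\<^sup>2\<close> becomes
  \<open>- 2 / 3 * s ^ 3 - s * t\<^sup>2 + \<i> * t ^ 3 / 3\<close>. Thus \<open>airy_U s\<close>
  and \<open>airy_V s\<close> stand for \<open>2 * pi\<close> times the usual Airy function and its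
  derivative at \<open>s\<^sup>2\<close>.\<close>

definition "airy_U s = exp (- 2 / 3 * s ^ 3) * airy_moment 1 0 s"
definition "airy_V s = exp (- 2 / 3 * s ^ 3) * (\<i> * airy_moment 1 1 s - s * airy_moment 1 0 s)"

text \<open>This is Airy's first-order system pulled back by \<open>s\<^sup>2\<close>, hence the
  chain rule factor \<open>2 * s\<close> in both components.\<close>

lemma airy_UV_deriv:
  assumes s: "Re s > 0"
  shows "(airy_U has_field_derivative 2 * s * airy_V s) (at s)"
    and "(airy_V has_field_derivative 2 * s ^ 3 * airy_U s) (at s)"
proof -
  have E: "((\<lambda>s. exp (- 2 / 3 * s ^ 3)) has_field_derivative exp (- 2 / 3 * s ^ 3) * (- 2 * s\<^sup>2)) (at s)"
    by (rule DERIV_fun_exp) (auto intro!: derivative_eq_intros)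
  have r2: "airy_moment 1 2 s = - 2 * \<i> * s * airy_moment 1 1 s"
    using airy_moment_rec[OF s, of 1 0] by (simp add: complex_eq_iff numeral_2_eq_2 algebra_simps)
  have r3: "airy_moment 1 3 s = \<i> * airy_moment 1 0 s - 2 * \<i> * s * airy_moment 1 2 s"
    using airy_moment_rec[OF s, of 1 1] by (simp add: complex_eq_iff numeral_2_eq_2 numeral_3_eq_3 algebra_simps)
  have M: "(airy_moment 1 0 has_field_derivative - airy_moment 1 2 s) (at s)"
    "(airy_moment 1 1 has_field_derivative - airy_moment 1 3 s) (at s)"
    using airy_moment_deriv[OF s, of 1 0] airy_moment_deriv[OF s, of 1 1] by (auto simp: numeral_2_eq_2 numeral_3_eq_3)
  show "(airy_U has_field_derivative 2 * s * airy_V s) (at s)"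
    unfolding airy_U_def[abs_def]
    by (rule DERIV_cong[OF DERIV_mult[OF E M(1)]]) (simp add: r2 airy_V_def algebra_simps power2_eq_square)
  have V: "((\<lambda>s. \<i> * airy_moment 1 1 s - s * airy_moment 1 0 s) has_field_derivative
     (\<i> * (- airy_moment 1 3 s) - (s * (- airy_moment 1 2 s) + airy_moment 1 0 s))) (at s)"
    by (rule DERIV_cong[OF DERIV_diff[OF DERIV_cmult[OF M(2)] DERIV_mult[OF DERIV_ident M(1)]]]) simp
  show "(airy_V has_field_derivative 2 * s ^ 3 * airy_U s) (at s)"
    unfolding airy_V_def[abs_def]
    by (rule DERIV_cong[OF DERIV_mult[OF E V]])
       (simp add: r2 r3 airy_U_def algebra_simps power2_eq_square power3_eq_cube)
qed

lemma ay_wronskian: "ay1 z * ay2' z - ay1' z * ay2 z = 1"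
proof -
  have "((\<lambda>z. ay1 z * ay2' z - ay1' z * ay2 z) has_field_derivative 0) (at z within UNIV)" for z
    by (rule derivative_eq_intros ay_deriv refl)+ (simp add: algebra_simps)
  from has_field_derivative_zero_constant[OF convex_UNIV this] obtain c where
    c: "\<And>z. ay1 z * ay2' z - ay1' z * ay2 z = c" by auto
  have "c = 1" using c[of 0] by (simp add: ay1_def ay2'_def ay2_def airy_series_0)
  thus ?thesis using c by simp
qed

text \<open>Cramer's rule with Wronskian 1: these are the coefficients for which the combination of
  \<open>ay1\<close> and \<open>ay2\<close> has the data \<open>airy_U 1\<close>,
  \<open>airy_V 1\<close> at the point 1.\<close>

definition "airy_c1 = airy_U 1 * ay2' 1 - airy_V 1 * ay2 1"
definition "airy_c2 = airy_V 1 * ay1 1 - airy_U 1 * ay1' 1"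

text \<open>This is \<open>2 * sqrt pi\<close> times the usual Airy function.\<close>

definition Airy :: "complex \<Rightarrow> complex" where
  "Airy z = (airy_c1 * ay1 z + airy_c2 * ay2 z) / of_real (sqrt pi)"
definition Airy' :: "complex \<Rightarrow> complex" where
  "Airy' z = (airy_c1 * ay1' z + airy_c2 * ay2' z) / of_real (sqrt pi)"

lemma Airy_deriv:
  "(Airy has_field_derivative Airy' z) (at z)" "(Airy' has_field_derivative z * Airy z) (at z)"
  unfolding Airy_def[abs_def] Airy'_def[abs_def]
  by (rule DERIV_cong[OF DERIV_cdivide[OF DERIV_add[OF DERIV_cmult[OF ay_deriv(1)] DERIV_cmult[OF ay_deriv(3)]]]], simp)
    (rule DERIV_cong[OF DERIV_cdivide[OF DERIV_add[OF DERIV_cmult[OF ay_deriv(2)] DERIV_cmult[OF ay_deriv(4)]]]],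
     simp add: algebra_simps)

text \<open>Uniqueness for Airy's equation in Wronskian form: the Wronskians of
  \<open>(airy_U, airy_V)\<close> with \<open>ay1\<close> and \<open>ay2\<close> at
  \<open>s\<^sup>2\<close> have derivative zero on the half plane \<open>Re s > 0\<close>, so they
  keep their values at \<open>s = 1\<close>. The integral exists only there, while
  \<open>Airy\<close> is entire.\<close>

lemma Airy_square:
  assumes s: "Re s > 0"
  shows "Airy (s\<^sup>2) = airy_U s / of_real (sqrt pi)" "Airy' (s\<^sup>2) = airy_V s / of_real (sqrt pi)"
proof -
  let ?S = "{z. Re z > 0}"
  have sq: "((\<lambda>s. s\<^sup>2) has_field_derivative 2 * z) (at z)" for z :: complex
    by (auto intro!: derivative_eq_intros)
  note ch = DERIV_chain2[OF _ sq]
  have "((\<lambda>z. airy_U z * ay2' (z\<^sup>2) - airy_V z * ay2 (z\<^sup>2)) has_field_derivative 0) (at z within ?S)" if "z \<in> ?S" for z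
    apply (rule has_field_derivative_at_within)
    by (rule DERIV_cong[OF DERIV_diff[OF DERIV_mult[OF airy_UV_deriv(1) ch[OF ay_deriv(4)]] DERIV_mult[OF airy_UV_deriv(2) ch[OF ay_deriv(3)]]]])
       (use that in \<open>auto simp: algebra_simps power2_eq_square power3_eq_cube\<close>)
  from has_field_derivative_zero_constant[OF convex_halfspace_Re_gt this] obtain c where
    "\<And>z. Re z > 0 \<Longrightarrow> airy_U z * ay2' (z\<^sup>2) - airy_V z * ay2 (z\<^sup>2) = c" by auto
  from this[of 1] this[OF s] have 1: "airy_U s * ay2' (s\<^sup>2) - airy_V s * ay2 (s\<^sup>2) = airy_c1"
    by (simp add: airy_c1_def)
  have "((\<lambda>z. airy_V z * ay1 (z\<^sup>2) - airy_U z * ay1' (z\<^sup>2)) has_field_derivative 0) (at z within ?S)" if "z \<in> ?S" for z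
    apply (rule has_field_derivative_at_within)
    by (rule DERIV_cong[OF DERIV_diff[OF DERIV_mult[OF airy_UV_deriv(2) ch[OF ay_deriv(1)]] DERIV_mult[OF airy_UV_deriv(1) ch[OF ay_deriv(2)]]]])
       (use that in \<open>auto simp: algebra_simps power2_eq_square power3_eq_cube\<close>)
  from has_field_derivative_zero_constant[OF convex_halfspace_Re_gt this] obtain c where
    "\<And>z. Re z > 0 \<Longrightarrow> airy_V z * ay1 (z\<^sup>2) - airy_U z * ay1' (z\<^sup>2) = c" by auto
  from this[of 1] this[OF s] have 2: "airy_V s * ay1 (s\<^sup>2) - airy_U s * ay1' (s\<^sup>2) = airy_c2"
    by (simp add: airy_c2_def)
  have "airy_c1 * ay1 (s\<^sup>2) + airy_c2 * ay2 (s\<^sup>2) = airy_U s * (ay1 (s\<^sup>2) * ay2' (s\<^sup>2) - ay1' (s\<^sup>2) * ay2 (s\<^sup>2))"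
    unfolding 1[symmetric] 2[symmetric] by (simp add: algebra_simps)
  thus "Airy (s\<^sup>2) = airy_U s / of_real (sqrt pi)" by (simp add: Airy_def ay_wronskian)
  have "airy_c1 * ay1' (s\<^sup>2) + airy_c2 * ay2' (s\<^sup>2) = airy_V s * (ay1 (s\<^sup>2) * ay2' (s\<^sup>2) - ay1' (s\<^sup>2) * ay2 (s\<^sup>2))"
    unfolding 1[symmetric] 2[symmetric] by (simp add: algebra_simps)
  thus "Airy' (s\<^sup>2) = airy_V s / of_real (sqrt pi)" by (simp add: Airy'_def ay_wronskian)
qed

text \<open>A twelfth root of unity; the paper's \<open>\<omega>\<close> is \<open>tau ^ 4\<close>.\<close>

definition tau :: complex where "tau = cis (pi / 6)"

text \<open>The relation \<open>tau ^ 4 = tau\<^sup>2 - 1\<close> is the twelfth cyclotomic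
  equation. By it \<open>1 - tau\<^sup>2\<close> is the inverse of \<open>tau\<^sup>2\<close>, the
  form in which the rotation by \<open>- pi / 3\<close> appears below.\<close>

lemma tau_simps: "tau ^ 3 = \<i>" "tau ^ 4 = tau\<^sup>2 - 1" "tau \<noteq> 0" "cmod tau = 1"
  and tau_Complex: "tau = Complex (sqrt 3 / 2) (1 / 2)"
proof -
  show t: "tau = Complex (sqrt 3 / 2) (1 / 2)"
    by (simp add: tau_def complex_eq_iff cos_30 sin_30)
  show c: "cmod tau = 1" by (simp add: tau_def)
  thus "tau \<noteq> 0" by auto
  show "tau ^ 3 = \<i>" by (simp add: tau_def Complex.DeMoivre)
  show "tau ^ 4 = tau\<^sup>2 - 1"
    by (simp add: t complex_eq_iff eval_nat_numeral algebra_simps)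
qed

lemma tau_12: "tau ^ 12 = 1" and tau_6: "tau ^ 6 = - 1" and tau_8: "tau ^ 8 = - (tau\<^sup>2)"
proof -
  have "tau ^ 6 = (tau ^ 3)\<^sup>2" by (simp flip: power_mult)
  thus 6: "tau ^ 6 = - 1" by (simp add: tau_simps)
  have "tau ^ 12 = (tau ^ 6)\<^sup>2" by (simp flip: power_mult)
  thus "tau ^ 12 = 1" by (simp add: 6)
  have "tau ^ 8 = tau ^ 6 * tau\<^sup>2" by (simp flip: power_add)
  thus "tau ^ 8 = - (tau\<^sup>2)" by (simp add: 6)
qed

section \<open>Connection formula, asymptotics in sectors, Wronskians\<close>

text \<open>Rotation by a cube root of unity fixes \<open>z ^ 3\<close>, hence fixes
  \<open>ay1\<close> and multiplies \<open>ay2\<close> by the root. Both coefficients become sums of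
  the three cube roots of unity.\<close>

lemma airy_connection: "Airy z + tau ^ 4 * Airy (tau ^ 4 * z) + tau ^ 8 * Airy (tau ^ 8 * z) = 0"
proof -
  have 3: "(tau ^ 4 * z) ^ 3 = z ^ 3" "(tau ^ 8 * z) ^ 3 = z ^ 3"
    using tau_12 by (simp_all add: power_mult_distrib flip: power_mult)
       (metis mult_1 numeral_Bit0 power_add tau_12)
  have "1 + tau ^ 4 + tau ^ 8 = 0" by (simp add: tau_8 tau_simps)
  moreover have "1 + (tau ^ 4) * (tau ^ 4) + tau ^ 8 * tau ^ 8 = 0"
  proof -
    have "tau ^ 8 * tau ^ 8 = tau ^ 12 * tau ^ 4" by (simp flip: power_add)
    thus ?thesis using calculation by (simp add: tau_12 add_ac flip: power_add)
  qed
  moreover have "Airy z + tau ^ 4 * Airy (tau ^ 4 * z) + tau ^ 8 * Airy (tau ^ 8 * z)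
    = (airy_c1 * ay1 z * (1 + tau ^ 4 + tau ^ 8) + airy_c2 * ay2 z * (1 + tau ^ 4 * tau ^ 4 + tau ^ 8 * tau ^ 8)) / of_real (sqrt pi)"
    unfolding Airy_def ay1_def ay2_def 3 by (simp add: field_simps)
  ultimately show ?thesis by simp
qed

lemma airy_asymptotics_Re:
  assumes pos: "Re s > 0"
  obtains e where "Airy (s\<^sup>2) = exp (- 2 / 3 * s ^ 3) / csqrt s * (1 + e)"
    "cmod e \<le> sqrt (cmod s / Re s) * (5 / (48 * Re s ^ 3))"
proof -
  define e where "e = csqrt s * (airy_moment 1 0 s - airy_moment 0 0 s) / of_real (sqrt pi)"
  have nz: "csqrt s \<noteq> 0" using pos by auto
  have M: "airy_moment 1 0 s = of_real (sqrt pi) / csqrt s * (1 + e)"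
    using nz by (simp add: e_def gauss_integral_complex[OF pos] field_simps)
  have "cmod e = sqrt (cmod s) * cmod (airy_moment 1 0 s - airy_moment 0 0 s) / sqrt pi"
    by (simp add: e_def norm_mult norm_divide)
  also have "\<dots> \<le> sqrt (cmod s) * (sqrt (pi / Re s) * (5 / (48 * Re s ^ 3))) / sqrt pi"
    by (intro divide_right_mono mult_left_mono airy_moment_0_estimate[OF pos]) auto
  also have "\<dots> = sqrt (cmod s / Re s) * (5 / (48 * Re s ^ 3))"
    by (simp add: real_sqrt_divide)
  finally have "cmod e \<le> sqrt (cmod s / Re s) * (5 / (48 * Re s ^ 3))" .
  moreover have "Airy (s\<^sup>2) = exp (- 2 / 3 * s ^ 3) / csqrt s * (1 + e)"
    unfolding Airy_square[OF pos] airy_U_def M by simp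
  ultimately show ?thesis using that by blast
qed

lemma airy_asymptotics:
  assumes s: "Re s \<ge> cmod s / 2" "s \<noteq> 0"
  obtains e where "Airy (s\<^sup>2) = exp (- 2 / 3 * s ^ 3) / csqrt s * (1 + e)" "cmod e \<le> 3 / cmod s ^ 3"
proof -
  have pos: "Re s > 0" using s by (smt (verit) divide_pos_pos zero_less_norm_iff)
  obtain e where e: "Airy (s\<^sup>2) = exp (- 2 / 3 * s ^ 3) / csqrt s * (1 + e)"
    "cmod e \<le> sqrt (cmod s / Re s) * (5 / (48 * Re s ^ 3))"
    by (rule airy_asymptotics_Re[OF pos])
  note e(2)
  also have "sqrt (cmod s / Re s) * (5 / (48 * Re s ^ 3)) \<le> 2 * (5 / (48 * (cmod s / 2) ^ 3))"
  proof (intro mult_mono divide_left_mono power_mono)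
    have "sqrt (cmod s / Re s) \<le> sqrt (2\<^sup>2)"
      using s pos by (intro real_sqrt_le_mono) (auto simp: field_simps)
    thus "sqrt (cmod s / Re s) \<le> 2" by simp
  qed (use s pos in auto)
  also have "\<dots> \<le> 3 / cmod s ^ 3" using s by (simp add: power_divide field_simps)
  finally show ?thesis using e(1) that by blast
qed

text \<open>The aperture 1/4 is dictated by \<open>airy_asymptotics_g\<close>, whose rotated sector
  reaches 75 degrees, with cosine just above 1/4. It also gives \<open>kp\<close> and
  \<open>km\<close> room to pass slightly beyond 60 degrees.\<close>

lemma airy_asymptotics_wide:
  assumes s: "Re s \<ge> cmod s / 4" "s \<noteq> 0"
  obtains e where "Airy (s\<^sup>2) = exp (- 2 / 3 * s ^ 3) / csqrt s * (1 + e)" "cmod e \<le> 14 / cmod s ^ 3"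
proof -
  have pos: "Re s > 0" using s by (smt (verit) divide_pos_pos zero_less_norm_iff)
  obtain e where e: "Airy (s\<^sup>2) = exp (- 2 / 3 * s ^ 3) / csqrt s * (1 + e)"
    "cmod e \<le> sqrt (cmod s / Re s) * (5 / (48 * Re s ^ 3))"
    by (rule airy_asymptotics_Re[OF pos])
  note e(2)
  also have "sqrt (cmod s / Re s) * (5 / (48 * Re s ^ 3)) \<le> 2 * (5 / (48 * (cmod s / 4) ^ 3))"
  proof (intro mult_mono divide_left_mono power_mono)
    have "sqrt (cmod s / Re s) \<le> sqrt (2\<^sup>2)"
      using s pos by (intro real_sqrt_le_mono) (auto simp: field_simps)
    thus "sqrt (cmod s / Re s) \<le> 2" by simp
  qed (use s pos in auto)
  also have "\<dots> \<le> 14 / cmod s ^ 3" using s by (simp add: power_divide field_simps)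
  finally show ?thesis using e(1) that by blast
qed

lemma airy_deriv_asymptotics:
  assumes s: "Re s \<ge> cmod s / 2" "s \<noteq> 0"
  obtains e where "Airy' (s\<^sup>2) = - s * exp (- 2 / 3 * s ^ 3) / csqrt s * (1 + e)" "cmod e \<le> 6 / cmod s ^ 3"
proof -
  have pos: "Re s > 0" using s by (smt (verit) divide_pos_pos zero_less_norm_iff)
  obtain e where e: "Airy (s\<^sup>2) = exp (- 2 / 3 * s ^ 3) / csqrt s * (1 + e)" "cmod e \<le> 3 / cmod s ^ 3"
    using airy_asymptotics[OF assms] by blast
  have nz: "csqrt s \<noteq> 0" using s by simp
  define e' where "e' = e - csqrt s * \<i> * airy_moment 1 1 s / (s * of_real (sqrt pi))"
  have 1: "airy_moment 1 0 s = of_real (sqrt pi) / csqrt s * (1 + e)"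
  proof -
    have "exp (- 2 / 3 * s ^ 3) * airy_moment 1 0 s = exp (- 2 / 3 * s ^ 3) * (of_real (sqrt pi) / csqrt s * (1 + e))"
      using e(1) unfolding Airy_square[OF pos] airy_U_def by (simp add: field_simps)
    thus ?thesis by (rule mult_left_cancel[OF exp_not_eq_zero, THEN iffD1])
  qed
  have V: "\<i> * airy_moment 1 1 s - s * airy_moment 1 0 s = - s * of_real (sqrt pi) / csqrt s * (1 + e')"
    unfolding 1 using nz s by (simp add: e'_def field_simps)
  have "cmod (csqrt s * \<i> * airy_moment 1 1 s / (s * of_real (sqrt pi)))
      = sqrt (cmod s) * cmod (airy_moment 1 1 s) / (cmod s * sqrt pi)"
    by (simp add: norm_mult norm_divide)
  also have "\<dots> \<le> sqrt (cmod s) * (sqrt (pi / Re s) * (1 / (4 * Re s ^ 2))) / (cmod s * sqrt pi)"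
    by (intro divide_right_mono mult_left_mono airy_moment_1_estimate[OF pos]) auto
  also have "\<dots> = sqrt (cmod s / Re s) * (1 / (4 * Re s ^ 2)) / cmod s"
    by (simp add: real_sqrt_divide)
  also have "\<dots> \<le> 2 * (1 / (4 * (cmod s / 2) ^ 2)) / cmod s"
  proof (intro mult_mono divide_left_mono divide_right_mono power_mono)
    have "sqrt (cmod s / Re s) \<le> sqrt (2\<^sup>2)"
      using s pos by (intro real_sqrt_le_mono) (auto simp: field_simps)
    thus "sqrt (cmod s / Re s) \<le> 2" by simp
  qed (use s pos in auto)
  also have "\<dots> \<le> 3 / cmod s ^ 3" using s by (simp add: power_divide field_simps eval_nat_numeral)
  finally have "cmod e' \<le> 6 / cmod s ^ 3"
    unfolding e'_def using e(2) norm_triangle_ineq4 by (smt (verit) add_divide_distrib)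
  moreover have "Airy' (s\<^sup>2) = - s * exp (- 2 / 3 * s ^ 3) / csqrt s * (1 + e')"
    unfolding Airy_square[OF pos] airy_V_def V by simp
  ultimately show ?thesis using that by blast
qed

text \<open>Rotating the first quadrant by \<open>- pi / 3\<close> does not cross the cut, so the
  principal root is rotated by half the angle; only the sign of the real part has to be checked. The
  factor \<open>(1 - tau\<^sup>2) * tau\<close> is the inverse of \<open>tau\<close>.\<close>

lemma csqrt_rotate:
  assumes "Re s > 0" "Im s \<ge> 0"
  shows "csqrt ((1 - tau\<^sup>2) * s) = (1 - tau\<^sup>2) * tau * csqrt s"
proof -
  define r where "r = csqrt s"
  have r: "r\<^sup>2 = s" "Re r > 0" "Im r \<ge> 0"
  proof -
    show "r\<^sup>2 = s" by (simp add: r_def)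
    have "cmod s + Re s > 0" using assms by (intro add_nonneg_pos) auto
    thus "Re r > 0" by (simp add: r_def)
    show "Im r \<ge> 0" using assms by (simp add: r_def complex_Re_le_cmod)
  qed
  have "csqrt (((1 - tau\<^sup>2) * tau * r)\<^sup>2) = (1 - tau\<^sup>2) * tau * r"
  proof (rule csqrt_square)
    have "Re ((1 - tau\<^sup>2) * tau * r) = sqrt 3 / 2 * Re r + Im r / 2"
      by (simp add: tau_Complex power2_eq_square field_simps)
    thus "0 < Re ((1 - tau\<^sup>2) * tau * r) \<or> Re ((1 - tau\<^sup>2) * tau * r) = 0 \<and> 0 \<le> Im ((1 - tau\<^sup>2) * tau * r)"
      using r by (simp add: add_pos_nonneg)
  qed
  moreover have "((1 - tau\<^sup>2) * tau)\<^sup>2 = 1 - tau\<^sup>2"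
  proof -
    have "((1 - tau\<^sup>2) * tau)\<^sup>2 = (- (tau ^ 4))\<^sup>2 * tau\<^sup>2" by (simp add: tau_simps power_mult_distrib)
    also have "\<dots> = tau ^ 6 * tau ^ 4" by (simp flip: power_mult power_add)
    finally show ?thesis by (simp add: tau_6 tau_simps)
  qed
  ultimately show ?thesis using r by (simp add: power_mult_distrib r_def)
qed

lemma csqrt_rotate':
  assumes "Re s > 0" "Im s \<ge> 0"
  shows "csqrt (- (tau\<^sup>2) * s) = (1 - tau\<^sup>2) * csqrt s"
proof -
  define r where "r = csqrt s"
  have r: "r\<^sup>2 = s" "Re r > 0" "Im r \<ge> 0"
  proof -
    show "r\<^sup>2 = s" by (simp add: r_def)
    have "cmod s + Re s > 0" using assms by (intro add_nonneg_pos) auto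
    thus "Re r > 0" by (simp add: r_def)
    show "Im r \<ge> 0" using assms by (simp add: r_def complex_Re_le_cmod)
  qed
  have "csqrt (((1 - tau\<^sup>2) * r)\<^sup>2) = (1 - tau\<^sup>2) * r"
  proof (rule csqrt_square)
    have "Re ((1 - tau\<^sup>2) * r) = Re r / 2 + sqrt 3 / 2 * Im r"
      by (simp add: tau_Complex power2_eq_square field_simps)
    thus "0 < Re ((1 - tau\<^sup>2) * r) \<or> Re ((1 - tau\<^sup>2) * r) = 0 \<and> 0 \<le> Im ((1 - tau\<^sup>2) * r)"
      using r by (simp add: add_pos_nonneg)
  qed
  moreover have "(1 - tau\<^sup>2)\<^sup>2 = - (tau\<^sup>2)"
    by (simp add: power2_diff tau_simps flip: power_mult)
  ultimately show ?thesis using r by (simp add: power_mult_distrib r_def)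
qed

lemma tau_inverse: "(1 - tau\<^sup>2) * tau * tau = 1" "(1 - tau\<^sup>2) * tau\<^sup>2 = 1"
  "(1 - tau\<^sup>2) ^ 3 = - 1" "(1 - tau\<^sup>2)\<^sup>2 = - (tau\<^sup>2)" "(- (tau\<^sup>2)) ^ 3 = 1" "(- (tau\<^sup>2))\<^sup>2 = tau ^ 4"
proof -
  have 1: "1 - tau\<^sup>2 = - (tau ^ 4)" by (simp add: tau_simps)
  show "(1 - tau\<^sup>2) * tau * tau = 1" "(1 - tau\<^sup>2) * tau\<^sup>2 = 1"
    unfolding 1 using tau_6 by (simp_all add: mult.assoc flip: power_add power_Suc power_Suc2 power2_eq_square)
  show "(1 - tau\<^sup>2) ^ 3 = - 1" unfolding 1 by (simp add: tau_12 flip: power_mult)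
  show "(1 - tau\<^sup>2)\<^sup>2 = - (tau\<^sup>2)" unfolding 1 by (simp add: tau_8 flip: power_mult)
  show "(- (tau\<^sup>2)) ^ 3 = 1" by (simp add: tau_6 flip: power_mult)
  show "(- (tau\<^sup>2))\<^sup>2 = tau ^ 4" by (simp flip: power_mult)
qed

text \<open>The rotation by \<open>- pi / 3\<close> moves the first quadrant to angles between
  \<open>- pi / 3\<close> and \<open>pi / 6\<close>, where the cosine is at least 1/2.\<close>

lemma quadrant_rotate: 
  assumes "Re s > 0" "Im s \<ge> 0"
  shows "Re ((1 - tau\<^sup>2) * s) \<ge> cmod ((1 - tau\<^sup>2) * s) / 2"
proof -
  have 0: "cmod (1 - tau\<^sup>2) = 1"
    by (simp add: tau_Complex power2_eq_square cmod_def field_simps)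
  have "(cmod s)\<^sup>2 \<le> (Re s + sqrt 3 * Im s)\<^sup>2"
    using assms by (simp add: cmod_power2 power2_sum power_mult_distrib)
  hence "cmod s \<le> Re s + sqrt 3 * Im s" using assms by (simp add: power2_le_iff_abs_le abs_of_nonneg)
  thus ?thesis by (simp add: norm_mult 0, simp add: tau_Complex power2_eq_square field_simps)
qed

text \<open>Replacing \<open>s\<close> by its rotation through \<open>- pi / 3\<close> reverses the
  sign of \<open>s ^ 3\<close>. This gives the partner solution with the reciprocal exponential,
  uniformly up to the imaginary axis.\<close>

lemma airy_asymptotics_B:
  assumes "Re s > 0" "Im s \<ge> 0"
  obtains e where "Airy (- (tau\<^sup>2) * s\<^sup>2) = tau * exp (2 / 3 * s ^ 3) / csqrt s * (1 + e)" "cmod e \<le> 3 / cmod s ^ 3"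
proof -
  let ?t = "(1 - tau\<^sup>2) * s"
  have c: "cmod (1 - tau\<^sup>2) = 1"
    by (simp add: tau_Complex power2_eq_square cmod_def field_simps)
  have nz: "?t \<noteq> 0" using c assms by auto
  obtain e where e: "Airy (?t\<^sup>2) = exp (- 2 / 3 * ?t ^ 3) / csqrt ?t * (1 + e)" "cmod e \<le> 3 / cmod ?t ^ 3"
    using airy_asymptotics[OF quadrant_rotate[OF assms] nz] by blast
  have 1: "?t\<^sup>2 = - (tau\<^sup>2) * s\<^sup>2" "?t ^ 3 = - (s ^ 3)"
    by (simp_all only: power_mult_distrib tau_inverse) simp
  have inv: "inverse ((1 - tau\<^sup>2) * tau) = tau" using tau_inverse(1) by (metis inverse_unique)
  have 2: "exp (- 2 / 3 * ?t ^ 3) / csqrt ?t = tau * exp (2 / 3 * s ^ 3) / csqrt s"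
    unfolding csqrt_rotate[OF assms] 1 divide_inverse inverse_mult_distrib[of "(1 - tau\<^sup>2) * tau"] inv by (simp add: mult_ac)
  show ?thesis using e that[of e] unfolding 2 unfolding 1 by (simp add: norm_mult c)
qed

text \<open>Rotation by \<open>- 2 * pi / 3\<close> preserves \<open>s ^ 3\<close>, so the
  exponential is that of \<open>Airy (s\<^sup>2)\<close>. But the expansion holds up to the
  imaginary axis, where \<open>s\<^sup>2\<close> is negative and \<open>Airy (s\<^sup>2)\<close>
  itself oscillates; in exchange, angles below 45 degrees are excluded.\<close>

lemma airy_asymptotics_g:
  assumes "Re s > 0" "Im s \<ge> Re s"
  obtains e where "Airy (tau ^ 4 * s\<^sup>2) = tau\<^sup>2 * exp (- 2 / 3 * s ^ 3) / csqrt s * (1 + e)" "cmod e \<le> 14 / cmod s ^ 3"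
proof -
  let ?t = "- (tau\<^sup>2) * s"
  have c: "cmod (tau\<^sup>2) = 1" by (simp add: norm_power tau_simps)
  have im: "Im s \<ge> 0" using assms by simp
  have nz: "?t \<noteq> 0" using tau_simps assms by auto
  \<comment> \<open>The numbers 71/50 above \<open>sqrt 2\<close> and 173/100 below
    \<open>sqrt 3\<close> must be this sharp: what is compared in the end is 0.71 with 0.73.\<close>
  have "(cmod s)\<^sup>2 \<le> 2 * (Im s)\<^sup>2"
    using power_mono[of "Re s" "Im s" 2] assms by (simp add: cmod_power2)
  also have "\<dots> \<le> (71 / 50 * Im s)\<^sup>2" by (simp add: power_mult_distrib power_divide)
  finally have "cmod s \<le> 71 / 50 * Im s" by (rule power2_le_imp_le) (use im in simp)
  moreover have "173 / 100 * Im s \<le> sqrt 3 * Im s"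
    by (intro mult_right_mono real_le_rsqrt im) (simp add: power2_eq_square)
  ultimately have "cmod s / 2 \<le> sqrt 3 * Im s - Re s" using assms by linarith
  hence R: "Re ?t \<ge> cmod ?t / 4" by (simp add: norm_mult c, simp add: tau_Complex power2_eq_square field_simps)
  obtain e where e: "Airy (?t\<^sup>2) = exp (- 2 / 3 * ?t ^ 3) / csqrt ?t * (1 + e)" "cmod e \<le> 14 / cmod ?t ^ 3"
    using airy_asymptotics_wide[OF R nz] by blast
  have 1: "?t\<^sup>2 = tau ^ 4 * s\<^sup>2" "?t ^ 3 = s ^ 3"
    by (simp_all only: power_mult_distrib tau_inverse) simp
  have inv: "inverse (1 - tau\<^sup>2) = tau\<^sup>2" using tau_inverse(2) by (metis inverse_unique)
  have 2: "exp (- 2 / 3 * ?t ^ 3) / csqrt ?t = tau\<^sup>2 * exp (- 2 / 3 * s ^ 3) / csqrt s"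
    unfolding csqrt_rotate'[OF assms(1) im] 1 divide_inverse inverse_mult_distrib inv by (simp only: mult_ac)
  show ?thesis using e that[of e] unfolding 2 unfolding 1 by (simp add: norm_mult c)
qed

text \<open>The Wronskian is constant, and on the positive real axis the two solutions have
  reciprocal exponentials, so the leading terms give its value in the limit. Both expansions are
  available on that axis, unlike the one of \<open>airy_asymptotics_g\<close>; therefore the
  rotation by \<open>tau ^ 8\<close> comes before that by \<open>tau ^ 4\<close>.\<close>

lemma airy_wronskian_B:
  "Airy z * (tau ^ 8 * Airy' (tau ^ 8 * z)) - Airy' z * Airy (tau ^ 8 * z) = 2 * tau"
proof -
  define F where "F z = Airy z * (tau ^ 8 * Airy' (tau ^ 8 * z)) - Airy' z * Airy (tau ^ 8 * z)" for z
  have lin: "((\<lambda>z. tau ^ 8 * z) has_field_derivative tau ^ 8) (at z)" for z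
    by (auto intro!: derivative_eq_intros)
  have t24: "tau ^ 24 = 1" using tau_12 power_mult[of tau 12 2] by simp
  have t24': "tau ^ 8 * (tau ^ 8 * (tau ^ 8 * x)) = x" for x
    using t24 by (simp flip: mult.assoc power_add)
  have "(F has_field_derivative 0) (at z within UNIV)" for z
    unfolding F_def[abs_def]
    by (rule DERIV_cong[OF DERIV_diff[OF DERIV_mult[OF Airy_deriv(1) DERIV_cmult[OF DERIV_chain2[OF Airy_deriv(2) lin]]]
          DERIV_mult[OF Airy_deriv(2) DERIV_chain2[OF Airy_deriv(1) lin]]]])
       (use t24' in \<open>simp add: algebra_simps\<close>)
  from has_field_derivative_zero_constant[OF convex_UNIV this] obtain c where c: "\<And>z. F z = c" by auto
  have est: "cmod (c - 2 * tau) \<le> 90 / r" if r: "r \<ge> 1" for r :: real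
  proof -
    let ?s = "complex_of_real r" let ?t = "(1 - tau\<^sup>2) * ?s"
    define X where "X = exp (2 / 3 * ?s ^ 3)"
    have c1: "cmod (1 - tau\<^sup>2) = 1"
      by (simp add: tau_Complex power2_eq_square cmod_def field_simps)
    have s: "Re ?s \<ge> cmod ?s / 2" "?s \<noteq> 0" "Re ?s > 0" "Im ?s \<ge> 0" "cmod ?s = r" using r by auto
    have nz: "?t \<noteq> 0" using c1 s by auto
    have rt: "cmod ?t = r" using s by (simp add: norm_mult c1)
    obtain e1 where e1: "Airy (?s\<^sup>2) = exp (- 2 / 3 * ?s ^ 3) / csqrt ?s * (1 + e1)" "cmod e1 \<le> 3 / r ^ 3"
      using airy_asymptotics[OF s(1,2)] unfolding s(5) by blast
    obtain e2 where e2: "Airy' (?s\<^sup>2) = - ?s * exp (- 2 / 3 * ?s ^ 3) / csqrt ?s * (1 + e2)" "cmod e2 \<le> 6 / r ^ 3"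
      using airy_deriv_asymptotics[OF s(1,2)] unfolding s(5) by blast
    obtain e3 where e3: "Airy (- (tau\<^sup>2) * ?s\<^sup>2) = tau * exp (2 / 3 * ?s ^ 3) / csqrt ?s * (1 + e3)" "cmod e3 \<le> 3 / r ^ 3"
      using airy_asymptotics_B[OF s(3,4)] unfolding s(5) by blast
    obtain e4 where e4: "Airy' (?t\<^sup>2) = - ?t * exp (- 2 / 3 * ?t ^ 3) / csqrt ?t * (1 + e4)" "cmod e4 \<le> 6 / r ^ 3"
      using airy_deriv_asymptotics[OF quadrant_rotate[OF s(3,4)] nz] unfolding rt by blast
    have 1: "?t\<^sup>2 = - (tau\<^sup>2) * ?s\<^sup>2" "?t ^ 3 = - (?s ^ 3)"
      by (simp_all only: power_mult_distrib tau_inverse) simp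
    have inv: "inverse ((1 - tau\<^sup>2) * tau) = tau" using tau_inverse(1) by (metis inverse_unique)
    have "exp (- 2 / 3 * ?t ^ 3) / csqrt ?t = tau * X / csqrt ?s"
      unfolding csqrt_rotate[OF s(3,4)] 1 X_def divide_inverse inverse_mult_distrib[of "(1 - tau\<^sup>2) * tau"] inv by (simp add: mult_ac)
    hence e4': "Airy' (- (tau\<^sup>2) * ?s\<^sup>2) = - ?t * (tau * X / csqrt ?s) * (1 + e4)"
      using e4(1) unfolding 1(1) by (metis times_divide_eq_right)
    have XX: "exp (- 2 / 3 * ?s ^ 3) = inverse X" "X \<noteq> 0" by (simp_all add: X_def exp_minus[symmetric])
    have q: "csqrt ?s * csqrt ?s = ?s" by (metis power2_csqrt power2_eq_square)
    have q0: "csqrt ?s \<noteq> 0" using s by simp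
    have tt: "- (tau\<^sup>2) * (1 - tau\<^sup>2) = - 1" using tau_inverse(2) by (simp add: mult.commute)
    have "c = F (?s\<^sup>2)" using c by simp
    also have "\<dots> = inverse X / csqrt ?s * (1 + e1) * (- (tau\<^sup>2) * (- ((1 - tau\<^sup>2) * ?s) * (tau * X / csqrt ?s) * (1 + e4)))
        - (- ?s * inverse X / csqrt ?s * (1 + e2)) * (tau * X / csqrt ?s * (1 + e3))"
      unfolding F_def tau_8 e1(1) e2(1) e3(1) e4' XX(1) X_def[symmetric] by simp
    also have "\<dots> = tau * (?s / (csqrt ?s * csqrt ?s)) * (- (- (tau\<^sup>2) * (1 - tau\<^sup>2)) * (1 + e1) * (1 + e4) + (1 + e2) * (1 + e3))"
      using XX(2) q0 by (simp add: field_simps)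
    also have "\<dots> = tau * ((1 + e1) * (1 + e4) + (1 + e2) * (1 + e3))"
      unfolding q tt using s by simp
    finally have "c - 2 * tau = tau * (e1 + e4 + e1 * e4 + e2 + e3 + e2 * e3)" by (simp add: algebra_simps)
    hence "cmod (c - 2 * tau) = cmod (e1 + e4 + e1 * e4 + e2 + e3 + e2 * e3)" by (simp add: norm_mult tau_simps)
    also have "\<dots> \<le> cmod e1 + cmod e4 + cmod e1 * cmod e4 + cmod e2 + cmod e3 + cmod e2 * cmod e3"
      unfolding norm_mult[symmetric] by (intro norm_triangle_le add_mono order.refl norm_triangle_ineq)
    also have "\<dots> \<le> 3 / r ^ 3 + 6 / r ^ 3 + 3 / r ^ 3 * 6 + 6 / r ^ 3 + 3 / r ^ 3 + 6 * (3 / r ^ 3)"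
    proof -
      have "r ^ 3 \<ge> 1" using r by simp
      hence "6 / r ^ 3 \<le> 6 / 1" using r by (intro divide_left_mono) auto
      thus ?thesis using e1(2) e2(2) e3(2) e4(2) r by (intro add_mono mult_mono) auto
    qed
    also have "\<dots> = 54 / r ^ 3" by simp
    also have "\<dots> \<le> 90 / r"
    proof -
      have "r \<le> r ^ 3" using r by (simp add: self_le_power)
      thus ?thesis using r by (intro frac_le) auto
    qed
    finally show ?thesis .
  qed
  have "((\<lambda>r. 90 / r) \<longlongrightarrow> (0::real)) at_top" by real_asymp
  hence "cmod (c - 2 * tau) \<le> 0"
    by (rule tendsto_lowerbound)
       (use est in \<open>auto simp: eventually_at_top_linorder\<close>)
  thus ?thesis using c[of z] by (simp add: F_def)
qed

lemma Airy_rotate: "Airy (tau ^ 4 * z) = - (tau ^ 8) * Airy z - tau ^ 4 * Airy (tau ^ 8 * z)"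
proof -
  have "tau ^ 8 * (Airy z + tau ^ 4 * Airy (tau ^ 4 * z) + tau ^ 8 * Airy (tau ^ 8 * z)) = 0"
    unfolding airy_connection by simp
  moreover have "tau ^ 8 * tau ^ 4 = 1" "tau ^ 8 * tau ^ 8 = tau ^ 4"
    using tau_12 power_add[of tau 12 4] by (simp_all flip: power_add)
  ultimately have "tau ^ 8 * Airy z + Airy (tau ^ 4 * z) + tau ^ 4 * Airy (tau ^ 8 * z) = 0"
    by (simp add: distrib_left flip: mult.assoc)
  thus ?thesis by (simp add: algebra_simps eq_neg_iff_add_eq_0)
qed

text \<open>By \<open>Airy_rotate\<close> the rotated function is a combination of
  \<open>Airy z\<close> and \<open>Airy (tau ^ 8 * z)\<close>, and only the second part contributes
  to the Wronskian. Differentiating both sides of that relation supplies the formula for the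
  derivative.\<close>

lemma airy_wronskian:
  "Airy z * (tau ^ 4 * Airy' (tau ^ 4 * z)) - Airy' z * Airy (tau ^ 4 * z) = - 2 * tau ^ 5"
proof -
  have lin: "((\<lambda>z. a * z) has_field_derivative a) (at z)" for z a :: complex
    by (auto intro!: derivative_eq_intros)
  have "((\<lambda>z. Airy (tau ^ 4 * z)) has_field_derivative Airy' (tau ^ 4 * z) * tau ^ 4) (at z)"
    by (rule DERIV_chain2[OF Airy_deriv(1) lin])
  moreover have "((\<lambda>z. Airy (tau ^ 4 * z)) has_field_derivative - (tau ^ 8) * Airy' z - tau ^ 4 * (Airy' (tau ^ 8 * z) * tau ^ 8)) (at z)"
    unfolding Airy_rotate
    by (rule DERIV_diff[OF DERIV_cmult[OF Airy_deriv(1)] DERIV_cmult[OF DERIV_chain2[OF Airy_deriv(1) lin]]])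
  ultimately have D: "Airy' (tau ^ 4 * z) * tau ^ 4 = - (tau ^ 8) * Airy' z - tau ^ 4 * (Airy' (tau ^ 8 * z) * tau ^ 8)"
    by (rule DERIV_unique)
  have "Airy z * (Airy' (tau ^ 4 * z) * tau ^ 4) - Airy' z * Airy (tau ^ 4 * z)
      = - (tau ^ 4) * (Airy z * (tau ^ 8 * Airy' (tau ^ 8 * z)) - Airy' z * Airy (tau ^ 8 * z))"
    unfolding D Airy_rotate by (simp add: algebra_simps)
  also have "\<dots> = - 2 * tau ^ 5" unfolding airy_wronskian_B by (simp add: eval_nat_numeral)
  finally show ?thesis by (simp add: mult_ac)
qed

text \<open>If it vanished, \<open>Airy\<close> would be a multiple of \<open>ay2\<close>, whose
  modulus is invariant under rotation by \<open>tau ^ 8\<close>. At \<open>s = 2\<close> the two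
  expansions contradict this: one value is exponentially small, the other large.\<close>

lemma Airy_0_nonzero: "Airy 0 \<noteq> 0"
proof
  assume 0: "Airy 0 = 0"
  have "airy_c1 = 0" using 0 by (simp add: Airy_def ay1_def ay2_def airy_series_0)
  hence A: "Airy z = airy_c2 * ay2 z / of_real (sqrt pi)" for z by (simp add: Airy_def)
  have t24: "tau ^ 24 = 1" using tau_12 power_mult[of tau 12 2] by simp
  have "(tau ^ 8 * z) ^ 3 = z ^ 3" for z using t24 by (simp add: power_mult_distrib flip: power_mult)
  hence "ay2 (tau ^ 8 * z) = tau ^ 8 * ay2 z" for z by (simp add: ay2_def)
  hence B: "cmod (Airy (- (tau\<^sup>2) * z)) = cmod (Airy z)" for z
    by (simp add: A norm_mult norm_power tau_simps norm_divide flip: tau_8)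
  let ?s = "2 :: complex"
  obtain e1 where e1: "Airy (?s\<^sup>2) = exp (- 2 / 3 * ?s ^ 3) / csqrt ?s * (1 + e1)" "cmod e1 \<le> 3 / cmod ?s ^ 3"
    by (rule airy_asymptotics[of ?s]) auto
  obtain e2 where e2: "Airy (- (tau\<^sup>2) * ?s\<^sup>2) = tau * exp (2 / 3 * ?s ^ 3) / csqrt ?s * (1 + e2)" "cmod e2 \<le> 3 / cmod ?s ^ 3"
    by (rule airy_asymptotics_B[of ?s]) auto
  have n1: "cmod (1 + e1) \<le> 11 / 8" using e1(2) norm_triangle_ineq[of 1 e1] by simp
  have n2: "cmod (1 + e2) \<ge> 5 / 8" using e2(2) norm_diff_ineq[of 1 e2] by simp
  have x: "cmod (exp (- 2 / 3 * ?s ^ 3)) \<le> 1 / 3"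
  proof -
    have "exp (-(16/3)) \<le> exp (-(2::real))" by simp
    also have "\<dots> = 1 / (exp 1)\<^sup>2" by (simp add: exp_minus field_simps flip: exp_of_nat_mult exp_double)
    also have "\<dots> \<le> 1 / 2\<^sup>2" by (intro divide_left_mono power_mono) (use exp_ge_add_one_self[of 1] in auto)
    finally show ?thesis by simp
  qed
  have y: "cmod (exp (2 / 3 * ?s ^ 3)) \<ge> 19 / 3"
    using exp_ge_add_one_self[of "16/3"] by simp
  have "cmod (exp (2 / 3 * ?s ^ 3)) * cmod (1 + e2) = cmod (exp (- 2 / 3 * ?s ^ 3)) * cmod (1 + e1)"
    using B[of "?s\<^sup>2"] unfolding e1(1) e2(1) by (simp add: norm_mult norm_divide tau_simps)
  moreover have "cmod (exp (2 / 3 * ?s ^ 3)) * cmod (1 + e2) \<ge> 19 / 3 * (5 / 8)"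
    using y n2 by (intro mult_mono) auto
  moreover have "cmod (exp (- 2 / 3 * ?s ^ 3)) * cmod (1 + e1) \<le> 1 / 3 * (11 / 8)"
    using x n1 by (intro mult_mono) auto
  ultimately show False by simp
qed

section \<open>The resolvent kernel\<close>

text \<open>Square integrability of \<open>u\<close> says nothing pointwise about \<open>u'\<close>,
  so the Wronskian cannot be estimated at a single point. It is averaged over
  \<open>{R..2*R}\<close> with a weight vanishing at both ends, and integration by parts moves the
  derivative from \<open>u\<close> to \<open>v\<close>.\<close>

lemma wronskian_at_infinity_eq_0:
  fixes u u' v v' :: "real \<Rightarrow> complex"
  assumes X: "X \<ge> 1"
    and u: "\<And>x. x > X \<Longrightarrow> (u has_vector_derivative u' x) (at x)"
    and v: "\<And>x. x > X \<Longrightarrow> (v has_vector_derivative v' x) (at x)" "continuous_on {X<..} v'"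
    and C: "\<And>x. x > X \<Longrightarrow> u x * v' x - u' x * v x = C"
    and L2: "integrable lborel (\<lambda>x. (cmod (u x))\<^sup>2)"
    and b: "\<And>x. x > X \<Longrightarrow> cmod (v x) \<le> K" "\<And>x. x > X \<Longrightarrow> cmod (v' x) \<le> K * x powr (1/4)"
  shows "C = 0"
proof -
  define N where "N = (LINT x|lborel. (cmod (u x))\<^sup>2)"
  have K0: "K \<ge> 0" using b(1)[of "X + 1"] norm_ge_zero by (smt (verit) order_trans)
  have main: "cmod C * (R ^ 3 / 6) \<le> K * (2 * R\<^sup>2 * (2 * R) powr (1/4) + R) * (sqrt R * (1 + N) / 2)" if R: "R > X" for R
  proof -
    \<comment> \<open>The weight has integral \<open>R ^ 3 / 6\<close>. On the other side
      \<open>q\<close> is of size \<open>R powr (9/4)\<close> times \<open>\<bar>u\<bar>\<close>,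
      and integrating \<open>\<bar>u\<bar>\<close> over a length \<open>R\<close> costs
      \<open>sqrt R\<close>; the total \<open>R powr (11/4)\<close> loses against
      \<open>R ^ 3\<close>.\<close>
    define p where "p t = (t - R) * (2 * R - t)" for t :: real
    define p' where "p' t = 3 * R - 2 * t" for t :: real
    have R0: "R > 1" using R X by simp
    have p: "(p has_real_derivative p' t) (at t)" for t
      unfolding p_def[abs_def] p'_def by (auto intro!: derivative_eq_intros)
    have cu: "continuous_on {R..2*R} u" "continuous_on {R..2*R} v"
      using R by (auto intro!: continuous_at_imp_continuous_on has_vector_derivative_continuous[OF u] has_vector_derivative_continuous[OF v(1)])
    have cv': "continuous_on {R..2*R} v'" by (rule continuous_on_subset[OF v(2)]) (use R in auto)
    have cp: "continuous_on A p" "continuous_on A p'" for A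
      unfolding p_def[abs_def] p'_def[abs_def] by (intro continuous_intros)+
    define q where "q t = of_real (p' t) * u t * v t + 2 * of_real (p t) * u t * v' t" for t
    have "((\<lambda>t. of_real (p t) * (u t * v t)) has_vector_derivative (q t - C * of_real (p t))) (at t within {R..2*R})" if "t \<in> {R..2*R}" for t
    proof -
      have t: "t > X" using that R by auto
      have "((\<lambda>t. complex_of_real (p t)) has_vector_derivative of_real (p' t)) (at t)"
        using p[of t] by (simp add: has_real_derivative_iff_has_vector_derivative has_vector_derivative_of_real)
      from has_vector_derivative_mult[OF this has_vector_derivative_mult[OF u[OF t] v(1)[OF t]]]
      have "((\<lambda>t. of_real (p t) * (u t * v t)) has_vector_derivative (of_real (p t) * (u t * v' t + u' t * v t) + of_real (p' t) * (u t * v t))) (at t)" .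
      moreover have "of_real (p t) * (u t * v' t + u' t * v t) + of_real (p' t) * (u t * v t) = q t - C * of_real (p t)"
        unfolding q_def C[OF t, symmetric] by (simp add: algebra_simps)
      ultimately show ?thesis by (auto intro: has_vector_derivative_at_within)
    qed
    from fundamental_theorem_of_calculus[OF _ this] R0
    have "((\<lambda>t. q t - C * of_real (p t)) has_integral 0) {R..2*R}" by (simp add: p_def)
    moreover have "((\<lambda>t. C * of_real (p t)) has_integral C * of_real (R ^ 3 / 6)) {R..2*R}"
    proof -
      have "(p has_integral ((\<lambda>t. - (t^3) / 3 + 3 * R * t\<^sup>2 / 2 - 2 * R\<^sup>2 * t) (2*R) - (\<lambda>t. - (t^3) / 3 + 3 * R * t\<^sup>2 / 2 - 2 * R\<^sup>2 * t) R)) {R..2*R}"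
        by (rule fundamental_theorem_of_calculus)
          (use R0 in \<open>auto simp: p_def power2_eq_square algebra_simps simp flip: has_real_derivative_iff_has_vector_derivative intro!: derivative_eq_intros\<close>)
      hence "(p has_integral (R ^ 3 / 6)) {R..2*R}" by (simp add: power2_eq_square power3_eq_cube algebra_simps)
      from has_integral_mult_right[OF has_integral_of_real[OF this]] show ?thesis .
    qed
    ultimately have "((\<lambda>t. (q t - C * of_real (p t)) + C * of_real (p t)) has_integral (0 + C * of_real (R ^ 3 / 6))) {R..2*R}"
      by (rule has_integral_add)
    hence qi: "(q has_integral (C * of_real (R ^ 3 / 6))) {R..2*R}" by simp
    define M where "M = K * (2 * R\<^sup>2 * (2 * R) powr (1/4) + R)"
    \<comment> \<open>The inequality of means replaces Cauchy--Schwarz; this \<open>e\<close> makes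
      \<open>R * e\<close> and \<open>N / e\<close> both of order \<open>sqrt R\<close>.\<close>
    define e where "e = 1 / sqrt R"
    have e: "e > 0" using R0 by (simp add: e_def)
    have M0: "M \<ge> 0" using K0 R0 by (simp add: M_def)
    have qb: "cmod (q t) \<le> M * ((e + (cmod (u t))\<^sup>2 / e) / 2)" if "t \<in> {R..2*R}" for t
    proof -
      have t: "t > X" using that R by auto
      have p1: "\<bar>p t\<bar> \<le> R\<^sup>2" using that R0
        unfolding p_def abs_mult power2_eq_square by (intro mult_mono) auto
      have p2: "\<bar>p' t\<bar> \<le> R" using that by (auto simp: p'_def abs_le_iff)
      have "cmod (q t) \<le> \<bar>p' t\<bar> * cmod (u t) * cmod (v t) + 2 * \<bar>p t\<bar> * cmod (u t) * cmod (v' t)"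
        unfolding q_def by (rule norm_triangle_le) (simp add: norm_mult)
      also have "\<dots> \<le> R * cmod (u t) * K + 2 * R\<^sup>2 * cmod (u t) * (K * (2 * R) powr (1/4))"
      proof (intro add_mono mult_mono p1 p2)
        have "cmod (v' t) \<le> K * t powr (1/4)" by (rule b[OF t])
        also have "\<dots> \<le> K * (2 * R) powr (1/4)" using that R0 K0 by (intro mult_left_mono powr_mono2) auto
        finally show "cmod (v' t) \<le> K * (2 * R) powr (1/4)" .
      qed (use b t R0 in auto)
      also have "\<dots> = M * cmod (u t)" by (simp add: M_def algebra_simps)
      also have "\<dots> \<le> M * ((e + (cmod (u t))\<^sup>2 / e) / 2)"
      proof (intro mult_left_mono M0)
        have "0 \<le> (cmod (u t) - e)\<^sup>2" by simp
        thus "cmod (u t) \<le> (e + (cmod (u t))\<^sup>2 / e) / 2"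
          using e by (simp add: power2_eq_square field_simps)
      qed
      finally show ?thesis .
    qed
    have i2: "(\<lambda>t. (cmod (u t))\<^sup>2) integrable_on {R..2*R}"
      by (intro integrable_continuous_interval continuous_intros cu)
    have i3: "integral {R..2*R} (\<lambda>t. (cmod (u t))\<^sup>2) \<le> N"
    proof -
      have L2': "set_integrable lborel {R..2*R} (\<lambda>t. (cmod (u t))\<^sup>2)"
        unfolding set_integrable_def by (rule integrable_mult_indicator) (use L2 in auto)
      have "integral {R..2*R} (\<lambda>t. (cmod (u t))\<^sup>2) = (LINT t:{R..2*R}|lborel. (cmod (u t))\<^sup>2)"
        using set_borel_integral_eq_integral(2)[OF L2'] by simp
      also have "\<dots> \<le> N" unfolding N_def set_lebesgue_integral_def
        by (rule integral_mono) (use L2 L2' in \<open>auto simp: set_integrable_def indicator_def\<close>)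
      finally show ?thesis .
    qed
    have "cmod C * (R ^ 3 / 6) = cmod (integral {R..2*R} q)"
      using qi R0 by (simp add: integral_unique norm_mult norm_divide norm_power)
    also have "\<dots> \<le> integral {R..2*R} (\<lambda>t. M * ((e + (cmod (u t))\<^sup>2 / e) / 2))"
      by (rule integral_norm_bound_integral) (use has_integral_integrable[OF qi] qb e in \<open>auto intro!: integrable_continuous_interval continuous_intros cu\<close>)
    also have "\<dots> = M * ((R * e + integral {R..2*R} (\<lambda>t. (cmod (u t))\<^sup>2) / e) / 2)"
    proof -
      have "((\<lambda>t. M * ((e + (cmod (u t))\<^sup>2 / e) / 2)) has_integral M * ((R * e + integral {R..2*R} (\<lambda>t. (cmod (u t))\<^sup>2) / e) / 2)) {R..2*R}"
        using R0 has_integral_const_real[of e R "2*R"]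
        by (intro has_integral_mult_right has_integral_divide has_integral_add integrable_integral i2) auto
      thus ?thesis by (rule integral_unique)
    qed
    also have "\<dots> \<le> M * ((R * e + N / e) / 2)"
      using i3 e M0 R0 by (intro mult_left_mono divide_right_mono add_mono) auto
    also have "R * e + N / e = sqrt R * (1 + N)"
      using R0 by (simp add: e_def algebra_simps real_div_sqrt)
    finally show ?thesis by (simp add: M_def)
  qed
  have N0: "N \<ge> 0" unfolding N_def by simp
  have "((\<lambda>R. K * (2 * R\<^sup>2 * (2 * R) powr (1/4) + R) * (sqrt R * (1 + N) / 2) / (R ^ 3 / 6)) \<longlongrightarrow> 0) at_top"
    by real_asymp
  moreover have "eventually (\<lambda>R. cmod C \<le> K * (2 * R\<^sup>2 * (2 * R) powr (1/4) + R) * (sqrt R * (1 + N) / 2) / (R ^ 3 / 6)) at_top"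
    using eventually_gt_at_top[of X]
  proof eventually_elim
    case (elim R)
    thus ?case using main[of R] X by (subst pos_le_divide_eq) auto
  qed
  ultimately have "cmod C \<le> 0" by (rule tendsto_lowerbound) auto
  thus ?thesis by simp
qed

lemma continuous_compact_support_integral:
  fixes F :: "real \<Rightarrow> complex"
  assumes F: "continuous_on UNIV F" and 0: "\<And>x. x \<notin> {a..b} \<Longrightarrow> F x = 0"
  shows "integrable lborel F" "(LINT x|lborel. F x) = integral {a..b} F"
proof -
  have ind: "(\<lambda>x. indicator {a..b} x *\<^sub>R F x) = F" using 0 by (auto simp: indicator_def)
  have "set_integrable lborel {a..b} F"
    by (rule borel_integrable_atLeastAtMost') (use F continuous_on_subset in auto)
  thus "integrable lborel F" unfolding set_integrable_def ind .
  have "(LINT x:{a..b}|lborel. F x) = integral {a..b} F"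
    by (rule set_borel_integral_eq_integral(2)) fact
  thus "(LINT x|lborel. F x) = integral {a..b} F" unfolding set_lebesgue_integral_def ind .
qed

text \<open>Upgrades the integral identity of \<open>stark_op\<close> to a pointwise second
  derivative away from the delta points: for continuous \<open>u\<close> and \<open>h\<close> the
  integrand is continuous, and the fundamental theorem applies.\<close>

lemma has_vector_derivative_of_increment:
  fixes u' h :: "real \<Rightarrow> complex"
  assumes "\<kappa> > 0" and x: "x \<notin> {\<kappa>, -\<kappa>}" and h: "continuous_on UNIV h"
    and inc: "\<And>a b. a \<le> b \<Longrightarrow> {a..b} \<inter> {\<kappa>, -\<kappa>} = {} \<Longrightarrow> u' b - u' a = (LINT x:{a..b}|lborel. h x)"
  shows "(u' has_vector_derivative h x) (at x)"
proof -
  have "open (- {\<kappa>, -\<kappa>})" by (intro open_Compl finite_imp_closed) auto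
  then obtain d where d: "d > 0" "cball x d \<subseteq> - {\<kappa>, -\<kappa>}"
    using x open_contains_cball[of "- {\<kappa>, -\<kappa>}"] by blast
  define a b where "a = x - d" and "b = x + d"
  have "{a..b} \<subseteq> cball x d" by (auto simp: a_def b_def dist_real_def)
  hence ab: "{a..b} \<inter> {\<kappa>, -\<kappa>} = {}" "a < x" "x < b"
    using d by (auto simp: a_def b_def)
  have eq: "u' y = u' a + integral {a..y} h" if "y \<in> {a..b}" for y
  proof -
    have "set_integrable lborel {a..y} h"
      by (rule borel_integrable_atLeastAtMost') (use h continuous_on_subset in auto)
    moreover have "{a..y} \<inter> {\<kappa>, -\<kappa>} = {}" using ab that by auto
    ultimately show ?thesis using inc[of a y] that set_borel_integral_eq_integral(2)[of "{a..y}" h]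
      by (simp add: algebra_simps)
  qed
  have "((\<lambda>y. integral {a..y} h) has_vector_derivative h x) (at x within {a..b})"
    by (rule integral_has_vector_derivative) (use h continuous_on_subset ab in auto)
  hence "((\<lambda>y. u' a + integral {a..y} h) has_vector_derivative h x) (at x)"
    using ab by (auto intro!: derivative_eq_intros simp: at_within_Icc_at)
  thus ?thesis
    by (rule has_vector_derivative_transform_within_open[where S = "{a<..<b}"]) (use ab in \<open>auto intro: eq[symmetric]\<close>)
qed

text \<open>Here \<open>u\<close> solves the inhomogeneous equation with the delta jumps, and
  \<open>v\<close> the homogeneous equation without them for the same \<open>w\<close>. The
  derivative of their Wronskian \<open>P\<close> is \<open>h * v\<close>, which is Lagrange's
  identity.\<close>

locale stark_solution =
  fixes \<kappa> \<eta> f :: real and w :: complex and u u' h v v' :: "real \<Rightarrow> complex"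
  assumes \<kappa>: "\<kappa> > 0" and cu: "continuous_on UNIV u" and ch: "continuous_on UNIV h"
    and du: "\<And>x. x \<notin> {\<kappa>, -\<kappa>} \<Longrightarrow> (u has_vector_derivative u' x) (at x)"
    and du': "\<And>x. x \<notin> {\<kappa>, -\<kappa>} \<Longrightarrow> (u' has_vector_derivative (of_real (f * x) - w) * u x - h x) (at x)"
    and jump: "\<And>s. s \<in> {\<kappa>, -\<kappa>} \<Longrightarrow> \<exists>l r. (u' \<longlongrightarrow> l) (at_left s) \<and> (u' \<longlongrightarrow> r) (at_right s) \<and> r - l = u s / complex_of_real \<eta>"
    and dv: "\<And>x. (v has_vector_derivative v' x) (at x)"
    and dv': "\<And>x. (v' has_vector_derivative (of_real (f * x) - w) * v x) (at x)"
begin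

definition P where "P x = u x * v' x - u' x * v x"

lemma cv: "continuous_on A v" "continuous_on A v'"
  using dv dv' by (auto intro!: continuous_at_imp_continuous_on has_vector_derivative_continuous)

lemma P_deriv: "x \<notin> {\<kappa>, -\<kappa>} \<Longrightarrow> (P has_vector_derivative h x * v x) (at x)"
  unfolding P_def[abs_def]
  by (rule has_vector_derivative_eq_rhs[OF has_vector_derivative_diff[OF
        has_vector_derivative_mult[OF du dv'] has_vector_derivative_mult[OF du' dv]]])
     (auto simp: algebra_simps)

lemma hv_integrable: "(\<lambda>x. h x * v x) integrable_on {a..b}"
  by (intro integrable_continuous_interval continuous_intros cv continuous_on_subset[OF ch]) auto

lemma P_no_jump:
  assumes "a \<le> b" "{a..b} \<inter> {\<kappa>, -\<kappa>} = {}"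
  shows "P b - P a = integral {a..b} (\<lambda>x. h x * v x)"
proof -
  have "((\<lambda>x. h x * v x) has_integral (P b - P a)) {a..b}"
    by (rule fundamental_theorem_of_calculus)
       (use assms in \<open>auto intro!: has_vector_derivative_at_within P_deriv\<close>)
  thus ?thesis by (simp add: integral_unique)
qed

text \<open>The value of \<open>u'\<close> at \<open>s\<close> is arbitrary, so \<open>P s\<close>
  is avoided. Both one-sided limits of \<open>P\<close> are computed twice, from the indefinite
  integral and from the limits \<open>l\<close> and \<open>r\<close> of \<open>u'\<close>;
  comparison leaves the jump \<open>(r - l) * v s\<close>.\<close>

lemma P_one_jump:
  assumes s: "a < s" "s < b" "s \<in> {\<kappa>, -\<kappa>}" "-s \<notin> {a..b}"
  shows "P b - P a = integral {a..b} (\<lambda>x. h x * v x) - u s * v s / \<eta>"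
proof -
  let ?F = "\<lambda>x. h x * v x"
  obtain l r where lr: "(u' \<longlongrightarrow> l) (at_left s)" "(u' \<longlongrightarrow> r) (at_right s)" "r - l = u s / \<eta>"
    using jump[OF s(3)] by auto
  have lims: "(u \<longlongrightarrow> u s) (at s)" "(v \<longlongrightarrow> v s) (at s)" "(v' \<longlongrightarrow> v' s) (at s)"
    using cu cv[of UNIV] by (simp_all add: continuous_on_def)
  have cont1: "continuous_on {a..b} (\<lambda>x. integral {a..x} ?F)"
    by (rule indefinite_integral_continuous_1[OF hv_integrable])
  hence l1: "((\<lambda>x. integral {a..x} ?F) \<longlongrightarrow> integral {a..s} ?F) (at s)"
    using bspec[OF cont1[unfolded continuous_on_def], of s] s(1,2) at_within_Icc_at[of a s b] by simp
  have "((\<lambda>x. P a + integral {a..x} ?F) \<longlongrightarrow> P a + integral {a..s} ?F) (at_left s)"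
    by (intro tendsto_intros filterlim_at_split[THEN iffD1, THEN conjunct1] l1)
  moreover have "eventually (\<lambda>x. P a + integral {a..x} ?F = u x * v' x - u' x * v x) (at_left s)"
    using eventually_at_left_real[OF s(1)]
  proof eventually_elim
    case (elim x)
    hence "{a..x} \<inter> {\<kappa>, -\<kappa>} = {}" using s by auto
    hence "P x - P a = integral {a..x} ?F" using P_no_jump[of a x] elim by simp
    hence "P a + integral {a..x} ?F = P x" by (simp add: algebra_simps)
    thus ?case by (simp only: P_def)
  qed
  ultimately have "((\<lambda>x. u x * v' x - u' x * v x) \<longlongrightarrow> P a + integral {a..s} ?F) (at_left s)"
    using tendsto_cong by fastforce
  moreover have "((\<lambda>x. u x * v' x - u' x * v x) \<longlongrightarrow> u s * v' s - l * v s) (at_left s)"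
    by (intro tendsto_intros lr filterlim_at_split[THEN iffD1, THEN conjunct1] lims)
  ultimately have L: "P a + integral {a..s} ?F = u s * v' s - l * v s"
    using tendsto_unique[OF trivial_limit_at_left_real] by blast
  have "((\<lambda>x. P b - integral {a..b} ?F + integral {a..x} ?F) \<longlongrightarrow> P b - integral {a..b} ?F + integral {a..s} ?F) (at_right s)"
    by (intro tendsto_intros filterlim_at_split[THEN iffD1, THEN conjunct2] l1)
  moreover have "eventually (\<lambda>x. P b - integral {a..b} ?F + integral {a..x} ?F = u x * v' x - u' x * v x) (at_right s)"
    using eventually_at_right_real[OF s(2)]
  proof eventually_elim
    case (elim x)
    hence "{x..b} \<inter> {\<kappa>, -\<kappa>} = {}" using s by auto
    moreover have "integral {a..x} ?F + integral {x..b} ?F = integral {a..b} ?F"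
      by (rule Henstock_Kurzweil_Integration.integral_combine) (use elim s hv_integrable in auto)
    moreover have "P b - P x = integral {x..b} ?F" using calculation(1) P_no_jump[of x b] elim by simp
    ultimately have "P b - integral {a..b} ?F + integral {a..x} ?F = P x" by (simp add: algebra_simps)
    thus ?case by (simp only: P_def)
  qed
  ultimately have "((\<lambda>x. u x * v' x - u' x * v x) \<longlongrightarrow> P b - integral {a..b} ?F + integral {a..s} ?F) (at_right s)"
    using tendsto_cong by fastforce
  moreover have "((\<lambda>x. u x * v' x - u' x * v x) \<longlongrightarrow> u s * v' s - r * v s) (at_right s)"
    by (intro tendsto_intros lr filterlim_at_split[THEN iffD1, THEN conjunct2] lims)
  ultimately have R: "P b - integral {a..b} ?F + integral {a..s} ?F = u s * v' s - r * v s"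
    using tendsto_unique[OF trivial_limit_at_right_real] by blast
  have "P b - P a = integral {a..b} ?F - (r - l) * v s"
    using L R by algebra
  thus ?thesis unfolding lr(3) by simp
qed

definition J where "J a b s = (if a < s \<and> s < b then u s * v s / \<eta> else 0)"

text \<open>An interval on one side of 0 contains at most one of the two delta points; other
  intervals are cut at 0 afterwards.\<close>

lemma P_half:
  assumes "a \<le> b" "a \<notin> {\<kappa>, -\<kappa>}" "b \<notin> {\<kappa>, -\<kappa>}" "0 \<le> a \<or> b \<le> 0"
  shows "P b - P a = integral {a..b} (\<lambda>x. h x * v x) - J a b \<kappa> - J a b (-\<kappa>)"
proof -
  have ne: "a \<noteq> \<kappa>" "a \<noteq> -\<kappa>" "b \<noteq> \<kappa>" "b \<noteq> -\<kappa>" using assms by auto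
  have one: ?thesis if "a < s" "s < b" "s \<in> {\<kappa>, -\<kappa>}" "- s \<notin> {a..b}" for s
    using P_one_jump[OF that] that by (auto simp: J_def)
  have none: ?thesis if "\<kappa> \<notin> {a..b}" "- \<kappa> \<notin> {a..b}"
    using P_no_jump[OF assms(1)] that by (auto simp: J_def)
  show ?thesis
  proof (cases "\<kappa> \<in> {a..b}")
    case True
    thus ?thesis using assms(4) ne \<kappa> by (intro one[of \<kappa>]) auto
  next
    case \<kappa>_out: False
    show ?thesis
    proof (cases "- \<kappa> \<in> {a..b}")
      case True
      thus ?thesis using \<kappa>_out ne \<kappa> by (intro one[of "-\<kappa>"]) auto
    qed (use none \<kappa>_out in blast)
  qed
qed

lemma P_increment:
  assumes "a \<le> b" "a \<notin> {\<kappa>, -\<kappa>}" "b \<notin> {\<kappa>, -\<kappa>}"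
  shows "P b - P a = integral {a..b} (\<lambda>x. h x * v x) - J a b \<kappa> - J a b (-\<kappa>)"
proof (cases "0 \<le> a \<or> b \<le> 0")
  case False
  hence "P b - P a = (P b - P 0) + (P 0 - P a)" by simp
  also have "P b - P 0 = integral {0..b} (\<lambda>x. h x * v x) - J 0 b \<kappa> - J 0 b (-\<kappa>)"
    by (rule P_half) (use assms False \<kappa> in auto)
  also have "P 0 - P a = integral {a..0} (\<lambda>x. h x * v x) - J a 0 \<kappa> - J a 0 (-\<kappa>)"
    by (rule P_half) (use assms False \<kappa> in auto)
  also have "integral {0..b} (\<lambda>x. h x * v x) = integral {a..b} (\<lambda>x. h x * v x) - integral {a..0} (\<lambda>x. h x * v x)"
    using Henstock_Kurzweil_Integration.integral_combine[OF _ _ hv_integrable, of a 0 b] False by (simp add: algebra_simps)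
  moreover have "J 0 b \<kappa> = J a b \<kappa>" "J a 0 \<kappa> = 0" "J 0 b (-\<kappa>) = 0" "J a 0 (-\<kappa>) = J a b (-\<kappa>)"
    using False \<kappa> by (simp_all add: J_def)
  ultimately show ?thesis by simp
qed (use P_half assms in blast)

lemma P_eq_0_right:
  assumes u: "u \<in> L2" and supp: "\<And>x. x > Y \<Longrightarrow> h x = 0" and Y: "Y > \<kappa>" "Y \<ge> 1"
    and b: "\<And>x. x > Y \<Longrightarrow> cmod (v x) \<le> K" "\<And>x. x > Y \<Longrightarrow> cmod (v' x) \<le> K * x powr (1/4)"
    and x: "x > Y"
  shows "P x = 0"
proof (rule wronskian_at_infinity_eq_0[of Y u u' v v' "P x" K])
  show "u t * v' t - u' t * v t = P x" if "t > Y" for t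
  proof -
    have "P t' = P t" if "t > Y" "t' > Y" "t \<le> t'" for t t'
    proof -
      have "P t' - P t = integral {t..t'} (\<lambda>x. h x * v x)"
        by (rule P_no_jump) (use that Y \<kappa> in auto)
      also have "\<dots> = integral {t..t'} (\<lambda>x. 0)"
        by (rule integral_cong) (use that supp in auto)
      finally show ?thesis by simp
    qed
    from this[of t x] this[of x t] show ?thesis using that x by (cases "t \<le> x") (auto simp: P_def)
  qed
  show "(u has_vector_derivative u' t) (at t)" if "t > Y" for t by (rule du) (use that Y \<kappa> in auto)
  show "(v has_vector_derivative v' t) (at t)" for t by (rule dv)
  show "continuous_on {Y<..} v'" by (rule cv)
  show "integrable lborel (\<lambda>x. (cmod (u x))\<^sup>2)" using u unfolding L2_def by blast
qed (rule Y b; assumption)+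

text \<open>Reduced to the right half line by reflection, which changes the sign of both derivatives
  and hence of \<open>P\<close>.\<close>

lemma P_eq_0_left:
  assumes u: "u \<in> L2" and supp: "\<And>x. x < - Y \<Longrightarrow> h x = 0" and Y: "Y > \<kappa>" "Y \<ge> 1"
    and b: "\<And>x. x < - Y \<Longrightarrow> cmod (v x) \<le> K" "\<And>x. x < - Y \<Longrightarrow> cmod (v' x) \<le> K * (- x) powr (1/4)"
    and x: "x < - Y"
  shows "P x = 0"
proof -
  have P: "P t = P x" if "t < -Y" for t
  proof -
    have "P t' = P t" if "t' < -Y" "t \<le> t'" for t t'
    proof -
      have "P t' - P t = integral {t..t'} (\<lambda>x. h x * v x)"
        by (rule P_no_jump) (use that Y \<kappa> in auto)
      also have "\<dots> = integral {t..t'} (\<lambda>x. 0)"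
        by (rule integral_cong) (use that supp in auto)
      finally show ?thesis by simp
    qed
    from this[of t x] this[of x t] show ?thesis using that x by (cases "t \<le> x") (auto simp: P_def)
  qed
  have refl: "((\<lambda>t. g (- t)) has_vector_derivative - g' (- t)) (at t)"
    if "(g has_vector_derivative g' (- t)) (at (- t))" for g g' :: "real \<Rightarrow> complex" and t
  proof -
    have "(uminus has_vector_derivative (- 1 :: real)) (at t)"
      using has_vector_derivative_minus[OF has_vector_derivative_id, of "at t"] by simp
    from vector_diff_chain_at[OF this that] show ?thesis by (simp add: o_def)
  qed
  have "- P x = 0"
  proof (rule wronskian_at_infinity_eq_0[of Y "\<lambda>t. u (- t)" "\<lambda>t. - u' (- t)" "\<lambda>t. v (- t)" "\<lambda>t. - v' (- t)" "- P x" K])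
    show "u (- t) * - v' (- t) - - u' (- t) * v (- t) = - P x" if "t > Y" for t
    proof -
      have "u (- t) * - v' (- t) - - u' (- t) * v (- t) = - P (- t)" by (simp add: P_def)
      thus ?thesis using P[of "- t"] that by simp
    qed
    show "((\<lambda>t. u (- t)) has_vector_derivative - u' (- t)) (at t)" if "t > Y" for t
      by (rule refl[where g = u and g' = u' and t = t], rule du) (use that Y \<kappa> in auto)
    show "((\<lambda>t. v (- t)) has_vector_derivative - v' (- t)) (at t)" for t by (rule refl[where g = v and g' = v' and t = t], rule dv)
    show "continuous_on {Y<..} (\<lambda>t. - v' (- t))"
      by (rule continuous_on_minus[OF continuous_on_compose2[OF cv(2)[of UNIV] continuous_on_minus[OF continuous_on_id]]]) simp
    show "integrable lborel (\<lambda>x. (cmod (u (- x)))\<^sup>2)"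
      using u lborel_integrable_real_affine[of "\<lambda>x. (cmod (u x))\<^sup>2" "-1" 0] unfolding L2_def by simp
    show "cmod (- v' (- t)) \<le> K * t powr (1/4)" if "t > Y" for t using b(2)[of "- t"] that by simp
    show "cmod (v (- t)) \<le> K" if "t > Y" for t using b(1)[of "- t"] that by simp
  qed (rule Y)
  thus ?thesis by simp
qed

end

section \<open>Solutions of the unperturbed Stark equation\<close>

text \<open>In the sector of half-angle \<open>pi / 3\<close> the root \<open>s\<close> has an angle
  of at most \<open>pi / 6\<close>, so \<open>Re (s ^ 3) \<ge> 0\<close> by the formula for the
  tripled angle, and the exponential is bounded by 1.\<close>

lemma airy_bounded_sector:
  assumes "Re z \<ge> cmod z / 2" "cmod z \<ge> 1"
  shows "cmod (Airy z) \<le> 4" "cmod (Airy' z) \<le> 7 * cmod z powr (1/4)"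
proof -
  define s where "s = csqrt z"
  have s2: "s\<^sup>2 = z" by (simp add: s_def)
  have n: "cmod s = sqrt (cmod z)" by (simp add: s_def)
  hence n1: "cmod s \<ge> 1" using assms(2) by simp
  have re: "Re s = sqrt ((cmod z + Re z) / 2)" by (simp add: s_def)
  have r2: "(Re s)\<^sup>2 \<ge> 3 / 4 * (cmod s)\<^sup>2"
    using assms by (simp add: re n)
  have re0: "Re s \<ge> 0" using assms by (simp add: re)
  have "(cmod s / 2)\<^sup>2 = (cmod s)\<^sup>2 / 4" by (simp add: power_divide)
  hence "(cmod s / 2)\<^sup>2 \<le> (Re s)\<^sup>2" using r2 zero_le_power2[of "cmod s"] by linarith
  hence s: "Re s \<ge> cmod s / 2" using re0 by (rule power2_le_imp_le)
  have nz: "s \<noteq> 0" using n1 by auto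
  have "Re (s ^ 3) = Re s * (4 * (Re s)\<^sup>2 - 3 * (cmod s)\<^sup>2)"
    by (simp only: cmod_power2) (simp add: power3_eq_cube power2_eq_square algebra_simps)
  hence re3: "Re (s ^ 3) \<ge> 0" using r2 re0 by simp
  have ex: "cmod (exp (- 2 / 3 * s ^ 3)) \<le> 1" using re3 by simp
  have "3 / cmod s ^ 3 \<le> 3 / 1" using n1 by (intro divide_left_mono) auto
  note small = this
  have c: "cmod (csqrt s) = sqrt (cmod s)" "sqrt (cmod s) \<ge> 1" using n1 by simp_all
  obtain e where e: "Airy (s\<^sup>2) = exp (- 2 / 3 * s ^ 3) / csqrt s * (1 + e)" "cmod e \<le> 3 / cmod s ^ 3"
    by (rule airy_asymptotics[OF s nz])
  have "cmod (1 + e) \<le> 4" using norm_triangle_ineq[of 1 e] e(2) small by simp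
  moreover have "cmod (exp (- 2 / 3 * s ^ 3)) / cmod (csqrt s) \<le> 1 / 1"
    using ex c by (intro frac_le) auto
  ultimately have "cmod (exp (- 2 / 3 * s ^ 3)) / cmod (csqrt s) * cmod (1 + e) \<le> 1 * 4"
    by (intro mult_mono) auto
  thus "cmod (Airy z) \<le> 4" using e(1) unfolding s2 by (simp add: norm_mult norm_divide)
  obtain e where e: "Airy' (s\<^sup>2) = - s * exp (- 2 / 3 * s ^ 3) / csqrt s * (1 + e)" "cmod e \<le> 6 / cmod s ^ 3"
    by (rule airy_deriv_asymptotics[OF s nz])
  have "cmod (1 + e) \<le> 7" using norm_triangle_ineq[of 1 e] e(2) small by simp
  moreover have "cmod s / cmod (csqrt s) = sqrt (cmod s)" unfolding c(1) using real_div_sqrt[of "cmod s"] by simp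
  moreover have "sqrt (cmod s) = cmod z powr (1/4)"
    unfolding n using assms(2) by (simp add: powr_powr flip: powr_half_sqrt)
  ultimately have "(cmod s / cmod (csqrt s)) * cmod (exp (- 2 / 3 * s ^ 3)) * cmod (1 + e) \<le> cmod z powr (1/4) * 1 * 7"
    using ex by (intro mult_mono) auto
  thus "cmod (Airy' z) \<le> 7 * cmod z powr (1/4)"
    using e(1) unfolding s2 by (simp add: norm_mult norm_divide mult_ac)
qed

text \<open>The affine change of variable that turns \<open>- u'' + f * x * u = w * u\<close> into
  Airy's equation.\<close>

definition stark_arg :: "real \<Rightarrow> complex \<Rightarrow> real \<Rightarrow> complex" where
  "stark_arg f w x = of_real (root 3 f) * (of_real x - w / of_real f)"

definition "stark_a f w x = Airy (stark_arg f w x)"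
definition "stark_a' f w x = of_real (root 3 f) * Airy' (stark_arg f w x)"
definition "stark_g f w x = Airy (tau ^ 4 * stark_arg f w x)"
definition "stark_g' f w x = of_real (root 3 f) * (tau ^ 4 * Airy' (tau ^ 4 * stark_arg f w x))"
definition stark_wronskian :: "real \<Rightarrow> complex" where "stark_wronskian f = - 2 * tau ^ 5 * of_real (root 3 f)"
text \<open>Divided by \<open>stark_wronskian f\<close> this is, for \<open>Im w > 0\<close>, the
  Green's function of the Stark operator without deltas: \<open>stark_a\<close> is the solution
  controlled at plus infinity, \<open>stark_g\<close> the one controlled at minus infinity.\<close>

definition "stark_K f w x y = stark_a f w (max x y) * stark_g f w (min x y)"

lemma stark_wronskian_eq:
  "stark_a f w x * stark_g' f w x - stark_a' f w x * stark_g f w x = stark_wronskian f"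
  unfolding stark_a_def stark_a'_def stark_g_def stark_g'_def stark_wronskian_def airy_wronskian[of "stark_arg f w x", symmetric]
  by (simp add: algebra_simps)

lemma stark_deriv:
  assumes f: "f > 0"
  shows "(stark_a f w has_vector_derivative stark_a' f w x) (at x)"
    "(stark_a' f w has_vector_derivative (of_real (f * x) - w) * stark_a f w x) (at x)"
    "(stark_g f w has_vector_derivative stark_g' f w x) (at x)"
    "(stark_g' f w has_vector_derivative (of_real (f * x) - w) * stark_g f w x) (at x)"
proof -
  let ?r = "complex_of_real (root 3 f)"
  have r3: "?r * ?r * ?r = of_real f"
    using f real_root_pow_pos2[of 3 f] by (simp flip: of_real_mult power3_eq_cube)
  have arg: "?r * ?r * stark_arg f w x = of_real (f * x) - w"
  proof -
    have "?r * ?r * stark_arg f w x = (?r * ?r * ?r) * (of_real x - w / of_real f)"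
      by (simp add: stark_arg_def)
    thus ?thesis unfolding r3 using f by (simp add: right_diff_distrib)
  qed
  have t12: "tau ^ 4 * (tau ^ 4 * (tau ^ 4 * c)) = c" for c
    using tau_12 by (simp flip: mult.assoc power_add)
  have lin: "((\<lambda>x. c * stark_arg f w x) has_vector_derivative c * ?r) (at x)" for c
    unfolding stark_arg_def
    by (intro has_vector_derivative_mult_right, rule has_vector_derivative_eq_rhs,
        rule has_vector_derivative_mult_right, rule has_vector_derivative_diff[OF has_vector_derivative_of_real has_vector_derivative_const])
       (auto intro!: derivative_eq_intros)
  have ch: "((\<lambda>x. F (c * stark_arg f w x)) has_vector_derivative c * ?r * F') (at x)"
    if "(F has_field_derivative F') (at (c * stark_arg f w x))" for F F' c
    using field_vector_diff_chain_at[OF lin that] by (simp add: o_def)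
  show "(stark_a f w has_vector_derivative stark_a' f w x) (at x)"
    unfolding stark_a_def[abs_def] stark_a'_def using ch[where c = 1, OF Airy_deriv(1)] by simp
  show "(stark_g f w has_vector_derivative stark_g' f w x) (at x)"
    unfolding stark_g_def[abs_def] stark_g'_def using ch[where c = "tau ^ 4", OF Airy_deriv(1)] by (simp add: mult_ac)
  have "(stark_a' f w has_vector_derivative ?r * (?r * (stark_arg f w x * Airy (stark_arg f w x)))) (at x)"
    unfolding stark_a'_def[abs_def]
    using has_vector_derivative_mult_right[OF ch[where c = 1, OF Airy_deriv(2)], of ?r] by simp
  also have "?r * (?r * (stark_arg f w x * Airy (stark_arg f w x))) = (of_real (f * x) - w) * stark_a f w x"
    unfolding stark_a_def arg[symmetric] by (simp add: mult_ac)
  finally show "(stark_a' f w has_vector_derivative (of_real (f * x) - w) * stark_a f w x) (at x)" .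
  have "(stark_g' f w has_vector_derivative
      ?r * (tau ^ 4 * ((tau ^ 4 * ?r) * ((tau ^ 4 * stark_arg f w x) * Airy (tau ^ 4 * stark_arg f w x))))) (at x)"
    unfolding stark_g'_def[abs_def]
    by (intro has_vector_derivative_mult_right ch Airy_deriv)
  also have "?r * (tau ^ 4 * ((tau ^ 4 * ?r) * ((tau ^ 4 * stark_arg f w x) * Airy (tau ^ 4 * stark_arg f w x))))
    = (?r * ?r * stark_arg f w x) * (tau ^ 4 * (tau ^ 4 * (tau ^ 4 * stark_g f w x)))"
    unfolding stark_g_def by (simp only: mult_ac)
  also have "\<dots> = (of_real (f * x) - w) * stark_g f w x" unfolding arg t12 by simp
  finally show "(stark_g' f w has_vector_derivative (of_real (f * x) - w) * stark_g f w x) (at x)" .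
qed

lemma continuous_on_stark:
  assumes "f > 0"
  shows "continuous_on A (stark_a f w)" "continuous_on A (stark_g f w)"
  by (rule continuous_at_imp_continuous_on, rule ballI, rule has_vector_derivative_continuous, rule stark_deriv[OF assms])+

lemma continuous_on_stark_K:
  assumes "f > 0"
  shows "continuous_on UNIV (\<lambda>y. stark_K f w x y)" "continuous_on UNIV (\<lambda>x. stark_K f w x y)"
  unfolding stark_K_def
  by (intro continuous_intros continuous_on_compose2[OF continuous_on_stark(1)[OF assms, of UNIV]]
     continuous_on_compose2[OF continuous_on_stark(2)[OF assms, of UNIV]]; simp)+

text \<open>The condition \<open>Im w > 0\<close> enters through \<open>stark_g\<close>: the
  imaginary part of \<open>stark_arg\<close> is negative, so far to the left its angle lies between
  \<open>- pi\<close> and \<open>- pi / 2\<close>, and multiplication by \<open>tau ^ 4\<close>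
  brings it into the sector of \<open>airy_bounded_sector\<close>.\<close>

lemma stark_decay:
  assumes f: "f > 0" and w: "Im w > 0"
  obtains Y K where "Y \<ge> 1"
    "\<And>x. x > Y \<Longrightarrow> cmod (stark_a f w x) \<le> K" "\<And>x. x > Y \<Longrightarrow> cmod (stark_a' f w x) \<le> K * x powr (1/4)"
    "\<And>x. x < -Y \<Longrightarrow> cmod (stark_g f w x) \<le> K" "\<And>x. x < -Y \<Longrightarrow> cmod (stark_g' f w x) \<le> K * (-x) powr (1/4)"
proof -
  define r where "r = root 3 f"
  have r: "r > 0" using f by (simp add: r_def)
  define c where "c = r * (1 + cmod w / f)"
  have c: "c > 0" using r f by (simp add: c_def add_pos_nonneg)
  \<comment> \<open>Beyond \<open>Y\<close> the modulus of the real part of \<open>stark_arg\<close>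
    exceeds that of the imaginary part by at least 1; \<open>cmod w / f\<close> is counted once for
    \<open>Re w\<close> and once for \<open>Im w\<close>.\<close>
  define Y where "Y = 2 * cmod w / f + 1 / r + 1"
  define K where "K = 4 + r * (7 * c powr (1/4))"
  have Y1: "Y \<ge> 1" using r f by (simp add: Y_def)
  let ?z = "stark_arg f w"
  have re: "Re (?z x) = r * (x - Re w / f)" and im: "Im (?z x) = - (r * (Im w / f))" for x
    by (simp_all add: stark_arg_def r_def)
  have im': "\<bar>Im (?z x)\<bar> \<le> r * (cmod w / f)" for x
    unfolding im using r f w abs_Im_le_cmod[of w] by (simp add: abs_mult divide_right_mono)
  have nz: "cmod (?z x) \<le> c * \<bar>x\<bar>" if "\<bar>x\<bar> > Y" for x
  proof -
    have "cmod (?z x) = r * cmod (of_real x - w / of_real f)"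
      unfolding stark_arg_def norm_mult using r by (simp add: r_def)
    also have "\<dots> \<le> r * (\<bar>x\<bar> + cmod w / f)"
      using r f norm_triangle_ineq4[of "of_real x" "w / of_real f"] by (intro mult_left_mono) (auto simp: norm_divide)
    also have "cmod w / f * 1 \<le> cmod w / f * \<bar>x\<bar>"
      using f that Y1 by (intro mult_left_mono) auto
    hence "r * (\<bar>x\<bar> + cmod w / f) \<le> c * \<bar>x\<bar>"
      using r by (simp add: c_def mult.assoc distrib_right)
    finally show ?thesis .
  qed
  have pw: "r * (7 * cmod (?z x) powr (1/4)) \<le> K * \<bar>x\<bar> powr (1/4)" if "\<bar>x\<bar> > Y" for x
  proof -
    have "cmod (?z x) powr (1/4) \<le> (c * \<bar>x\<bar>) powr (1/4)" by (intro powr_mono2 nz that) auto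
    hence "r * (7 * cmod (?z x) powr (1/4)) \<le> r * (7 * (c * \<bar>x\<bar>) powr (1/4))" using r by simp
    also have "\<dots> = r * (7 * c powr (1/4)) * \<bar>x\<bar> powr (1/4)" using c by (simp add: powr_mult)
    also have "\<dots> \<le> K * \<bar>x\<bar> powr (1/4)" by (intro mult_right_mono) (auto simp: K_def)
    finally show ?thesis .
  qed
  have K4: "4 \<le> K" using r by (simp add: K_def)
  have big: "r * (\<bar>x\<bar> - cmod w / f) \<ge> 1 + r * (cmod w / f)" if "\<bar>x\<bar> > Y" for x
  proof -
    have "\<bar>x\<bar> - cmod w / f \<ge> 1 / r + cmod w / f" using that by (simp add: Y_def)
    from mult_left_mono[OF this, of r] r show ?thesis by (simp add: distrib_left)
  qed
  have "\<bar>Re w / f\<bar> \<le> cmod w / f" using f abs_Re_le_cmod[of w] by (simp add: divide_right_mono)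
  hence wre: "Re w / f \<le> cmod w / f" "- (Re w / f) \<le> cmod w / f" by linarith+
  have sec1: "Re (?z x) \<ge> cmod (?z x) / 2 \<and> cmod (?z x) \<ge> 1" if "x > Y" for x
  proof -
    have "Re (?z x) \<ge> r * (\<bar>x\<bar> - cmod w / f)"
      unfolding re using r wre that Y1 by (intro mult_left_mono) auto
    hence R: "Re (?z x) \<ge> 1 + r * (cmod w / f)" using big[of x] that Y1 by auto
    have "cmod (?z x) \<le> Re (?z x) + \<bar>Im (?z x)\<bar>" using cmod_le[of "?z x"] R r f
      by (smt (verit) divide_nonneg_pos mult_nonneg_nonneg norm_ge_zero)
    moreover have "Re (?z x) \<le> cmod (?z x)" by (rule complex_Re_le_cmod)
    moreover have "0 \<le> r * (cmod w / f)" using r f by simp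
    ultimately show ?thesis using R im'[of x] by (intro conjI; linarith)
  qed
  have sec2: "Re (tau ^ 4 * ?z x) \<ge> cmod (tau ^ 4 * ?z x) / 2 \<and> cmod (tau ^ 4 * ?z x) \<ge> 1" if "x < - Y" for x
  proof -
    have n: "cmod (tau ^ 4 * ?z x) = cmod (?z x)" by (simp add: norm_mult norm_power tau_simps(4))
    have "- Re (?z x) = r * (\<bar>x\<bar> + Re w / f)" unfolding re using that Y1 by (simp add: algebra_simps)
    also have "\<dots> \<ge> r * (\<bar>x\<bar> - cmod w / f)" using r wre by (intro mult_left_mono) auto
    finally have R: "- Re (?z x) \<ge> 1 + r * (cmod w / f)" using big[of x] that Y1 by auto
    moreover have "0 \<le> r * (cmod w / f)" using r f by simp
    ultimately have R1: "- Re (?z x) \<ge> 1" by linarith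
    have I: "- Im (?z x) \<ge> 0" unfolding im using r f w by simp
    have sq: "(cmod (?z x))\<^sup>2 \<le> (- Re (?z x) + sqrt 3 * (- Im (?z x)))\<^sup>2"
    proof -
      have "0 \<le> - Re (?z x) * - Im (?z x) * sqrt 3" using R1 I by (intro mult_nonneg_nonneg) auto
      thus ?thesis by (simp only: cmod_power2 power2_sum power_mult_distrib real_sqrt_pow2) (simp add: algebra_simps)
    qed
    have "0 \<le> sqrt 3 * (- Im (?z x))" using I by (intro mult_nonneg_nonneg) auto
    hence "0 \<le> - Re (?z x) + sqrt 3 * (- Im (?z x))" using R1 by linarith
    with sq have "cmod (?z x) \<le> - Re (?z x) + sqrt 3 * (- Im (?z x))"
      by (rule power2_le_imp_le)
    moreover have "Re (tau ^ 4 * ?z x) = (- Re (?z x) + sqrt 3 * (- Im (?z x))) / 2"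
      unfolding tau_simps(2) by (simp add: tau_Complex power2_eq_square field_simps)
    moreover have "cmod (?z x) \<ge> 1" using R1 abs_Re_le_cmod[of "?z x"] by linarith
    ultimately show ?thesis unfolding n by simp
  qed
  show ?thesis
  proof (rule that[of Y K])
    fix x assume x: "x > Y"
    show "cmod (stark_a f w x) \<le> K"
      using airy_bounded_sector(1)[of "?z x"] sec1[OF x] K4 by (simp add: stark_a_def)
    have "cmod (stark_a' f w x) \<le> r * (7 * cmod (?z x) powr (1/4))"
      using airy_bounded_sector(2)[of "?z x"] sec1[OF x] r by (simp add: stark_a'_def norm_mult r_def[symmetric])
    also have "\<dots> \<le> K * \<bar>x\<bar> powr (1/4)" by (rule pw) (use x in auto)
    finally show "cmod (stark_a' f w x) \<le> K * x powr (1/4)" using x Y1 by simp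
  next
    fix x assume x: "x < - Y"
    have n: "cmod (tau ^ 4 * ?z x) = cmod (?z x)" by (simp add: norm_mult norm_power tau_simps(4))
    show "cmod (stark_g f w x) \<le> K"
      using airy_bounded_sector(1)[of "tau ^ 4 * ?z x"] sec2[OF x] K4 by (simp add: stark_g_def)
    have "cmod (stark_g' f w x) \<le> r * (7 * cmod (?z x) powr (1/4))"
      using airy_bounded_sector(2)[of "tau ^ 4 * ?z x"] sec2[OF x] r unfolding n
      by (simp add: stark_g'_def norm_mult r_def[symmetric] norm_power tau_simps(4))
    also have "\<dots> \<le> K * \<bar>x\<bar> powr (1/4)" by (rule pw) (use x in auto)
    finally show "cmod (stark_g' f w x) \<le> K * (-x) powr (1/4)" using x Y1 by simp
  qed (rule Y1)
qed

section \<open>Resolvent identity and determinant\<close>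

text \<open>Eliminating \<open>u'\<close> from the Wronskians of \<open>u\<close> with the two Airy
  solutions gives \<open>W * u = a * P_g - g * P_a\<close>. Each Wronskian is integrated from the
  end at which it vanishes: \<open>P_a\<close> from the right, \<open>P_g\<close> from the
  left.\<close>

lemma lippmann_schwinger:
  assumes pos: "\<kappa> > 0" "\<eta> > 0" "f > 0" "Im w > 0"
    and op: "stark_op \<kappa> \<eta> f u (\<lambda>x. w * u x + g x)"
    and g: "continuous_on UNIV g" "\<And>x. \<bar>x\<bar> > L \<Longrightarrow> g x = 0"
    and x: "x \<notin> {\<kappa>, -\<kappa>}"
  obtains Y where "Y \<ge> L" "stark_wronskian f * u x = integral {-Y..Y} (\<lambda>y. stark_K f w x y * g y)
      - (stark_K f w x \<kappa> * u \<kappa> + stark_K f w x (-\<kappa>) * u (-\<kappa>)) / \<eta>"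
proof -
  have uL: "u \<in> L2" and cu: "continuous_on UNIV u" using op by (auto simp: stark_op_def)
  obtain u' where du: "\<And>x. x \<notin> {\<kappa>, -\<kappa>} \<Longrightarrow> (u has_vector_derivative u' x) (at x)"
    and inc: "\<And>a b. a \<le> b \<Longrightarrow> {a..b} \<inter> {\<kappa>, -\<kappa>} = {} \<Longrightarrow>
              u' b - u' a = (LINT x:{a..b}|lborel. complex_of_real (f * x) * u x - (w * u x + g x))"
    and jump: "\<And>s. s \<in> {\<kappa>, -\<kappa>} \<Longrightarrow> \<exists>l r. (u' \<longlongrightarrow> l) (at_left s) \<and> (u' \<longlongrightarrow> r) (at_right s) \<and> r - l = u s / complex_of_real \<eta>"
    using op unfolding stark_op_def by blast
  have ch: "continuous_on UNIV (\<lambda>x. complex_of_real (f * x) * u x - (w * u x + g x))"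
    by (intro continuous_intros cu g)
  have du': "(u' has_vector_derivative (of_real (f * x) - w) * u x - g x) (at x)" if "x \<notin> {\<kappa>, -\<kappa>}" for x
    using has_vector_derivative_of_increment[OF pos(1) that ch inc] by (simp add: algebra_simps)
  interpret A: stark_solution \<kappa> \<eta> f w u u' g "stark_a f w" "stark_a' f w"
    by (rule stark_solution.intro) (erule du du' jump | rule pos cu g stark_deriv)+
  interpret G: stark_solution \<kappa> \<eta> f w u u' g "stark_g f w" "stark_g' f w"
    by (rule stark_solution.intro) (erule du du' jump | rule pos cu g stark_deriv)+
  obtain Y0 K where Y0: "Y0 \<ge> 1"
    "\<And>x. x > Y0 \<Longrightarrow> cmod (stark_a f w x) \<le> K" "\<And>x. x > Y0 \<Longrightarrow> cmod (stark_a' f w x) \<le> K * x powr (1/4)"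
    "\<And>x. x < -Y0 \<Longrightarrow> cmod (stark_g f w x) \<le> K" "\<And>x. x < -Y0 \<Longrightarrow> cmod (stark_g' f w x) \<le> K * (-x) powr (1/4)"
    using stark_decay[OF pos(3,4)] by blast
  define Y1 where "Y1 = Max {Y0, \<kappa> + 1, L, \<bar>x\<bar>}"
  have Y1: "Y1 \<ge> Y0" "Y1 \<ge> \<kappa> + 1" "Y1 \<ge> L" "Y1 \<ge> \<bar>x\<bar>" by (simp_all add: Y1_def)
  define Y where "Y = Y1 + 1"
  have "A.P Y = 0"
    by (rule A.P_eq_0_right[of Y1 K]) (use uL g Y0 Y1 in \<open>auto simp: Y_def\<close>)
  moreover have "G.P (- Y) = 0"
    by (rule G.P_eq_0_left[of Y1 K]) (use uL g Y0 Y1 in \<open>auto simp: Y_def\<close>)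
  moreover have "A.P Y - A.P x = integral {x..Y} (\<lambda>y. g y * stark_a f w y) - A.J x Y \<kappa> - A.J x Y (-\<kappa>)"
    by (rule A.P_increment) (use x Y1 pos in \<open>auto simp: Y_def\<close>)
  moreover have "G.P x - G.P (- Y) = integral {-Y..x} (\<lambda>y. g y * stark_g f w y) - G.J (-Y) x \<kappa> - G.J (-Y) x (-\<kappa>)"
    by (rule G.P_increment) (use x Y1 pos in \<open>auto simp: Y_def\<close>)
  ultimately have PA: "A.P x = - integral {x..Y} (\<lambda>y. g y * stark_a f w y) + A.J x Y \<kappa> + A.J x Y (-\<kappa>)"
    and PG: "G.P x = integral {-Y..x} (\<lambda>y. g y * stark_g f w y) - G.J (-Y) x \<kappa> - G.J (-Y) x (-\<kappa>)"
    by (simp_all add: algebra_simps minus_equation_iff)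
  have I1: "integral {-Y..x} (\<lambda>y. stark_K f w x y * g y) = stark_a f w x * integral {-Y..x} (\<lambda>y. g y * stark_g f w y)"
    unfolding integral_mult_right[symmetric]
    by (rule integral_cong) (simp add: stark_K_def max_absorb1 min_absorb2)
  have I2: "integral {x..Y} (\<lambda>y. stark_K f w x y * g y) = stark_g f w x * integral {x..Y} (\<lambda>y. g y * stark_a f w y)"
    unfolding integral_mult_right[symmetric]
    by (rule integral_cong) (simp add: stark_K_def max_absorb2 min_absorb1)
  have I: "integral {-Y..x} (\<lambda>y. stark_K f w x y * g y) + integral {x..Y} (\<lambda>y. stark_K f w x y * g y)
      = integral {-Y..Y} (\<lambda>y. stark_K f w x y * g y)"
    by (rule Henstock_Kurzweil_Integration.integral_combine)
       (use Y1 in \<open>auto simp: Y_def intro!: integrable_continuous_interval continuous_on_mult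
          continuous_on_subset[OF continuous_on_stark_K(1)[OF pos(3)]] continuous_on_subset[OF g(1)]\<close>)
  have Js: "stark_a f w x * G.J (-Y) x s + stark_g f w x * A.J x Y s = stark_K f w x s * u s / \<eta>"
    if "s \<in> {\<kappa>, -\<kappa>}" for s
  proof -
    have "s \<noteq> x" "-Y < s" "s < Y" using that x Y1 pos by (auto simp: Y_def)
    thus ?thesis by (cases "s < x") (simp_all add: stark_K_def A.J_def G.J_def max_def min_def)
  qed
  have "stark_wronskian f * u x = stark_a f w x * G.P x - stark_g f w x * A.P x"
    unfolding stark_wronskian_eq[of f w x, symmetric] A.P_def G.P_def by (simp add: algebra_simps)
  also have "\<dots> = stark_a f w x * integral {-Y..x} (\<lambda>y. g y * stark_g f w y) + stark_g f w x * integral {x..Y} (\<lambda>y. g y * stark_a f w y)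
      - (stark_a f w x * G.J (-Y) x \<kappa> + stark_g f w x * A.J x Y \<kappa>)
      - (stark_a f w x * G.J (-Y) x (-\<kappa>) + stark_g f w x * A.J x Y (-\<kappa>))"
    unfolding PA PG by (simp add: algebra_simps)
  also have "\<dots> = integral {-Y..Y} (\<lambda>y. stark_K f w x y * g y) - stark_K f w x \<kappa> * u \<kappa> / \<eta> - stark_K f w x (-\<kappa>) * u (-\<kappa>) / \<eta>"
    unfolding I[symmetric] I1 I2 using Js[of \<kappa>] Js[of "-\<kappa>"] by simp
  finally show ?thesis using Y1 by (intro that[of Y]) (auto simp: Y_def add_divide_distrib)
qed

text \<open>Testing with \<open>cnj q\<close> times a tent function centred at \<open>y\<close>
  makes the integrand continuous and nonnegative, so it vanishes at \<open>y\<close>, where the tent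
  has height 1.\<close>

lemma continuous_eq_0_if_integrals_vanish:
  fixes q :: "real \<Rightarrow> complex"
  assumes q: "continuous_on UNIV q"
    and int: "\<And>g L. continuous_on UNIV g \<Longrightarrow> (\<And>x. \<bar>x\<bar> > L \<Longrightarrow> g x = 0) \<Longrightarrow>
       \<exists>Y\<ge>L. integral {-Y..Y} (\<lambda>y. q y * g y) = 0"
  shows "q y = 0"
proof -
  define t where "t x = max 0 (1 - \<bar>x - y\<bar>)" for x :: real
  have ct: "continuous_on A t" for A unfolding t_def[abs_def] by (intro continuous_intros)
  define g where "g x = of_real (t x) * cnj (q x)" for x
  have cg: "continuous_on UNIV g" unfolding g_def[abs_def] by (intro continuous_intros ct q)
  have t0: "t x = 0" if "\<bar>x\<bar> > \<bar>y\<bar> + 1" for x using that by (auto simp: t_def)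
  hence "g x = 0" if "\<bar>x\<bar> > \<bar>y\<bar> + 1" for x using that by (simp add: g_def)
  from int[OF cg this] obtain Y where Y: "Y \<ge> \<bar>y\<bar> + 1" "integral {-Y..Y} (\<lambda>y. q y * g y) = 0" by blast
  let ?h = "\<lambda>x. t x * (cmod (q x))\<^sup>2"
  have qg: "q x * g x = of_real (?h x)" for x
    unfolding g_def by (simp add: complex_norm_square mult_ac del: of_real_power)
  have ch: "continuous_on A ?h" for A
    by (intro continuous_intros ct continuous_on_subset[OF q]) auto
  have "((\<lambda>x. complex_of_real (?h x)) has_integral of_real (integral {-Y..Y} ?h)) {-Y..Y}"
    by (intro has_integral_of_real integrable_integral integrable_continuous_interval ch)
  hence "integral {-Y..Y} ?h = 0" using Y(2) unfolding qg by (simp add: integral_unique)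
  moreover have "(?h has_integral integral {-Y..Y} ?h) (cbox (-Y) Y)"
    using integrable_integral[OF integrable_continuous_interval[OF ch]] by simp
  ultimately have "?h y = 0"
    using has_integral_0_cbox_imp_0[of "-Y" Y ?h y] Y(1) ch by (force simp: t_def)
  thus ?thesis by (simp add: t_def)
qed

text \<open>\<open>G\<close> is known only through its action on functions, so the equation for
  \<open>u\<close> is tested against all continuous \<open>g\<close> of compact support. The points
  \<open>x = \<kappa>\<close> and \<open>x = - \<kappa>\<close>, excluded because \<open>u'\<close>
  jumps there, are recovered by continuity.\<close>

lemma green_function_identity:
  assumes pos: "\<kappa> > 0" "\<eta> > 0" "f > 0" "Im w > 0" and G: "green_function \<kappa> \<eta> f w G"
  shows "stark_wronskian f * G x y = stark_K f w x y
     - (stark_K f w x \<kappa> * G \<kappa> y + stark_K f w x (-\<kappa>) * G (-\<kappa>) y) / \<eta>"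
proof -
  have cG: "continuous_on UNIV (\<lambda>(x, y). G x y)" using G by (simp add: green_function_def)
  have cG1: "continuous_on UNIV (\<lambda>y. G x y)" and cG2: "continuous_on UNIV (\<lambda>x. G x y)" for x y
    using continuous_on_compose2[OF cG, of UNIV "\<lambda>y. (x, y)"] continuous_on_compose2[OF cG, of UNIV "\<lambda>x. (x, y)"]
    by (simp_all add: continuous_on_Pair)
  define q where "q x y = stark_wronskian f * G x y - stark_K f w x y
     + (stark_K f w x \<kappa> * G \<kappa> y + stark_K f w x (-\<kappa>) * G (-\<kappa>) y) / \<eta>" for x y
  have off: "q x y = 0" if x: "x \<notin> {\<kappa>, -\<kappa>}" for x y
  proof (rule continuous_eq_0_if_integrals_vanish[of "q x"])
    show "continuous_on UNIV (q x)"
      unfolding q_def[abs_def] by (intro continuous_intros cG1 continuous_on_stark_K pos) (use pos in auto)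
    fix g :: "real \<Rightarrow> complex" and L :: real
    assume g: "continuous_on UNIV g" "\<And>x. \<bar>x\<bar> > L \<Longrightarrow> g x = 0"
    define u where "u x = (LINT y|lborel. G x y * g y)" for x
    have "g \<in> L2"
    proof -
      have "integrable lborel (\<lambda>x. g x * cnj (g x))"
        by (rule continuous_compact_support_integral(1)[of _ "-L" L])
           (use g in \<open>auto intro!: continuous_intros\<close>)
      hence "integrable lborel (\<lambda>x. norm (g x * cnj (g x)))" by (rule integrable_norm)
      moreover have "g \<in> borel_measurable lborel" using borel_measurable_continuous_onI[OF g(1)] by simp
      ultimately show ?thesis by (simp add: L2_def norm_mult power2_eq_square)
    qed
    hence op: "stark_op \<kappa> \<eta> f u (\<lambda>x. w * u x + g x)"
      using G unfolding green_function_def u_def[abs_def] Let_def by blast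
    obtain Y where Y: "Y \<ge> L" "stark_wronskian f * u x = integral {-Y..Y} (\<lambda>y. stark_K f w x y * g y)
      - (stark_K f w x \<kappa> * u \<kappa> + stark_K f w x (-\<kappa>) * u (-\<kappa>)) / \<eta>"
      using lippmann_schwinger[OF pos op g x] by blast
    have u: "((\<lambda>y. G x y * g y) has_integral u x) {-Y..Y}" for x
    proof -
      have c: "continuous_on UNIV (\<lambda>y. G x y * g y)" by (intro continuous_intros cG1 g)
      have "u x = integral {-Y..Y} (\<lambda>y. G x y * g y)"
        unfolding u_def by (rule continuous_compact_support_integral(2)[OF c]) (use g(2) Y(1) in auto)
      thus ?thesis using integrable_continuous_interval[OF continuous_on_subset[OF c], of "-Y" Y]
        by (auto intro: integrable_integral)
    qed
    have cK: "continuous_on UNIV (\<lambda>y. stark_K f w x y * g y)" by (intro continuous_intros continuous_on_stark_K pos g)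
    have K: "((\<lambda>y. stark_K f w x y * g y) has_integral integral {-Y..Y} (\<lambda>y. stark_K f w x y * g y)) {-Y..Y}"
      by (intro integrable_integral integrable_continuous_interval continuous_on_subset[OF cK]) auto
    have "((\<lambda>y. stark_wronskian f * (G x y * g y) - stark_K f w x y * g y
       + (stark_K f w x \<kappa> * (G \<kappa> y * g y) + stark_K f w x (-\<kappa>) * (G (-\<kappa>) y * g y)) / of_real \<eta>) has_integral
       (stark_wronskian f * u x - integral {-Y..Y} (\<lambda>y. stark_K f w x y * g y)
       + (stark_K f w x \<kappa> * u \<kappa> + stark_K f w x (-\<kappa>) * u (-\<kappa>)) / of_real \<eta>)) {-Y..Y}"
      by (intro has_integral_add has_integral_diff has_integral_mult_right has_integral_divide u K)
    hence "((\<lambda>y. q x y * g y) has_integral 0) {-Y..Y}"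
      unfolding Y(2) q_def by (simp add: algebra_simps add_divide_distrib)
    thus "\<exists>Y\<ge>L. integral {-Y..Y} (\<lambda>y. q x y * g y) = 0" using Y(1) by (auto intro: integral_unique)
  qed
  have "q x y = 0"
  proof (rule continuous_constant_on_closure[of "- {\<kappa>, -\<kappa>}" "\<lambda>x. q x y" 0])
    show "continuous_on (closure (- {\<kappa>, - \<kappa>})) (\<lambda>x. q x y)"
      unfolding q_def by (rule continuous_on_subset[of UNIV]) 
        (use pos in \<open>auto intro!: continuous_intros cG2 continuous_on_stark_K\<close>)
    show "x \<in> closure (- {\<kappa>, - \<kappa>})"
    proof -
      have "interior {\<kappa>, -\<kappa>} = {}" by (intro empty_interior_finite) auto
      thus ?thesis by (simp add: closure_complement)
    qed
  qed (use off in auto)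
  thus ?thesis by (simp add: q_def algebra_simps)
qed

text \<open>This is \<open>\<W>\<^sup>2 * D\<close> in the notation of the paper, up to the normalization of the Airy function.\<close>

definition stark_det :: "real \<Rightarrow> real \<Rightarrow> real \<Rightarrow> complex \<Rightarrow> complex" where
  "stark_det \<kappa> \<eta> f w =
     (stark_wronskian f + stark_K f w \<kappa> \<kappa> / \<eta>) * (stark_wronskian f + stark_K f w (-\<kappa>) (-\<kappa>) / \<eta>)
     - (stark_K f w \<kappa> (-\<kappa>) / \<eta>)\<^sup>2"

lemma stark_K_sym: "stark_K f w x y = stark_K f w y x"
  by (simp add: stark_K_def max.commute min.commute)

lemma stark_K_holomorphic: "(\<lambda>w. stark_K f w x y) holomorphic_on A"
proof -
  have A: "Airy holomorphic_on B" for B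
    using Airy_deriv(1) by (intro holomorphic_onI) (auto simp: field_differentiable_def intro: has_field_derivative_at_within)
  have "(\<lambda>w. stark_arg f w x) holomorphic_on B" for x B
  \<comment> \<open>For \<open>f = 0\<close> the factor \<open>root 3 f\<close> is 0 and the
    argument is constant.\<close>
  proof (cases "f = 0")
    case False
    thus ?thesis unfolding stark_arg_def by (auto intro!: holomorphic_intros)
  qed (simp add: stark_arg_def)
  thus ?thesis unfolding stark_K_def stark_a_def stark_g_def
    by (intro holomorphic_on_mult holomorphic_on_compose[OF _ A, unfolded o_def] holomorphic_on_const)
qed

text \<open>At \<open>x = \<kappa>\<close> and \<open>x = - \<kappa>\<close> the resolvent identity
  is a closed linear system for \<open>G \<kappa> y\<close> and \<open>G (- \<kappa>) y\<close>. The
  solution is left multiplied by the determinant, so that \<open>E\<close> is entire even where the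
  determinant vanishes.\<close>

lemma green_function_det:
  assumes pos: "\<kappa> > 0" "\<eta> > 0" "f > 0"
  obtains E where "E holomorphic_on UNIV"
    "\<And>w G. Im w > 0 \<Longrightarrow> green_function \<kappa> \<eta> f w G \<Longrightarrow> G x y * (stark_wronskian f * stark_det \<kappa> \<eta> f w) = E w"
proof
  define W where "W = stark_wronskian f"
  define K where "K = stark_K f"
  define E where "E w = K w x y * stark_det \<kappa> \<eta> f w
     - (K w x \<kappa> * (K w \<kappa> y * (W + K w (-\<kappa>) (-\<kappa>) / \<eta>) - K w \<kappa> (-\<kappa>) / \<eta> * K w (-\<kappa>) y)
        + K w x (-\<kappa>) * ((W + K w \<kappa> \<kappa> / \<eta>) * K w (-\<kappa>) y - K w \<kappa> (-\<kappa>) / \<eta> * K w \<kappa> y)) / \<eta>" for w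
  show "E holomorphic_on UNIV"
    unfolding E_def[abs_def] stark_det_def K_def using pos
    by (intro holomorphic_on_diff holomorphic_on_mult holomorphic_on_add holomorphic_on_divide holomorphic_on_power stark_K_holomorphic holomorphic_on_const) auto
  fix w G assume w: "Im w > 0" and G: "green_function \<kappa> \<eta> f w G"
  have id: "W * G x y = K w x y - (K w x \<kappa> * G \<kappa> y + K w x (-\<kappa>) * G (-\<kappa>) y) / \<eta>" for x y
    unfolding W_def K_def by (rule green_function_identity[OF pos w G])
  have D: "stark_det \<kappa> \<eta> f w = (W + K w \<kappa> \<kappa> / \<eta>) * (W + K w (-\<kappa>) (-\<kappa>) / \<eta>) - (K w \<kappa> (-\<kappa>) / \<eta>) * (K w \<kappa> (-\<kappa>) / \<eta>)"
    by (simp add: stark_det_def W_def K_def power2_eq_square)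
  have sym: "K w (-\<kappa>) \<kappa> = K w \<kappa> (-\<kappa>)" unfolding K_def by (rule stark_K_sym)
  have 1: "(W + K w \<kappa> \<kappa> / \<eta>) * G \<kappa> y + K w \<kappa> (-\<kappa>) / \<eta> * G (-\<kappa>) y = K w \<kappa> y"
    using id[of \<kappa> y] by (simp add: algebra_simps add_divide_distrib)
  have 2: "K w \<kappa> (-\<kappa>) / \<eta> * G \<kappa> y + (W + K w (-\<kappa>) (-\<kappa>) / \<eta>) * G (-\<kappa>) y = K w (-\<kappa>) y"
    using id[of "-\<kappa>" y] sym by (simp add: algebra_simps add_divide_distrib)
  have 3: "stark_det \<kappa> \<eta> f w * G \<kappa> y = K w \<kappa> y * (W + K w (-\<kappa>) (-\<kappa>) / \<eta>) - K w \<kappa> (-\<kappa>) / \<eta> * K w (-\<kappa>) y"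
    unfolding 1[symmetric] 2[symmetric] D by (simp only: ring_distribs mult_ac) simp
  have 4: "stark_det \<kappa> \<eta> f w * G (-\<kappa>) y = (W + K w \<kappa> \<kappa> / \<eta>) * K w (-\<kappa>) y - K w \<kappa> (-\<kappa>) / \<eta> * K w \<kappa> y"
    unfolding 1[symmetric] 2[symmetric] D by (simp only: ring_distribs mult_ac) simp
  have "G x y * (W * stark_det \<kappa> \<eta> f w) = stark_det \<kappa> \<eta> f w * (W * G x y)" by simp
  also have "\<dots> = E w"
    unfolding id E_def 3[symmetric] 4[symmetric] by (simp add: algebra_simps add_divide_distrib)
  finally show "G x y * (stark_wronskian f * stark_det \<kappa> \<eta> f w) = E w" by (simp add: W_def)
qed

lemma stark_wronskian_nonzero: "f > 0 \<Longrightarrow> stark_wronskian f \<noteq> 0"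
  by (simp add: stark_wronskian_def tau_simps)

lemma stark_det_holomorphic: "\<eta> \<noteq> 0 \<Longrightarrow> stark_det \<kappa> \<eta> f holomorphic_on A"
  unfolding stark_det_def[abs_def]
  by (intro holomorphic_on_diff holomorphic_on_mult holomorphic_on_add holomorphic_on_divide holomorphic_on_power stark_K_holomorphic holomorphic_on_const) auto

text \<open>The relation between \<open>G\<close> and \<open>E\<close> passes to the continuation
  \<open>F\<close> by the identity theorem. Where the determinant is nonzero, \<open>F\<close> then
  agrees near \<open>z\<close> with a continuous quotient and cannot have a pole.\<close>

lemma resonance_imp_stark_det_eq_0:
  assumes pos: "\<kappa> > 0" "\<eta> > 0" "f > 0" and z: "z \<in> resonances \<kappa> \<eta> f"
  shows "stark_det \<kappa> \<eta> f z = 0"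
proof (rule ccontr)
  assume nz: "stark_det \<kappa> \<eta> f z \<noteq> 0"
  obtain G x y F where G: "\<And>w. Im w > 0 \<Longrightarrow> green_function \<kappa> \<eta> f w (G w)"
    and F: "F meromorphic_on UNIV" "\<And>w. Im w > 0 \<Longrightarrow> F w = G w x y" and pole: "is_pole F z"
    using z unfolding resonances_def by blast
  obtain E where E: "E holomorphic_on UNIV"
    "\<And>w G. Im w > 0 \<Longrightarrow> green_function \<kappa> \<eta> f w G \<Longrightarrow> G x y * (stark_wronskian f * stark_det \<kappa> \<eta> f w) = E w"
    using green_function_det[OF pos, of x y] by blast
  let ?D = "\<lambda>w. stark_wronskian f * stark_det \<kappa> \<eta> f w"
  have D: "?D holomorphic_on UNIV" using pos by (intro holomorphic_on_mult stark_det_holomorphic holomorphic_on_const) auto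
  have nzD: "?D z \<noteq> 0" using nz stark_wronskian_nonzero[OF pos(3)] by simp
  have mero: "E meromorphic_on UNIV" "?D meromorphic_on UNIV"
    using E(1) D by (auto intro!: analytic_on_imp_meromorphic_on simp: analytic_on_open)
  have "(\<lambda>w. F w * ?D w - E w) meromorphic_on UNIV"
    by (intro meromorphic_intros F mero)
  \<comment> \<open>This ball lies in the upper half plane, where \<open>F\<close> is given by the
    Green function.\<close>
  moreover have "F w * ?D w - E w = 0" if "w \<in> ball \<i> 1" for w
  proof -
    have "\<bar>Im w - 1\<bar> < 1" using that abs_Im_le_cmod[of "\<i> - w"] by (simp add: dist_norm)
    hence "Im w > 0" by simp
    thus ?thesis using E(2)[OF _ G] F(2) by simp
  qed
  hence "frequently (\<lambda>w. F w * ?D w - E w = 0) (at \<i>)"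
    by (intro eventually_frequently) (auto simp: eventually_at intro!: exI[of _ 1] simp: dist_commute)
  moreover have "eventually (\<lambda>w. F w * ?D w - E w \<noteq> 0) (at \<i>)"
    if "eventually (\<lambda>w. F w * ?D w - E w \<noteq> 0) (cosparse UNIV)"
    using eventually_cosparse_imp_eventually_at[OF that] by blast
  ultimately have "eventually (\<lambda>w. F w * ?D w - E w = 0) (cosparse UNIV)"
    using meromorphic_imp_constant_or_avoid[of "\<lambda>w. F w * ?D w - E w" UNIV 0]
    by (auto simp: frequently_def)
  hence "eventually (\<lambda>w. F w * ?D w - E w = 0) (at z)"
    using eventually_cosparse_imp_eventually_at by blast
  moreover have "eventually (\<lambda>w. ?D w \<noteq> 0) (at z)"
  proof -
    have "isCont ?D z" using holomorphic_on_imp_continuous_on[OF D] by (simp add: continuous_on_eq_continuous_at)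
    from isContD[OF this] show ?thesis by (rule tendsto_imp_eventually_ne[OF _ nzD])
  qed
  ultimately have ev: "eventually (\<lambda>w. E w / ?D w = F w) (at z)"
    by eventually_elim (auto simp: field_simps)
  have "isCont (\<lambda>w. E w / ?D w) z"
    using nzD holomorphic_on_imp_continuous_on[OF D] holomorphic_on_imp_continuous_on[OF E(1)]
    by (intro isCont_divide) (auto simp: continuous_on_eq_continuous_at)
  hence "((\<lambda>w. E w / ?D w) \<longlongrightarrow> E z / ?D z) (at z)" by (simp add: isCont_def)
  hence "(F \<longlongrightarrow> E z / ?D z) (at z)" using ev by (rule Lim_transform_eventually)
  thus False using pole not_tendsto_and_filterlim_at_infinity[of "at z" F] by (auto simp: is_pole_def)
qed

section \<open>Zero-free regions\<close>

lemma csqrt_upper_half_plane: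
  assumes "Im w > 0"
  shows "Re (csqrt w) > 0" "Im (csqrt w) > 0"
proof -
  have "\<bar>Re w\<bar> < cmod w"
    using assms by (simp add: cmod_def real_less_rsqrt)
  thus "Re (csqrt w) > 0" "Im (csqrt w) > 0" using assms by auto
qed

text \<open>Two vectors in the same quadrant have a nonnegative inner product. This prevents
  cancellation in \<open>kp + km\<close> and in \<open>k + k0\<close>.\<close>

lemma norm_add_quadrant:
  assumes "Re a \<ge> 0" "Im a \<ge> 0" "Re b \<ge> 0" "Im b \<ge> 0"
  shows "(cmod a)\<^sup>2 + (cmod b)\<^sup>2 \<le> (cmod (a + b))\<^sup>2"
  using mult_nonneg_nonneg[OF assms(1,3)] mult_nonneg_nonneg[OF assms(2,4)]
  by (simp add: cmod_power2 power2_sum)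

lemma norm_mult_diff_1:
  fixes x y :: complex
  assumes "cmod (x - 1) \<le> d" "cmod (y - 1) \<le> d" "d \<le> 1"
  shows "cmod (x * y - 1) \<le> 3 * d"
proof -
  have "x * y - 1 = (x - 1) * (y - 1) + (x - 1) + (y - 1)" by (simp add: algebra_simps)
  hence "cmod (x * y - 1) \<le> cmod (x - 1) * cmod (y - 1) + cmod (x - 1) + cmod (y - 1)"
    by (metis norm_mult norm_triangle_mono norm_triangle_ineq order_refl)
  also have "\<dots> \<le> d * 1 + d + d"
    using assms order.trans[OF norm_ge_zero assms(1)] by (intro add_mono mult_mono) auto
  finally show ?thesis by simp
qed

lemma norm_mult_diff_1':
  fixes x y :: complex
  assumes "cmod (x - 1) \<le> 3 * d" "cmod (y - 1) \<le> 3 * d" "d \<le> 1" "d \<ge> 0"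
  shows "cmod (x * y - 1) \<le> 15 * d"
proof -
  have "x * y - 1 = (x - 1) * (y - 1) + (x - 1) + (y - 1)" by (simp add: algebra_simps)
  hence "cmod (x * y - 1) \<le> cmod (x - 1) * cmod (y - 1) + cmod (x - 1) + cmod (y - 1)"
    by (metis norm_mult norm_triangle_mono norm_triangle_ineq order_refl)
  also have "\<dots> \<le> (3 * d) * 3 + 3 * d + 3 * d" using assms by (intro add_mono mult_mono) auto
  finally show ?thesis by simp
qed

lemma norm_triangle_4: "cmod (a + b + c - d) \<le> cmod a + cmod b + cmod c + cmod d"
  using norm_triangle_ineq4[of "a + b + c" d] norm_triangle_ineq[of "a + b" c] norm_triangle_ineq[of a b] by linarith

lemma norm_triangle_6:
  "cmod (a - b + c - d - e - g) \<le> cmod a + cmod b + cmod c + cmod d + cmod e + cmod g"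
  using norm_triangle_ineq4[of "a - b + c - d - e" g] norm_triangle_ineq4[of "a - b + c - d" e]
    norm_triangle_4[of a "- b" c d] by simp

text \<open>The bound \<open>f \<le> \<epsilon> * (cmod z)\<^sup>2\<close>, which makes the Airy error \<open>f / \<rho> ^ 3\<close> negligible against the size \<open>\<rho>\<close>
  of the leading terms, is what the cutoff \<open>cmod z > f powr (\<beta> / 2)\<close> is for.\<close>

locale stark_regime =
  fixes \<kappa> \<eta> f \<epsilon> :: real and z :: complex
  assumes pos: "\<kappa> > 0" "\<eta> > 0" "f > 0" "\<epsilon> > 0" and z: "Im z < 0"
    and f_small: "f \<le> \<epsilon>" "f \<le> \<epsilon> * (cmod z)\<^sup>2"
    and eps: "\<epsilon> \<le> 1 / 1000" "\<kappa> * \<epsilon> \<le> 1 / 100"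
begin

definition "\<rho> = sqrt (cmod z)"
text \<open>Up to division by \<open>root 3 f\<close>, \<open>kp\<close> and \<open>km\<close> are
  square roots of \<open>stark_arg f z \<kappa>\<close> and
  \<open>stark_arg f z (- \<kappa>)\<close>, hence the natural variables for the expansions of
  \<open>Airy (s\<^sup>2)\<close>.\<close>

definition "kp = csqrt (- z + of_real (\<kappa> * f))"
definition "km = csqrt (- z - of_real (\<kappa> * f))"
definition "m = (kp + km) / 2"
definition "d = (kp - km) / 2"
text \<open>The difference between the Airy exponents at the two delta points; \<open>q\<close> is
  the square of the ratio of the exponentials.\<close>

definition "\<Delta> = 2 / (3 * of_real f) * (kp ^ 3 - km ^ 3)"
definition "q = exp (- 2 * \<Delta>)"
text \<open>A bound for the relative error of all Airy expansions used: 15 exceeds 14 times the cube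
  of 100/99, where 14 comes from \<open>airy_asymptotics_wide\<close> and 99/100 from
  \<open>norm_k\<close>.\<close>

definition "\<delta> = 15 * f / \<rho> ^ 3"

lemma rho: "\<rho> > 0" "\<rho>\<^sup>2 = cmod z" "\<rho> ^ 4 = (cmod z)\<^sup>2"
proof -
  show "\<rho> > 0" "\<rho>\<^sup>2 = cmod z" using z by (auto simp: \<rho>_def)
  thus "\<rho> ^ 4 = (cmod z)\<^sup>2" using power_mult[of \<rho> 2 2] by simp
qed

text \<open>Geometric interpolation between \<open>f \<le> \<epsilon>\<close> and
  \<open>f \<le> \<epsilon> * \<rho> ^ 4\<close>.\<close>

lemma f_le_rho: "f \<le> \<epsilon> * \<rho>" "f \<le> \<epsilon> * \<rho>\<^sup>2" "f \<le> \<epsilon> * \<rho> ^ 3" "f \<le> \<epsilon> * \<rho> ^ 4"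
proof -
  show 4: "f \<le> \<epsilon> * \<rho> ^ 4" using f_small rho by simp
  have mix: "f ^ i * f ^ j \<le> \<epsilon> ^ i * (\<epsilon> * \<rho> ^ 4) ^ j" for i j
    using pos rho(1) f_small(1) 4 by (intro mult_mono power_mono) auto
  have "f ^ 4 \<le> (\<epsilon> * \<rho>) ^ 4" using mix[of 3 1] by (simp add: power_mult_distrib eval_nat_numeral mult_ac)
  thus "f \<le> \<epsilon> * \<rho>" by (rule power_le_imp_le_base[of f 3, simplified]) (use pos rho(1) in auto)
  have "f ^ 2 \<le> (\<epsilon> * \<rho>\<^sup>2) ^ 2" using mix[of 1 1] by (simp add: power_mult_distrib eval_nat_numeral mult_ac)
  thus "f \<le> \<epsilon> * \<rho>\<^sup>2" by (rule power2_le_imp_le) (use pos in auto)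
  have "f ^ 4 \<le> (\<epsilon> * \<rho> ^ 3) ^ 4" using mix[of 1 3] by (simp add: power_mult_distrib eval_nat_numeral mult_ac)
  thus "f \<le> \<epsilon> * \<rho> ^ 3" by (rule power_le_imp_le_base[of f 3, simplified]) (use pos rho(1) in auto)
qed

lemma kappa_f: "\<kappa> * f \<le> \<rho>\<^sup>2 / 100"
proof -
  have "\<kappa> * f \<le> \<kappa> * (\<epsilon> * \<rho>\<^sup>2)" using f_le_rho(2) pos by (intro mult_left_mono) auto
  also have "\<dots> = (\<kappa> * \<epsilon>) * \<rho>\<^sup>2" by simp
  also have "\<dots> \<le> (1 / 100) * \<rho>\<^sup>2" using eps by (intro mult_right_mono) auto
  finally show ?thesis by simp
qed

lemma k_square: "kp\<^sup>2 = - z + of_real (\<kappa> * f)" "km\<^sup>2 = - z - of_real (\<kappa> * f)"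
  by (simp_all add: kp_def km_def)

lemma k_quadrant: "Re kp > 0" "Im kp > 0" "Re km > 0" "Im km > 0"
  unfolding kp_def km_def using z by (auto intro!: csqrt_upper_half_plane simp del: csqrt.simps)

lemma norm_k_square: "\<bar>(cmod kp)\<^sup>2 - \<rho>\<^sup>2\<bar> \<le> \<kappa> * f" "\<bar>(cmod km)\<^sup>2 - \<rho>\<^sup>2\<bar> \<le> \<kappa> * f"
proof -
  have "(cmod kp)\<^sup>2 = cmod (- z + of_real (\<kappa> * f))" "(cmod km)\<^sup>2 = cmod (- z - of_real (\<kappa> * f))"
    by (simp_all add: k_square flip: norm_power)
  moreover have "\<bar>cmod (- z + of_real (\<kappa> * f)) - cmod (- z)\<bar> \<le> cmod (of_real (\<kappa> * f))"
    "\<bar>cmod (- z - of_real (\<kappa> * f)) - cmod (- z)\<bar> \<le> cmod (of_real (\<kappa> * f))"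
    using norm_triangle_ineq3[of "- z + of_real (\<kappa> * f)" "- z"] norm_triangle_ineq3[of "- z - of_real (\<kappa> * f)" "- z"]
    by simp_all
  moreover have "cmod (of_real (\<kappa> * f)) = \<kappa> * f" using pos by (simp del: of_real_mult)
  ultimately show "\<bar>(cmod kp)\<^sup>2 - \<rho>\<^sup>2\<bar> \<le> \<kappa> * f" "\<bar>(cmod km)\<^sup>2 - \<rho>\<^sup>2\<bar> \<le> \<kappa> * f"
    by (simp_all only: rho norm_minus_cancel)
qed

lemma norm_k: "99 / 100 * \<rho> \<le> cmod kp" "cmod kp \<le> 101 / 100 * \<rho>"
  "99 / 100 * \<rho> \<le> cmod km" "cmod km \<le> 101 / 100 * \<rho>"
proof -
  have *: "99 / 100 * \<rho> \<le> cmod k \<and> cmod k \<le> 101 / 100 * \<rho>" if "\<bar>(cmod k)\<^sup>2 - \<rho>\<^sup>2\<bar> \<le> \<kappa> * f" for k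
  proof
    have p: "0 \<le> \<rho>\<^sup>2" by simp
    have "(99 / 100 * \<rho>)\<^sup>2 = 9801 / 10000 * \<rho>\<^sup>2" "(101 / 100 * \<rho>)\<^sup>2 = 10201 / 10000 * \<rho>\<^sup>2"
      by (simp_all add: power_mult_distrib power_divide)
    hence "(99 / 100 * \<rho>)\<^sup>2 \<le> (cmod k)\<^sup>2" "(cmod k)\<^sup>2 \<le> (101 / 100 * \<rho>)\<^sup>2"
      using that kappa_f p by linarith+
    thus "99 / 100 * \<rho> \<le> cmod k" "cmod k \<le> 101 / 100 * \<rho>"
      using rho(1) by (auto intro: power2_le_imp_le)
  qed
  show "99 / 100 * \<rho> \<le> cmod kp" "cmod kp \<le> 101 / 100 * \<rho>"
    "99 / 100 * \<rho> \<le> cmod km" "cmod km \<le> 101 / 100 * \<rho>"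
    using *[OF norm_k_square(1)] *[OF norm_k_square(2)] by auto
qed

lemma k_nonzero: "kp \<noteq> 0" "km \<noteq> 0" "m \<noteq> 0"
  using k_quadrant by (auto simp: m_def complex_eq_iff)

lemma norm_m: "7 / 10 * \<rho> \<le> cmod m" "cmod m \<le> 101 / 100 * \<rho>"
proof -
  have "(99 / 100 * \<rho>)\<^sup>2 + (99 / 100 * \<rho>)\<^sup>2 \<le> (cmod kp)\<^sup>2 + (cmod km)\<^sup>2"
    using norm_k rho(1) by (intro add_mono power_mono) auto
  also have "\<dots> \<le> (cmod (kp + km))\<^sup>2" using k_quadrant by (intro norm_add_quadrant) auto
  also have "cmod (kp + km) = 2 * cmod m" by (simp add: m_def norm_divide)
  finally have "(7 / 10 * \<rho>)\<^sup>2 \<le> (cmod m)\<^sup>2"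
  proof -
    assume *: "(99 / 100 * \<rho>)\<^sup>2 + (99 / 100 * \<rho>)\<^sup>2 \<le> (2 * cmod m)\<^sup>2"
    have "(99 / 100 * \<rho>)\<^sup>2 = 9801 / 10000 * \<rho>\<^sup>2" "(7 / 10 * \<rho>)\<^sup>2 = 49 / 100 * \<rho>\<^sup>2" "(2 * cmod m)\<^sup>2 = 4 * (cmod m)\<^sup>2"
      by (simp_all add: power_mult_distrib power_divide)
    with * zero_le_power2[of \<rho>] show ?thesis by linarith
  qed
  thus "7 / 10 * \<rho> \<le> cmod m" by (rule power2_le_imp_le) auto
  have "2 * cmod m \<le> cmod kp + cmod km"
    using norm_triangle_ineq[of kp km] by (simp add: m_def norm_divide)
  thus "cmod m \<le> 101 / 100 * \<rho>" using norm_k by linarith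
qed

lemma dm: "d * m = of_real (\<kappa> * f) / 2" and kpm: "kp = m + d" "km = m - d"
proof -
  have "4 * (d * m) = kp\<^sup>2 - km\<^sup>2" by (simp add: d_def m_def power2_eq_square field_simps)
  hence "d * m = (kp\<^sup>2 - km\<^sup>2) / 4" by (metis nonzero_mult_div_cancel_left zero_neq_numeral)
  thus "d * m = of_real (\<kappa> * f) / 2" unfolding k_square by simp
  show "kp = m + d" "km = m - d" by (simp_all add: m_def d_def field_simps)
qed

text \<open>By \<open>dm\<close> the product \<open>d * m\<close> contains the factor
  \<open>f\<close>, which cancels the denominator: the two exponents have size
  \<open>\<rho> ^ 3 / f\<close>, but their difference is \<open>2 * \<kappa> * m\<close> up to a
  small correction.\<close>

lemma Delta_eq: "\<Delta> = 2 * of_real \<kappa> * m + 2 * of_real \<kappa> / 3 * (d\<^sup>2 / m)"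
proof -
  have "kp ^ 3 - km ^ 3 = 2 * (d * m) / m * (3 * m\<^sup>2 + d\<^sup>2)"
    unfolding kpm using k_nonzero by (simp add: power3_eq_cube power2_eq_square algebra_simps)
  hence "\<Delta> = 2 / (3 * of_real f) * (of_real (\<kappa> * f) / m * (3 * m\<^sup>2 + d\<^sup>2))"
    unfolding \<Delta>_def dm by simp
  also have "\<dots> = 2 * of_real \<kappa> * m + 2 * of_real \<kappa> / 3 * (d\<^sup>2 / m)"
    using pos k_nonzero by (simp add: power2_eq_square field_simps)
  finally show ?thesis .
qed

lemma norm_d: "cmod d \<le> 3 / 4 * (\<kappa> * f / \<rho>)" "cmod (d\<^sup>2 / m) \<le> \<kappa>\<^sup>2 * f\<^sup>2 / \<rho> ^ 3"
  "cmod (kp - km) \<le> 3 / 2 * (\<kappa> * f / \<rho>)"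
proof -
  have "cmod d * cmod m = \<kappa> * f / 2" using arg_cong[OF dm, of cmod] pos by (simp add: norm_mult norm_divide)
  moreover have "cmod d * (7 / 10 * \<rho>) \<le> cmod d * cmod m" using norm_m by (intro mult_left_mono) auto
  ultimately have "cmod d * (7 / 10 * \<rho>) \<le> \<kappa> * f / 2" by linarith
  hence "cmod d \<le> (\<kappa> * f / 2) / (7 / 10 * \<rho>)" using rho(1) by (subst pos_le_divide_eq) auto
  hence 1: "cmod d \<le> 5 / 7 * (\<kappa> * f / \<rho>)" by simp
  have p: "\<kappa> * f / \<rho> \<ge> 0" using pos rho(1) by simp
  show 2: "cmod d \<le> 3 / 4 * (\<kappa> * f / \<rho>)" using 1 p by linarith
  show "cmod (kp - km) \<le> 3 / 2 * (\<kappa> * f / \<rho>)" using 2 by (simp add: d_def norm_divide)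
  have "cmod (d\<^sup>2 / m) = (cmod d)\<^sup>2 / cmod m" by (simp add: norm_divide norm_power)
  also have "\<dots> \<le> (5 / 7 * (\<kappa> * f / \<rho>))\<^sup>2 / (7 / 10 * \<rho>)"
    using 1 norm_m rho(1) by (intro frac_le power_mono) auto
  also have "\<dots> = 250 / 343 * (\<kappa>\<^sup>2 * f\<^sup>2 / \<rho> ^ 3)"
    by (simp add: power_mult_distrib power_divide power2_eq_square power3_eq_cube mult_ac)
  also have "\<dots> \<le> 1 * (\<kappa>\<^sup>2 * f\<^sup>2 / \<rho> ^ 3)" using rho(1) by (intro mult_right_mono) auto
  finally show "cmod (d\<^sup>2 / m) \<le> \<kappa>\<^sup>2 * f\<^sup>2 / \<rho> ^ 3" by simp
qed

lemma delta: "\<delta> \<ge> 0" "\<delta> \<le> 15 * \<epsilon>" "\<delta> \<le> 15 * \<epsilon> * \<rho>" "\<delta> \<le> 1"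
proof -
  show "\<delta> \<ge> 0" using pos rho(1) by (simp add: \<delta>_def)
  show *: "\<delta> \<le> 15 * \<epsilon>" using f_le_rho(3) rho(1) by (simp add: \<delta>_def field_simps)
  show "\<delta> \<le> 15 * \<epsilon> * \<rho>" using f_le_rho(4) rho(1) by (simp add: \<delta>_def field_simps eval_nat_numeral)
  show "\<delta> \<le> 1" using * eps by simp
qed

section \<open>Lower bounds for the coefficient \<open>N\<close>\<close>

definition "near1 ap am bp bm \<longleftrightarrow>
  cmod (ap - 1) \<le> \<delta> \<and> cmod (am - 1) \<le> \<delta> \<and> cmod (bp - 1) \<le> \<delta> \<and> cmod (bm - 1) \<le> \<delta>"

lemma near1D:
  assumes "near1 ap am bp bm"
  shows "cmod (ap - 1) \<le> \<delta>" "cmod (am - 1) \<le> \<delta>"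
    "cmod (bp - 1) \<le> \<delta>" "cmod (bm - 1) \<le> \<delta>"
  using assms by (auto simp: near1_def)

text \<open>The coefficient of \<open>\<i> * Xm\<^sup>2\<close> in the expanded determinant, the
  arguments being the Airy correction factors; \<open>N0\<close> is its value when all of them are
  1.\<close>

definition "N ap am bp bm = 2 * of_real \<eta> * (q * ap\<^sup>2 * km + am\<^sup>2 * kp) + am\<^sup>2 * ap * bp - q * ap\<^sup>2 * am * bm"
definition "N0 = 2 * of_real \<eta> * (q * km + kp) + 1 - q"

lemma N_perturb:
  assumes q: "cmod q \<le> 1"
    and near: "near1 ap am bp bm"
  shows "cmod (N ap am bp bm - N0) \<le> \<delta> * (13 * \<eta> * \<rho> + 30)"
proof -
  note a = near1D[OF near]
  have 2: "cmod (ap\<^sup>2 - 1) \<le> 3 * \<delta>" "cmod (am\<^sup>2 - 1) \<le> 3 * \<delta>"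
    "cmod (am * am - 1) \<le> 3 * \<delta>" "cmod (ap * ap - 1) \<le> 3 * \<delta>" "cmod (ap * bp - 1) \<le> 3 * \<delta>" "cmod (am * bm - 1) \<le> 3 * \<delta>"
    unfolding power2_eq_square by (intro norm_mult_diff_1 a delta)+
  have 4: "cmod ((am * am) * (ap * bp) - 1) \<le> 15 * \<delta>" "cmod ((ap * ap) * (am * bm) - 1) \<le> 15 * \<delta>"
    by (intro norm_mult_diff_1' 2 delta)+
  have k: "cmod kp \<le> (101 / 100) * \<rho>" "cmod km \<le> (101 / 100) * \<rho>" using norm_k by simp_all
  have "N ap am bp bm - N0 = 2 * of_real \<eta> * (q * (ap\<^sup>2 - 1) * km) + 2 * of_real \<eta> * ((am\<^sup>2 - 1) * kp)
      + ((am * am) * (ap * bp) - 1) - q * ((ap * ap) * (am * bm) - 1)"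
    by (simp add: N_def N0_def algebra_simps power2_eq_square)
  also have "cmod \<dots> \<le> 2 * \<eta> * (cmod q * cmod (ap\<^sup>2 - 1) * cmod km) + 2 * \<eta> * (cmod (am\<^sup>2 - 1) * cmod kp)
      + cmod ((am * am) * (ap * bp) - 1) + cmod q * cmod ((ap * ap) * (am * bm) - 1)"
    using pos by (intro order.trans[OF norm_triangle_4] eq_refl) (simp add: norm_mult)
  also have "\<dots> \<le> 2 * \<eta> * (1 * (3 * \<delta>) * ((101 / 100) * \<rho>)) + 2 * \<eta> * ((3 * \<delta>) * ((101 / 100) * \<rho>)) + 15 * \<delta> + 1 * (15 * \<delta>)"
    using q 2 4 k delta pos by (intro add_mono mult_mono) auto
  also have "\<dots> = \<delta> * ((303 / 25) * \<eta> * \<rho> + 30)" by (simp add: algebra_simps)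
  also have "\<dots> \<le> \<delta> * (13 * \<eta> * \<rho> + 30)" using delta pos rho(1) by (intro mult_left_mono) auto
  finally show ?thesis .
qed

lemma d2m_le: "cmod (d\<^sup>2 / m) \<le> \<rho> / 10000"
proof -
  have "\<kappa>\<^sup>2 * f\<^sup>2 = (\<kappa> * f)\<^sup>2" by (simp add: power_mult_distrib)
  also have "\<dots> \<le> (\<rho>\<^sup>2 / 100)\<^sup>2" using kappa_f pos by (intro power_mono) auto
  finally have "\<kappa>\<^sup>2 * f\<^sup>2 \<le> \<rho> ^ 4 / 10000" by (simp add: power_divide flip: power_mult)
  hence "\<kappa>\<^sup>2 * f\<^sup>2 / \<rho> ^ 3 \<le> \<rho> ^ 4 / 10000 / \<rho> ^ 3" using rho(1) by (intro divide_right_mono) auto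
  also have "\<dots> = \<rho> / 10000" using rho(1) by (simp add: eval_nat_numeral)
  finally show ?thesis using norm_d(2) by linarith
qed

text \<open>For small \<open>\<rho>\<close> both terms of \<open>N0\<close> are linear in \<open>\<rho>\<close> and add up.\<close>

lemma N_lower_small_rho:
  assumes q: "cmod q \<le> 1"
    and near: "near1 ap am bp bm"
    and small: "100 * \<kappa> * \<rho> \<le> 1" "\<rho> \<le> 1" "2250 * \<epsilon> \<le> \<eta> + \<kappa>"
  shows "cmod (N ap am bp bm) \<ge> (\<eta> + \<kappa>) * \<rho>"
proof -
  have "cmod \<Delta> \<le> cmod (2 * of_real \<kappa> * m) + cmod (2 * of_real \<kappa> / 3 * (d\<^sup>2 / m))"
    unfolding Delta_eq by (rule norm_triangle_ineq)
  also have "\<dots> = 2 * \<kappa> * cmod m + 2 * \<kappa> / 3 * cmod (d\<^sup>2 / m)"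
    using pos by (simp only: norm_mult norm_divide norm_of_real norm_numeral abs_of_pos)
  also have "\<dots> \<le> 2 * \<kappa> * (101 / 100 * \<rho>) + 2 * \<kappa> / 3 * (\<rho> / 10000)"
    using norm_m d2m_le pos by (intro add_mono mult_left_mono) auto
  also have "\<dots> \<le> (21 / 10) * \<kappa> * \<rho>" using pos rho(1) by (simp add: algebra_simps)
  finally have D: "cmod (2 * \<Delta>) \<le> (21 / 5) * \<kappa> * \<rho>" by (simp add: norm_mult)
  have D1: "cmod (2 * \<Delta>) \<le> 1" using D small by simp
  have e: "cmod (1 - q - 2 * \<Delta>) \<le> (14 / 5) * ((21 / 5) * \<kappa> * \<rho>)\<^sup>2"
  proof -
    have "cmod (exp (- (2 * \<Delta>)) - (\<Sum>i\<le>1. (- (2 * \<Delta>)) ^ i / fact i))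
        \<le> exp \<bar>Re (- (2 * \<Delta>))\<bar> * cmod (- (2 * \<Delta>)) ^ Suc 1 / fact 1"
      by (rule Taylor_exp)
    also have "\<dots> \<le> (14 / 5) * (cmod (2 * \<Delta>))\<^sup>2"
    proof -
      have "\<bar>Re (- (2 * \<Delta>))\<bar> \<le> 1" using abs_Re_le_cmod[of "- (2 * \<Delta>)"] D1 by simp
      hence "exp \<bar>Re (- (2 * \<Delta>))\<bar> \<le> exp 1" by simp
      also have "\<dots> \<le> ((14 / 5) :: real)" using e_less_272 by simp
      finally have "exp \<bar>Re (- (2 * \<Delta>))\<bar> * (cmod (2 * \<Delta>))\<^sup>2 \<le> (14 / 5) * (cmod (2 * \<Delta>))\<^sup>2"
        by (rule mult_right_mono) simp
      thus ?thesis by (simp only: norm_minus_cancel power2_eq_square power_Suc power_one_right fact_Suc_0 div_by_1 One_nat_def power_0 mult_1_right)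

    qed
    also have "\<dots> \<le> (14 / 5) * ((21 / 5) * \<kappa> * \<rho>)\<^sup>2" using D by (intro mult_left_mono power_mono) auto
    finally show ?thesis unfolding q_def by (simp add: norm_minus_commute algebra_simps)
  qed
  have q1: "cmod (1 - q) \<le> (42 / 5) * \<kappa> * \<rho>"
  proof -
    have "cmod (1 - q) \<le> cmod (1 - q - 2 * \<Delta>) + cmod (2 * \<Delta>)"
      using norm_triangle_ineq[of "1 - q - 2 * \<Delta>" "2 * \<Delta>"] by simp
    moreover have "((21 / 5) * \<kappa> * \<rho>)\<^sup>2 \<le> (21 / 5) * \<kappa> * \<rho> * (1 / 10)"
      unfolding power2_eq_square using small pos rho(1) by (intro mult_left_mono) auto
    moreover have "0 \<le> \<kappa> * \<rho>" using pos rho(1) by simp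
    ultimately show ?thesis using e D by linarith
  qed
  \<comment> \<open>As \<open>q\<close> is close to \<open>1 - 2 * \<Delta>\<close>,
    \<open>\<Delta>\<close> to \<open>2 * \<kappa> * m\<close>, and \<open>kp + km = 2 * m\<close>,
    the main part of \<open>N0\<close> is the left side; the other terms are the errors. By
    \<open>norm_m\<close> the main part is at least 14/5 times
    \<open>(\<eta> + \<kappa>) * \<rho>\<close>, and the errors may consume 9/5.\<close>
  have "4 * of_real (\<eta> + \<kappa>) * m = N ap am bp bm - (N ap am bp bm - N0)
      + 2 * of_real \<eta> * (m * (1 - q)) - 2 * of_real \<eta> * (d * (1 - q)) - (1 - q - 2 * \<Delta>) - 4 * of_real \<kappa> / 3 * (d\<^sup>2 / m)"
    unfolding N0_def Delta_eq kpm by (simp add: algebra_simps)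
  hence "cmod (4 * of_real (\<eta> + \<kappa>) * m) \<le> cmod (N ap am bp bm) + cmod (N ap am bp bm - N0)
      + cmod (2 * of_real \<eta> * (m * (1 - q))) + cmod (2 * of_real \<eta> * (d * (1 - q))) + cmod (1 - q - 2 * \<Delta>)
      + cmod (4 * of_real \<kappa> / 3 * (d\<^sup>2 / m))"
    by (simp only: norm_triangle_6)
  also have "\<dots> = cmod (N ap am bp bm) + cmod (N ap am bp bm - N0)
      + 2 * \<eta> * (cmod m * cmod (1 - q)) + 2 * \<eta> * (cmod d * cmod (1 - q)) + cmod (1 - q - 2 * \<Delta>)
      + 4 * \<kappa> / 3 * cmod (d\<^sup>2 / m)"
    using pos by (simp only: norm_mult norm_divide norm_of_real norm_numeral abs_of_pos)
  also have "\<dots> \<le> cmod (N ap am bp bm) + (15 * \<epsilon> * \<rho>) * (13 * \<eta> + 30)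
      + 2 * \<eta> * ((101 / 100) * \<rho> * ((42 / 5) * \<kappa> * \<rho>)) + 2 * \<eta> * ((1 / 100) * \<rho> * ((42 / 5) * \<kappa> * \<rho>)) + (14 / 5) * ((21 / 5) * \<kappa> * \<rho>)\<^sup>2
      + 4 * \<kappa> / 3 * (\<rho> / 10000)"
  proof (intro add_mono order.refl mult_left_mono mult_mono e q1)
    have "cmod (N ap am bp bm - N0) \<le> \<delta> * (13 * \<eta> * \<rho> + 30)" by (rule N_perturb[OF q near])
    also have "\<dots> \<le> (15 * \<epsilon> * \<rho>) * (13 * \<eta> + 30)"
    proof (rule mult_mono)
      have "13 * \<eta> * \<rho> \<le> 13 * \<eta> * 1" using small pos by (intro mult_left_mono) auto
      thus "13 * \<eta> * \<rho> + 30 \<le> 13 * \<eta> + 30" by simp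
    qed (use delta pos rho(1) in auto)
    finally show "cmod (N ap am bp bm - N0) \<le> (15 * \<epsilon> * \<rho>) * (13 * \<eta> + 30)" .
    have "cmod d \<le> 3 / 4 * (\<kappa> * f / \<rho>)" by (rule norm_d)
    also have "\<kappa> * f / \<rho> \<le> \<rho>\<^sup>2 / 100 / \<rho>" using kappa_f rho(1) by (intro divide_right_mono) auto
    hence "3 / 4 * (\<kappa> * f / \<rho>) \<le> (1 / 100) * \<rho>" using rho(1) by (simp add: power2_eq_square)
    finally show "cmod d \<le> (1 / 100) * \<rho>" .
  qed (use norm_m d2m_le pos rho(1) in auto)
  also have "\<dots> = cmod (N ap am bp bm) + ((2142 / 125) * \<kappa> * \<rho> * \<eta> + (6174 / 125) * \<kappa> * \<rho> * \<kappa> + 195 * \<epsilon> * \<eta> + 450 * \<epsilon> + 4 * \<kappa> / 30000) * \<rho>"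
    by (simp add: algebra_simps power2_eq_square)
  also have "((2142 / 125) * \<kappa> * \<rho> * \<eta> + (6174 / 125) * \<kappa> * \<rho> * \<kappa> + 195 * \<epsilon> * \<eta> + 450 * \<epsilon> + 4 * \<kappa> / 30000) * \<rho> \<le> ((9 / 5) * (\<eta> + \<kappa>)) * \<rho>"
  proof (intro mult_right_mono)
    have "(2142 / 125) * \<kappa> * \<rho> * \<eta> \<le> (1 / 2) * \<eta>" "(6174 / 125) * \<kappa> * \<rho> * \<kappa> \<le> (1 / 2) * \<kappa>" "195 * \<epsilon> * \<eta> \<le> (1 / 5) * \<eta>"
      using small eps pos by (intro mult_right_mono; simp)+
    moreover have "450 * \<epsilon> \<le> 1 / 5 * (\<eta> + \<kappa>)" using small by simp
    moreover have "4 * \<kappa> / 30000 \<le> 1 / 2 * \<kappa>" using pos by simp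
    ultimately have "(2142 / 125) * \<kappa> * \<rho> * \<eta> + (6174 / 125) * \<kappa> * \<rho> * \<kappa> + 195 * \<epsilon> * \<eta> + 450 * \<epsilon> + 4 * \<kappa> / 30000
        \<le> 1 / 2 * \<eta> + 1 / 2 * \<kappa> + 1 / 5 * \<eta> + 1 / 5 * (\<eta> + \<kappa>) + 1 / 2 * \<kappa>"
      by (intro add_mono)
    also have "\<dots> \<le> (9 / 5) * (\<eta> + \<kappa>)" using pos(1,2) by (simp add: field_simps)
    finally show "(2142 / 125) * \<kappa> * \<rho> * \<eta> + (6174 / 125) * \<kappa> * \<rho> * \<kappa> + 195 * \<epsilon> * \<eta> + 450 * \<epsilon> + 4 * \<kappa> / 30000
        \<le> (9 / 5) * (\<eta> + \<kappa>)" .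
  qed (use rho in auto)
  finally have "cmod (4 * of_real (\<eta> + \<kappa>) * m) \<le> cmod (N ap am bp bm) + (9 / 5) * (\<eta> + \<kappa>) * \<rho>" by simp
  moreover have "cmod (4 * of_real (\<eta> + \<kappa>) * m) = 4 * (\<eta> + \<kappa>) * cmod m"
    using pos by (simp only: norm_mult norm_of_real norm_numeral abs_of_pos add_pos_pos)
  moreover have "4 * (\<eta> + \<kappa>) * (7 / 10 * \<rho>) \<le> 4 * (\<eta> + \<kappa>) * cmod m"
    using pos norm_m by (intro mult_left_mono) auto
  moreover have "4 * (\<eta> + \<kappa>) * (7 / 10 * \<rho>) = 14 / 5 * ((\<eta> + \<kappa>) * \<rho>)"
    "(9 / 5) * (\<eta> + \<kappa>) * \<rho> = 9 / 5 * ((\<eta> + \<kappa>) * \<rho>)" by simp_all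
  moreover have "0 \<le> (\<eta> + \<kappa>) * \<rho>" using pos rho(1) by simp
  ultimately show ?thesis by linarith
qed

end

lemma one_minus_exp_ge: "x \<ge> 0 \<Longrightarrow> min 1 x / 2 \<le> 1 - exp (- x)" for x :: real
proof -
  assume x: "x \<ge> 0"
  have "exp (- x) \<le> 1 / (1 + x)"
    using exp_ge_add_one_self[of x] x by (simp add: exp_minus inverse_eq_divide frac_le)
  moreover have "min 1 x / 2 \<le> 1 - 1 / (1 + x)"
    using x by (auto simp: min_def field_simps mult_left_le)
  ultimately show ?thesis by linarith
qed

text \<open>Divided by \<open>1 + r\<close>, the expression is \<open>2 * k\<close> plus the Cayley
  transform \<open>(1 - r) / (1 + r)\<close>, whose real part is nonnegative on the unit disc.
  Multiplying by \<open>cnj (1 + r)\<close> instead avoids the singularity at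
  \<open>r = - 1\<close>.\<close>

lemma norm_reflection_lower:
  fixes r k :: complex
  assumes "cmod r \<le> 1" "Re k \<ge> 0"
  shows "(1 - cmod r) / 2 \<le> cmod (2 * k * (1 + r) + (1 - r))"
proof -
  have "Re ((2 * k * (1 + r) + (1 - r)) * cnj (1 + r)) = 2 * Re k * (cmod (1 + r))\<^sup>2 + (1 - (cmod r)\<^sup>2)"
    by (simp add: cmod_power2) (simp add: power2_eq_square algebra_simps)
  hence "1 - (cmod r)\<^sup>2 \<le> Re ((2 * k * (1 + r) + (1 - r)) * cnj (1 + r))"
    using assms by simp
  also have "\<dots> \<le> cmod (2 * k * (1 + r) + (1 - r)) * cmod (1 + r)"
    by (metis complex_Re_le_cmod complex_mod_cnj norm_mult)
  also have "\<dots> \<le> cmod (2 * k * (1 + r) + (1 - r)) * 2"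
    using norm_triangle_ineq[of 1 r] assms by (intro mult_left_mono) auto
  finally have "1 - (cmod r)\<^sup>2 \<le> cmod (2 * k * (1 + r) + (1 - r)) * 2" .
  moreover have "(cmod r)\<^sup>2 \<le> cmod r" using assms by (simp add: power2_eq_square mult_left_le)
  ultimately show ?thesis by simp
qed

context stark_regime
begin

text \<open>A lower bound for \<open>Re kp\<close> and \<open>Re km\<close>, from
  \<open>2 * Re k * Im k = \<bar>Im z\<bar>\<close> and
  \<open>Im k \<le> 101 / 100 * \<rho>\<close>; the divisor 3 is a rounding.\<close>

definition "\<sigma> = \<bar>Im z\<bar> / (3 * \<rho>)"
text \<open>The argument of the logarithm in the angular conditions. It is the common large
  parameter: constants and powers of \<open>\<rho>\<close> are absorbed into powers of
  \<open>T\<close>.\<close>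

definition "T = 1 / f + \<rho>\<^sup>2"

lemma T: "1 / f \<le> T" "\<rho>\<^sup>2 \<le> T" "1 / \<epsilon> \<le> T" "T \<ge> 1000"
proof -
  show "1 / f \<le> T" "\<rho>\<^sup>2 \<le> T" using pos by (simp_all add: T_def)
  moreover have "1 / \<epsilon> \<le> 1 / f" using f_small pos by (intro divide_left_mono) auto
  ultimately show "1 / \<epsilon> \<le> T" by linarith
  moreover have "1000 \<le> 1 / \<epsilon>" using eps pos by (simp add: field_simps)
  ultimately show "T \<ge> 1000" by linarith
qed

lemma T_I: "c * \<epsilon> \<le> 1 \<Longrightarrow> c \<le> T"
  using T(3) pos pos_le_divide_eq[of \<epsilon> c 1] by linarith

lemma sigma_pos: "\<sigma> > 0"
  using z rho(1) by (simp add: \<sigma>_def divide_neg_pos)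

lemma Re_k_ge: "\<sigma> \<le> Re kp" "\<sigma> \<le> Re km" "\<sigma> \<le> Re m"
proof -
  have *: "\<sigma> \<le> Re k" if "Im (k\<^sup>2) = - Im z" "Re k > 0" "Im k > 0" "cmod k \<le> 101 / 100 * \<rho>" for k
  proof -
    have "\<bar>Im z\<bar> = 2 * Re k * Im k" using that(1) z by (simp add: power2_eq_square mult_ac)
    also have "\<dots> \<le> 2 * Re k * (101 / 100 * \<rho>)"
      using that abs_Im_le_cmod[of k] by (intro mult_left_mono) auto
    also have "\<dots> \<le> Re k * (3 * \<rho>)" using that rho(1) by simp
    finally show ?thesis unfolding \<sigma>_def using rho(1) by (subst pos_divide_le_eq) auto
  qed
  show 1: "\<sigma> \<le> Re kp" "\<sigma> \<le> Re km"
    by (rule *; use k_quadrant norm_k in \<open>simp add: k_square\<close>)+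
  show "\<sigma> \<le> Re m" using 1 by (simp add: m_def)
qed

context
  assumes sig: "2 * f \<le> \<epsilon> * \<sigma> * \<rho>\<^sup>2"
begin

text \<open>The main term contributes at least \<open>2 * \<kappa> * \<sigma>\<close>, and
  \<open>sig\<close> limits the loss from the correction to
  \<open>2 / 3 * \<kappa> * \<sigma>\<close>.\<close>

lemma Re_Delta: "\<kappa> * \<sigma> \<le> Re \<Delta>"
proof -
  have "\<kappa>\<^sup>2 * f\<^sup>2 / \<rho> ^ 3 = \<kappa>\<^sup>2 * (f / \<rho>\<^sup>2) * (f / \<rho>)" by (simp add: power2_eq_square power3_eq_cube)
  also have "\<dots> \<le> \<kappa>\<^sup>2 * (\<epsilon> * \<sigma> / 2) * \<epsilon>"
    using sig f_le_rho(1) rho(1) pos sigma_pos by (intro mult_mono mult_left_mono) (auto simp: field_simps)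
  also have "\<dots> = (\<kappa> * \<epsilon>)\<^sup>2 * \<sigma> / 2" by (simp add: power2_eq_square)
  also have "\<dots> \<le> (1 / 100)\<^sup>2 * \<sigma> / 2"
    using eps pos sigma_pos by (intro divide_right_mono mult_right_mono power_mono) auto
  also have "(1 / 100)\<^sup>2 * \<sigma> / 2 \<le> \<sigma>" using sigma_pos by (simp add: power_divide)
  finally have "cmod (d\<^sup>2 / m) \<le> \<sigma>" using norm_d(2) by linarith
  hence "- \<sigma> \<le> Re (d\<^sup>2 / m)" using abs_Re_le_cmod[of "d\<^sup>2 / m"] by linarith
  hence "2 * \<kappa> / 3 * - \<sigma> \<le> 2 * \<kappa> / 3 * Re (d\<^sup>2 / m)" using pos by (intro mult_left_mono) auto
  moreover have "2 * \<kappa> * \<sigma> \<le> 2 * \<kappa> * Re m" using Re_k_ge(3) pos by simp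
  moreover have "Re \<Delta> = 2 * \<kappa> * Re m + 2 * \<kappa> / 3 * Re (d\<^sup>2 / m)"
  proof -
    have "\<Delta> = of_real (2 * \<kappa>) * m + of_real (2 * \<kappa> / 3) * (d\<^sup>2 / m)" unfolding Delta_eq by simp
    thus ?thesis by (simp only: plus_complex.sel Re_complex_of_real times_complex.sel Im_complex_of_real)
  qed
  moreover have "\<kappa> * \<sigma> \<ge> 0" using pos sigma_pos by simp
  ultimately show ?thesis by linarith
qed

lemma norm_q: "cmod q \<le> exp (- 2 * (\<kappa> * \<sigma>))" "cmod q \<le> 1"
proof -
  show "cmod q \<le> exp (- 2 * (\<kappa> * \<sigma>))" using Re_Delta by (simp add: q_def)
  also have "\<dots> \<le> 1" using pos sigma_pos by simp
  finally show "cmod q \<le> 1" .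
qed

lemma norm_k_ratio: "cmod (kp - km) / cmod kp \<le> 8 / 5 * \<kappa> * (f / \<rho>\<^sup>2)" "cmod (kp - km) / cmod km \<le> 8 / 5 * \<kappa> * (f / \<rho>\<^sup>2)"
proof -
  have *: "cmod (kp - km) / x \<le> 8 / 5 * \<kappa> * (f / \<rho>\<^sup>2)" if "99 / 100 * \<rho> \<le> x" for x
  proof -
    have "cmod (kp - km) / x \<le> (3 / 2 * (\<kappa> * f / \<rho>)) / (99 / 100 * \<rho>)"
      using norm_d(3) that rho(1) pos by (intro frac_le) auto
    also have "\<dots> = 50 / 33 * (\<kappa> * f / \<rho>\<^sup>2)" by (simp add: power2_eq_square)
    also have "\<dots> \<le> 8 / 5 * (\<kappa> * f / \<rho>\<^sup>2)" using pos rho(1) by (intro mult_right_mono) auto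
    finally show ?thesis by simp
  qed
  show "cmod (kp - km) / cmod kp \<le> 8 / 5 * \<kappa> * (f / \<rho>\<^sup>2)" "cmod (kp - km) / cmod km \<le> 8 / 5 * \<kappa> * (f / \<rho>\<^sup>2)"
    by (intro * norm_k)+
qed

text \<open>With \<open>r = q * km / kp\<close>, \<open>N0\<close> is up to \<open>O(f / \<rho>\<^sup>2)\<close> the expression of the reflection lemma.
  The hypothesis \<open>sig\<close> makes this error negligible against \<open>1 - \<bar>r\<bar>\<close>.\<close>

lemma N_lower_large_rho:
  assumes near: "near1 ap am bp bm"
    and large: "\<rho> \<ge> \<rho>0" "\<rho>0 > 0"
    and C: "C = 2 * \<kappa> + 195 * \<eta> + 450 / \<rho>0" "8 * C * \<epsilon> \<le> 1" "8 * C * \<epsilon> \<le> \<kappa>"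
  shows "cmod (N ap am bp bm) \<ge> min 1 (\<kappa> * \<sigma>) / 8"
proof -
  define r where "r = q * km / kp"
  have fr: "f / \<rho>\<^sup>2 \<ge> 0" "f / \<rho>\<^sup>2 \<le> \<epsilon>" "f / \<rho>\<^sup>2 \<le> \<epsilon> * \<sigma> / 2"
    using pos f_le_rho(2) sig rho(1) by (simp_all add: field_simps)
  \<comment> \<open>The factor \<open>q\<close> contributes
    \<open>exp (- 2 * (\<kappa> * \<sigma>))\<close>. The quotient \<open>km / kp\<close> may exceed
    1 in modulus, but it costs at most \<open>1 + \<kappa> * \<sigma>\<close>, so half of the decay
    survives.\<close>
  have r: "cmod r \<le> exp (- (\<kappa> * \<sigma>))"
  proof -
    have "cmod km \<le> cmod kp + cmod (kp - km)" using norm_triangle_ineq2[of km kp] by (simp add: norm_minus_commute)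
    hence "cmod km / cmod kp \<le> 1 + cmod (kp - km) / cmod kp"
      using k_nonzero by (simp add: field_simps)
    also have "\<dots> \<le> 1 + 8 / 5 * \<kappa> * (\<epsilon> * \<sigma> / 2)"
    proof -
      have "8 / 5 * \<kappa> * (f / \<rho>\<^sup>2) \<le> 8 / 5 * \<kappa> * (\<epsilon> * \<sigma> / 2)"
        using fr(3) pos by (intro mult_left_mono) auto
      thus ?thesis using norm_k_ratio(1) by linarith
    qed
    also have "\<dots> \<le> 1 + \<kappa> * \<sigma>"
    proof -
      have "\<kappa> * \<sigma> * \<epsilon> \<le> \<kappa> * \<sigma> * 1" using eps pos sigma_pos by (intro mult_left_mono) auto
      moreover have "\<kappa> * \<sigma> \<ge> 0" using pos sigma_pos by simp
      ultimately show ?thesis by (simp add: algebra_simps)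
    qed
    also have "\<dots> \<le> exp (\<kappa> * \<sigma>)" by (rule exp_ge_add_one_self)
    finally have "cmod q * (cmod km / cmod kp) \<le> exp (- 2 * (\<kappa> * \<sigma>)) * exp (\<kappa> * \<sigma>)"
      by (intro mult_mono norm_q) auto
    also have "\<dots> = exp (- (\<kappa> * \<sigma>))" by (simp flip: exp_add)
    finally show ?thesis by (simp add: r_def norm_mult norm_divide)
  qed
  also have "\<dots> \<le> 1" using pos sigma_pos by simp
  finally have r1: "cmod r \<le> 1" .
  have P: "min 1 (\<kappa> * \<sigma>) / 4 \<le> cmod (2 * (of_real \<eta> * kp) * (1 + r) + (1 - r))"
  proof -
    have "min 1 (\<kappa> * \<sigma>) / 2 \<le> 1 - exp (- (\<kappa> * \<sigma>))" using pos sigma_pos by (intro one_minus_exp_ge) simp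
    also have "\<dots> \<le> 1 - cmod r" using r by simp
    finally have "min 1 (\<kappa> * \<sigma>) / 4 \<le> (1 - cmod r) / 2" by simp
    also have "\<dots> \<le> cmod (2 * (of_real \<eta> * kp) * (1 + r) + (1 - r))"
      by (rule norm_reflection_lower) (use r1 pos k_quadrant in auto)
    finally show ?thesis .
  qed
  have eq: "2 * (of_real \<eta> * kp) * (1 + r) + (1 - r) = N ap am bp bm - (N ap am bp bm - N0) - r * ((km - kp) / km)"
    using k_nonzero by (simp add: N0_def r_def field_simps)
  have "cmod (2 * (of_real \<eta> * kp) * (1 + r) + (1 - r)) \<le> cmod (N ap am bp bm) + cmod (N ap am bp bm - N0) + cmod (r * ((km - kp) / km))"
    unfolding eq by (intro order.trans[OF norm_triangle_ineq4] add_mono order.refl norm_triangle_ineq4)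
  also have "cmod (r * ((km - kp) / km)) \<le> 1 * (8 / 5 * \<kappa> * (f / \<rho>\<^sup>2))"
    unfolding norm_mult norm_divide using r1 norm_k_ratio(2) by (intro mult_mono) (auto simp: norm_minus_commute)
  also have "cmod (N ap am bp bm - N0) \<le> \<delta> * (13 * \<eta> * \<rho> + 30)" by (rule N_perturb[OF norm_q(2) near])
  \<comment> \<open>Source of the constants in \<open>C\<close>: with
    \<open>\<delta> = 15 * f / \<rho> ^ 3\<close> one gets 195 = 15 * 13 and 450 = 15 * 30.\<close>
  also have "\<delta> * (13 * \<eta> * \<rho> + 30) = f / \<rho>\<^sup>2 * (195 * \<eta> + 450 / \<rho>)"
    using rho(1) by (simp add: \<delta>_def field_simps eval_nat_numeral)
  also have "f / \<rho>\<^sup>2 * (195 * \<eta> + 450 / \<rho>) \<le> f / \<rho>\<^sup>2 * (195 * \<eta> + 450 / \<rho>0)"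
    using large rho(1) fr by (intro mult_left_mono add_mono divide_left_mono) auto
  finally have "cmod (2 * (of_real \<eta> * kp) * (1 + r) + (1 - r)) \<le> cmod (N ap am bp bm) + f / \<rho>\<^sup>2 * (8 / 5 * \<kappa> + 195 * \<eta> + 450 / \<rho>0)"
    by (simp add: algebra_simps)
  moreover have "f / \<rho>\<^sup>2 * (8 / 5 * \<kappa> + 195 * \<eta> + 450 / \<rho>0) \<le> f / \<rho>\<^sup>2 * C"
    using fr pos by (intro mult_left_mono) (auto simp: C(1))
  moreover have "f / \<rho>\<^sup>2 * C \<le> min 1 (\<kappa> * \<sigma>) / 8"
  proof -
    have C0: "C \<ge> 0" using C(1) pos large by simp
    have "f / \<rho>\<^sup>2 * C \<le> \<epsilon> * C" using fr C0 by (intro mult_right_mono) auto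
    moreover have "f / \<rho>\<^sup>2 * C \<le> (\<epsilon> * \<sigma> / 2) * C" using fr C0 by (intro mult_right_mono) auto
    moreover have "(8 * C * \<epsilon>) * \<sigma> \<le> \<kappa> * \<sigma>" using C(3) sigma_pos by (intro mult_right_mono) auto
    moreover have "(8 * C * \<epsilon>) * \<sigma> \<ge> 0" using C0 pos sigma_pos by simp
    moreover have "\<epsilon> * C \<le> 1 / 8" using C(2) by (simp add: mult_ac)
    moreover have "(\<epsilon> * \<sigma> / 2) * C = (8 * C * \<epsilon>) * \<sigma> / 16" by simp
    ultimately have "8 * (f / \<rho>\<^sup>2 * C) \<le> min 1 (\<kappa> * \<sigma>)" by (intro min.boundedI) linarith+
    thus ?thesis by linarith
  qed
  ultimately show ?thesis using P by linarith
qed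

text \<open>Both regimes are weakened to one power of \<open>T\<close>, using
  \<open>\<rho> \<ge> 1 / T\<close> for small \<open>\<rho>\<close> and
  \<open>\<sigma> \<ge> 1 / T\<^sup>2\<close> for large \<open>\<rho>\<close>.\<close>

lemma N_lower:
  assumes near: "near1 ap am bp bm"
    and \<rho>0: "\<rho>0 > 0" "100 * \<kappa> * \<rho>0 \<le> 1" "\<rho>0 \<le> 1"
    and e: "2250 * \<epsilon> \<le> \<eta> + \<kappa>" "8 * (2 * \<kappa> + 195 * \<eta> + 450 / \<rho>0) * \<epsilon> \<le> 1" "8 * (2 * \<kappa> + 195 * \<eta> + 450 / \<rho>0) * \<epsilon> \<le> \<kappa>"
  shows "cmod (N ap am bp bm) \<ge> 1 / T ^ 3"
proof (cases "\<rho> \<le> \<rho>0")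
  case True
  have "100 * \<kappa> * \<rho> \<le> 100 * \<kappa> * \<rho>0" using True pos by (intro mult_left_mono) auto
  hence "(\<eta> + \<kappa>) * \<rho> \<le> cmod (N ap am bp bm)"
    using True \<rho>0 e by (intro N_lower_small_rho[OF norm_q(2) near]) auto
  moreover have "1 / T ^ 3 \<le> (\<eta> + \<kappa>) * \<rho>"
  proof -
    have "1 \<le> (\<eta> + \<kappa>) * (1 / \<epsilon>)" using e(1) pos by (simp add: field_simps)
    also have "\<dots> \<le> (\<eta> + \<kappa>) * T" using T pos by (intro mult_left_mono) auto
    finally have 1: "1 \<le> (\<eta> + \<kappa>) * T" .
    have "f \<le> \<epsilon> * \<rho>" by (rule f_le_rho)
    also have "\<dots> \<le> 1 * \<rho>" using eps rho(1) by (intro mult_right_mono) auto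
    finally have "T * f \<le> T * \<rho>" using T(4) by (intro mult_left_mono) auto
    moreover have "1 \<le> T * f" using T(1) pos by (simp add: field_simps)
    ultimately have 2: "1 \<le> \<rho> * T" by (simp add: mult.commute)
    have "1 * 1 * 1 \<le> ((\<eta> + \<kappa>) * T) * (\<rho> * T) * T" using 1 2 T(4) by (intro mult_mono) auto
    hence "1 \<le> (\<eta> + \<kappa>) * \<rho> * T ^ 3" by (simp add: power3_eq_cube mult_ac)
    thus ?thesis using T(4) by (simp add: field_simps)
  qed
  ultimately show ?thesis by linarith
next
  case False
  have "min 1 (\<kappa> * \<sigma>) / 8 \<le> cmod (N ap am bp bm)"
    by (rule N_lower_large_rho[OF near, of \<rho>0]) (use False \<rho>0 e in auto)
  moreover have "1 / T ^ 3 \<le> 1 / 8"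
  proof (rule divide_left_mono)
    have "(2::real) ^ 3 \<le> T ^ 3" using T(4) by (intro power_mono) auto
    thus "8 \<le> T ^ 3" by simp
  qed (use T(4) in auto)
  moreover have "1 / T ^ 3 \<le> (\<kappa> * \<sigma>) / 8"
  proof -
    have 1: "1 / T\<^sup>2 \<le> \<sigma>"
    proof -
      have "1 / T \<le> f" using T(1,4) pos by (simp add: field_simps)
      hence "1 / T / T \<le> f / \<rho>\<^sup>2" using T rho(1) pos by (intro frac_le) auto
      also have "\<dots> \<le> \<epsilon> * \<sigma> / 2" using sig rho(1) by (simp add: field_simps)
      also have "\<dots> \<le> 1 * \<sigma>" using eps sigma_pos by (simp add: field_simps)
      finally show ?thesis by (simp add: power2_eq_square)
    qed
    have "8 * 450 / 1 \<le> 8 * 450 / \<rho>0" using \<rho>0 by (intro divide_left_mono) auto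
    hence "8 \<le> 8 * (2 * \<kappa> + 195 * \<eta> + 450 / \<rho>0)" using pos by simp
    hence "8 * \<epsilon> \<le> 8 * (2 * \<kappa> + 195 * \<eta> + 450 / \<rho>0) * \<epsilon>" using pos by (intro mult_right_mono) auto
    hence "8 * \<epsilon> \<le> \<kappa>" using e(3) by simp
    hence "8 / \<kappa> \<le> 1 / \<epsilon>" using pos by (simp add: field_simps)
    hence "8 / \<kappa> \<le> T" using T(3) by linarith
    hence 2: "1 / T \<le> \<kappa> / 8" using T(4) pos by (simp add: field_simps)
    have "1 / T ^ 3 = (1 / T) * (1 / T\<^sup>2)" by (simp add: power3_eq_cube power2_eq_square)
    also have "\<dots> \<le> (\<kappa> / 8) * \<sigma>" using 1 2 pos T(4) by (intro mult_mono) auto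
    finally show ?thesis by simp
  qed
  ultimately show ?thesis by (auto simp: min_def split: if_splits)
qed

end

end

section \<open>The determinant in terms of exponentials\<close>

lemma exp_two_thirds: "exp (2 / 3 * y) = 1 / exp (- 2 / 3 * y)" for y :: complex
proof -
  have "exp (2 / 3 * y) * exp (- 2 / 3 * y) = 1" unfolding exp_add[symmetric] by simp
  thus ?thesis by (simp add: eq_divide_eq)
qed

context stark_regime
begin

text \<open>The WKB factors: \<open>amp k * osc k\<close> is the leading term of \<open>Airy\<close>
  at the square of \<open>k / root 3 f\<close>. Since \<open>(amp k)\<^sup>2 * k\<close> is
  independent of \<open>k\<close>, the Wronskian can be factored out of every entry.\<close>

definition "amp k = 1 / csqrt (k / of_real (root 3 f))"
definition "osc k = exp (- 2 / 3 * (k ^ 3 / of_real f))"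
definition "Xp = osc kp"
definition "Xm = osc km"

text \<open>\<open>4 * \<eta>\<^sup>2 * kp * km * stark_det\<close> is a multiple of \<open>F1 + \<i> * Xm\<^sup>2 * N\<close>, and also, with other
  arguments close to 1, of \<open>F2 + \<i> * Xm\<^sup>2 * N\<close>: the terms quadratic in \<open>Xm\<^sup>2\<close> cancel.\<close>

definition "F1 ap am bp bm = (2 * of_real \<eta> * kp + ap * bp) * (2 * of_real \<eta> * km + am * bm) - q * ap\<^sup>2 * bm\<^sup>2"
definition "F2 ap am bp bm = (2 * of_real \<eta> * kp - ap * bp) * (2 * of_real \<eta> * km - am * bm) - am\<^sup>2 * bp\<^sup>2 / q"

lemma q_eq: "q = (Xp / Xm)\<^sup>2" "q \<noteq> 0" "Xp \<noteq> 0" "Xm \<noteq> 0"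
proof -
  have "- 2 / 3 * (kp ^ 3 / of_real f) - (- 2 / 3 * (km ^ 3 / of_real f)) = - \<Delta>"
    unfolding \<Delta>_def using pos by (simp add: field_simps)
  hence "Xp / Xm = exp (- \<Delta>)" unfolding Xp_def Xm_def osc_def exp_diff[symmetric] by (rule arg_cong)
  thus "q = (Xp / Xm)\<^sup>2" by (simp add: q_def flip: exp_of_nat_mult exp_double)
  show "q \<noteq> 0" "Xp \<noteq> 0" "Xm \<noteq> 0" by (simp_all add: q_def Xp_def Xm_def osc_def)
qed

context
  fixes k :: complex and x :: real
  assumes k: "k\<^sup>2 = of_real (f * x) - z" "Re k > 0" "Im k > 0" "99 / 100 * \<rho> \<le> cmod k"
begin

definition "scaled = k / of_real (root 3 f)"

lemma scaled: "scaled\<^sup>2 = stark_arg f z x" "Re scaled > 0" "Im scaled > 0" "scaled ^ 3 = k ^ 3 / of_real f"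
  "(amp k)\<^sup>2 * k = of_real (root 3 f)" "cmod scaled ^ 3 = cmod k ^ 3 / f" "amp k = 1 / csqrt scaled"
proof -
  let ?r = "root 3 f"
  have r: "?r > 0" "?r ^ 3 = f" using pos by (auto simp: real_root_pow_pos2)
  have r3: "complex_of_real ?r ^ 3 = of_real f" using r(2) by (metis of_real_power)
  show "Re scaled > 0" "Im scaled > 0" using k r by (simp_all add: scaled_def)
  show "scaled ^ 3 = k ^ 3 / of_real f" unfolding scaled_def power_divide r3 ..
  show "cmod scaled ^ 3 = cmod k ^ 3 / f" unfolding scaled_def norm_divide power_divide using r by simp
  have "scaled\<^sup>2 = of_real ?r * (k\<^sup>2 / of_real ?r ^ 3)"
    using r by (simp add: scaled_def power_divide power2_eq_square power3_eq_cube)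
  also have "\<dots> = stark_arg f z x" unfolding r3 k(1) stark_arg_def using pos by (simp add: field_simps)
  finally show "scaled\<^sup>2 = stark_arg f z x" .
  show a: "amp k = 1 / csqrt scaled" by (simp add: amp_def scaled_def)
  have "scaled \<noteq> 0" using \<open>Re scaled > 0\<close> by auto
  moreover have "(amp k)\<^sup>2 = 1 / scaled" unfolding a by (simp add: power_divide)
  ultimately show "(amp k)\<^sup>2 * k = of_real ?r" using r by (auto simp: scaled_def field_simps)
qed

lemma error_le_delta:
  assumes "cmod e \<le> 14 / cmod scaled ^ 3"
  shows "cmod e \<le> \<delta>"
proof -
  have "cmod e \<le> 14 * f / cmod k ^ 3" using assms unfolding scaled by simp
  also have "\<dots> \<le> 14 * f / (99 / 100 * \<rho>) ^ 3"
  proof (intro divide_left_mono power_mono)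
    have "0 < 99 / 100 * \<rho>" using rho(1) by simp
    hence "0 < cmod k" using k(4) by linarith
    thus "0 < cmod k ^ 3 * (99 / 100 * \<rho>) ^ 3" using rho(1) by simp
  qed (use k(4) pos rho(1) in auto)
  also have "\<dots> = 14 * (100 / 99) ^ 3 * (f / \<rho> ^ 3)" by (simp add: power_divide power_mult_distrib)
  also have "\<dots> \<le> 15 * (f / \<rho> ^ 3)" using pos rho(1) by (intro mult_right_mono) (auto simp: power_divide)
  finally show ?thesis by (simp add: \<delta>_def)
qed

lemma osc_scaled: "exp (- 2 / 3 * scaled ^ 3) = osc k" "exp (2 / 3 * scaled ^ 3) = 1 / osc k"
  unfolding exp_two_thirds scaled osc_def by simp_all

lemma stark_B_asymptotics:
  obtains b where "Airy (tau ^ 8 * stark_arg f z x) = tau * (amp k / osc k) * b" "cmod (b - 1) \<le> \<delta>"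
proof -
  obtain e where e: "Airy (- (tau\<^sup>2) * scaled\<^sup>2) = tau * exp (2 / 3 * scaled ^ 3) / csqrt scaled * (1 + e)"
    "cmod e \<le> 3 / cmod scaled ^ 3"
    by (rule airy_asymptotics_B[of scaled]) (use scaled in auto)
  show ?thesis
  proof (rule that)
    show "Airy (tau ^ 8 * stark_arg f z x) = tau * (amp k / osc k) * (1 + e)"
      using e(1)[unfolded osc_scaled] unfolding tau_8 by (simp add: scaled(7) flip: scaled(1))
    show "cmod (1 + e - 1) \<le> \<delta>"
      using error_le_delta[of e] order.trans[OF e(2), of "14 / cmod scaled ^ 3"] by (simp add: divide_right_mono)
  qed
qed

lemma stark_a_asymptotics:
  assumes "Re k \<ge> cmod k / 4"
  obtains a where "stark_a f z x = amp k * osc k * a" "cmod (a - 1) \<le> \<delta>"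
proof -
  have "Re scaled \<ge> cmod scaled / 4" "scaled \<noteq> 0"
    using assms scaled(2) pos by (auto simp: scaled_def norm_divide field_simps)
  then obtain e where e: "Airy (scaled\<^sup>2) = exp (- 2 / 3 * scaled ^ 3) / csqrt scaled * (1 + e)" "cmod e \<le> 14 / cmod scaled ^ 3"
    by (rule airy_asymptotics_wide)
  show ?thesis
    by (rule that[of "1 + e"])
      (use e(1)[unfolded osc_scaled] error_le_delta[OF e(2)] in \<open>simp_all add: stark_a_def scaled(7) flip: scaled(1)\<close>)
qed

lemma stark_g_asymptotics:
  assumes "Im k \<ge> Re k"
  obtains a where "stark_g f z x = tau\<^sup>2 * (amp k * osc k * a)" "cmod (a - 1) \<le> \<delta>"
proof -
  have "Im scaled \<ge> Re scaled" using assms pos by (simp add: scaled_def divide_right_mono)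
  with scaled(2) obtain e where e: "Airy (tau ^ 4 * scaled\<^sup>2) = tau\<^sup>2 * exp (- 2 / 3 * scaled ^ 3) / csqrt scaled * (1 + e)"
    "cmod e \<le> 14 / cmod scaled ^ 3"
    by (rule airy_asymptotics_g)
  show ?thesis
    by (rule that[of "1 + e"])
      (use e(1)[unfolded osc_scaled] error_le_delta[OF e(2)] in \<open>simp_all add: stark_g_def scaled(7) flip: scaled(1)\<close>)
qed

end

lemma k_hyps: "kp\<^sup>2 = of_real (f * \<kappa>) - z" "km\<^sup>2 = of_real (f * (-\<kappa>)) - z"
  by (simp_all add: k_square mult.commute)

lemmas kp_hyps = k_hyps(1) k_quadrant(1,2) norm_k(1)
lemmas km_hyps = k_hyps(2) k_quadrant(3,4) norm_k(3)

lemma tau2_eq: "tau\<^sup>2 = - (tau ^ 5 * \<i>)"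
proof -
  have "tau ^ 5 * tau ^ 3 = tau ^ 8" by (simp flip: power_add)
  thus ?thesis unfolding tau_simps(1) tau_8 by simp
qed

text \<open>The part shared by both expansions. Scaling the diagonal entries by
  \<open>2 * kp\<close> and \<open>2 * km\<close> leaves \<open>u\<close> and \<open>v\<close>
  beside the Wronskian; the off-diagonal entry enters squared, so its two amplitudes combine with
  \<open>kp * km\<close> in the same way.\<close>

lemma det_zero_expand:
  assumes det: "stark_det \<kappa> \<eta> f z = 0"
    and 1: "2 * kp * (stark_a f z \<kappa> * stark_g f z \<kappa>) = stark_wronskian f * u"
    and 2: "2 * km * (stark_a f z (-\<kappa>) * stark_g f z (-\<kappa>)) = stark_wronskian f * v"
    and 3: "stark_a f z \<kappa> * stark_g f z (-\<kappa>) = - (tau ^ 5) * (amp kp * amp km * w)"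
  shows "(2 * of_real \<eta> * kp + u) * (2 * of_real \<eta> * km + v) - w\<^sup>2 = 0"
proof -
  let ?W = "stark_wronskian f" let ?e = "complex_of_real \<eta>"
  have "4 * kp * km * (stark_a f z \<kappa> * stark_g f z (-\<kappa>))\<^sup>2
      = (- 2 * tau ^ 5)\<^sup>2 * ((amp kp)\<^sup>2 * kp) * ((amp km)\<^sup>2 * km) * w\<^sup>2"
    unfolding 3 by (simp only: power_mult_distrib) (simp add: mult_ac)
  also have "\<dots> = ?W\<^sup>2 * w\<^sup>2"
    unfolding scaled(5)[OF kp_hyps] scaled(5)[OF km_hyps] stark_wronskian_def
    by (simp only: power_mult_distrib power2_eq_square) (simp add: mult_ac)
  finally have 3: "4 * kp * km * (stark_a f z \<kappa> * stark_g f z (-\<kappa>))\<^sup>2 = ?W\<^sup>2 * w\<^sup>2" .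
  have D: "stark_det \<kappa> \<eta> f z = (?W + stark_a f z \<kappa> * stark_g f z \<kappa> / \<eta>) * (?W + stark_a f z (-\<kappa>) * stark_g f z (-\<kappa>) / \<eta>)
      - (stark_a f z \<kappa> * stark_g f z (-\<kappa>) / \<eta>)\<^sup>2"
    using pos by (simp add: stark_det_def stark_K_def max_def min_def)
  have "0 = 4 * ?e\<^sup>2 * kp * km * stark_det \<kappa> \<eta> f z" using det by simp
  also have "\<dots> = (2 * ?e * kp * ?W + 2 * kp * (stark_a f z \<kappa> * stark_g f z \<kappa>)) * (2 * ?e * km * ?W + 2 * km * (stark_a f z (-\<kappa>) * stark_g f z (-\<kappa>)))
      - 4 * kp * km * (stark_a f z \<kappa> * stark_g f z (-\<kappa>))\<^sup>2"
    unfolding D using pos by (simp add: field_simps power2_eq_square)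
  also have "\<dots> = ?W\<^sup>2 * ((2 * ?e * kp + u) * (2 * ?e * km + v) - w\<^sup>2)"
    unfolding 1 2 3 by (simp add: algebra_simps power2_eq_square)
  finally show ?thesis using stark_wronskian_nonzero[OF pos(3)] by simp
qed

text \<open>For \<open>kp\<close> and \<open>km\<close> away from the imaginary axis
  \<open>stark_a\<close> has its own expansion, and \<open>Airy_rotate\<close> writes
  \<open>stark_g\<close> through \<open>Airy\<close> and its partner at
  \<open>tau ^ 8\<close>.\<close>

lemma det_zero_1:
  assumes det: "stark_det \<kappa> \<eta> f z = 0" and sec: "Re kp \<ge> cmod kp / 4" "Re km \<ge> cmod km / 4"
  obtains ap am bp bm where "near1 ap am bp bm" "F1 ap am bp bm + \<i> * Xm\<^sup>2 * N ap am bp bm = 0"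
proof -
  obtain ap where ap: "stark_a f z \<kappa> = amp kp * Xp * ap" "cmod (ap - 1) \<le> \<delta>"
    unfolding Xp_def by (rule stark_a_asymptotics[OF kp_hyps sec(1)])
  obtain am where am: "stark_a f z (-\<kappa>) = amp km * Xm * am" "cmod (am - 1) \<le> \<delta>"
    unfolding Xm_def by (rule stark_a_asymptotics[OF km_hyps sec(2)])
  obtain bp where bp: "Airy (tau ^ 8 * stark_arg f z \<kappa>) = tau * (amp kp / Xp) * bp" "cmod (bp - 1) \<le> \<delta>"
    unfolding Xp_def by (rule stark_B_asymptotics[OF kp_hyps])
  obtain bm where bm: "Airy (tau ^ 8 * stark_arg f z (-\<kappa>)) = tau * (amp km / Xm) * bm" "cmod (bm - 1) \<le> \<delta>"
    unfolding Xm_def by (rule stark_B_asymptotics[OF km_hyps])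
  have G: "stark_g f z \<kappa> = tau\<^sup>2 * (amp kp * Xp * ap) - tau ^ 4 * (tau * (amp kp / Xp) * bp)"
    "stark_g f z (-\<kappa>) = tau\<^sup>2 * (amp km * Xm * am) - tau ^ 4 * (tau * (amp km / Xm) * bm)"
    unfolding stark_g_def Airy_rotate bp(1) bm(1) unfolding tau_8 ap(1)[unfolded stark_a_def] am(1)[unfolded stark_a_def]
    by simp_all
  have diag: "2 * k * ((amp k * X * a) * (tau\<^sup>2 * (amp k * X * a) - tau ^ 4 * (tau * (amp k / X) * b)))
      = stark_wronskian f * (a * b + \<i> * (X\<^sup>2 * a\<^sup>2))"
    if "(amp k)\<^sup>2 * k = of_real (root 3 f)" "X \<noteq> 0" for k X a b
  proof -
    have "2 * k * ((amp k * X * a) * (tau\<^sup>2 * (amp k * X * a) - tau ^ 4 * (tau * (amp k / X) * b)))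
        = ((amp k)\<^sup>2 * k) * 2 * (X * a * (tau\<^sup>2 * (X * a)) - tau ^ 5 * (a * b))"
      using that(2) by (simp add: field_simps power2_eq_square eval_nat_numeral)
    thus ?thesis unfolding that(1) stark_wronskian_def tau2_eq by (simp add: algebra_simps power2_eq_square)
  qed
  have "stark_a f z \<kappa> * stark_g f z (-\<kappa>) = amp kp * amp km * (Xp / Xm) * ap * (tau\<^sup>2 * Xm\<^sup>2 * am - tau ^ 5 * bm)"
    unfolding ap(1) G using q_eq by (simp add: field_simps power2_eq_square eval_nat_numeral)
  also have "\<dots> = - (tau ^ 5) * (amp kp * amp km * ((Xp / Xm) * ap * (bm + \<i> * (Xm\<^sup>2 * am))))"
    unfolding tau2_eq using q_eq by (simp add: field_simps)
  finally have eq: "(2 * of_real \<eta> * kp + (ap * bp + \<i> * (Xp\<^sup>2 * ap\<^sup>2))) * (2 * of_real \<eta> * km + (am * bm + \<i> * (Xm\<^sup>2 * am\<^sup>2)))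
      - ((Xp / Xm) * ap * (bm + \<i> * (Xm\<^sup>2 * am)))\<^sup>2 = 0"
    using diag[OF scaled(5)[OF kp_hyps]] diag[OF scaled(5)[OF km_hyps]] q_eq
    by (intro det_zero_expand[OF det]) (simp_all add: ap(1) am(1) G)
  have sq: "(Xp / Xm)\<^sup>2 = q" "Xp\<^sup>2 = q * Xm\<^sup>2" unfolding q_eq(1) using q_eq by (simp_all add: power_divide)
  have "F1 ap am bp bm + \<i> * Xm\<^sup>2 * N ap am bp bm = 0"
    using eq[unfolded power_mult_distrib sq] unfolding F1_def N_def by (simp add: algebra_simps power2_eq_square)
  thus ?thesis using that ap am bp bm by (auto simp: near1_def)
qed

text \<open>Near the positive real axis both exponentials in \<open>stark_a\<close> are comparable,
  so it has no expansion of relative accuracy. There \<open>stark_g\<close> has one, and the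
  connection formula writes \<open>stark_a\<close> through \<open>stark_g\<close> and the same
  partner as before.\<close>

lemma det_zero_2:
  assumes det: "stark_det \<kappa> \<eta> f z = 0" and sec: "Im kp \<ge> Re kp" "Im km \<ge> Re km"
  obtains ap am bp bm where "near1 ap am bp bm" "F2 ap am bp bm + \<i> * Xm\<^sup>2 * N ap am bp bm = 0"
proof -
  obtain ap where ap: "stark_g f z \<kappa> = tau\<^sup>2 * (amp kp * Xp * ap)" "cmod (ap - 1) \<le> \<delta>"
    unfolding Xp_def by (rule stark_g_asymptotics[OF kp_hyps sec(1)])
  obtain am where am: "stark_g f z (-\<kappa>) = tau\<^sup>2 * (amp km * Xm * am)" "cmod (am - 1) \<le> \<delta>"
    unfolding Xm_def by (rule stark_g_asymptotics[OF km_hyps sec(2)])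
  obtain bp where bp: "Airy (tau ^ 8 * stark_arg f z \<kappa>) = tau * (amp kp / Xp) * bp" "cmod (bp - 1) \<le> \<delta>"
    unfolding Xp_def by (rule stark_B_asymptotics[OF kp_hyps])
  obtain bm where bm: "Airy (tau ^ 8 * stark_arg f z (-\<kappa>)) = tau * (amp km / Xm) * bm" "cmod (bm - 1) \<le> \<delta>"
    unfolding Xm_def by (rule stark_B_asymptotics[OF km_hyps])
  have t: "tau ^ 4 * tau\<^sup>2 = - 1" "tau\<^sup>2 * tau = \<i>"
    using tau_6 tau_simps(1) by (simp_all flip: power_add power_Suc2)
  have AA: "Airy y = - (tau ^ 4) * Airy (tau ^ 4 * y) + tau\<^sup>2 * Airy (tau ^ 8 * y)" for y
    using airy_connection[of y] unfolding tau_8 by (simp add: algebra_simps eq_neg_iff_add_eq_0)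
  have aa: "stark_a f z x = - (tau ^ 4) * stark_g f z x + tau\<^sup>2 * Airy (tau ^ 8 * stark_arg f z x)" for x
    unfolding stark_a_def stark_g_def by (rule AA)
  have "stark_a f z \<kappa> = - (tau ^ 4 * tau\<^sup>2) * (amp kp * Xp * ap) + (tau\<^sup>2 * tau) * ((amp kp / Xp) * bp)"
    "stark_a f z (-\<kappa>) = - (tau ^ 4 * tau\<^sup>2) * (amp km * Xm * am) + (tau\<^sup>2 * tau) * ((amp km / Xm) * bm)"
    unfolding aa ap(1) am(1) bp(1) bm(1) by (simp_all add: mult_ac)
  hence A: "stark_a f z \<kappa> = amp kp * Xp * ap + \<i> * ((amp kp / Xp) * bp)" "stark_a f z (-\<kappa>) = amp km * Xm * am + \<i> * ((amp km / Xm) * bm)"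
    unfolding t by simp_all
  have diag: "2 * k * ((amp k * X * a + \<i> * ((amp k / X) * b)) * (tau\<^sup>2 * (amp k * X * a)))
      = stark_wronskian f * (\<i> * (X\<^sup>2 * a\<^sup>2) - a * b)"
    if "(amp k)\<^sup>2 * k = of_real (root 3 f)" "X \<noteq> 0" for k X a b
  proof -
    have "2 * k * ((amp k * X * a + \<i> * ((amp k / X) * b)) * (tau\<^sup>2 * (amp k * X * a)))
        = ((amp k)\<^sup>2 * k) * 2 * tau\<^sup>2 * (X\<^sup>2 * a\<^sup>2 + \<i> * (a * b))"
      using that(2) by (simp add: field_simps power2_eq_square)
    thus ?thesis unfolding that(1) stark_wronskian_def tau2_eq by (simp add: algebra_simps)
  qed
  have "stark_a f z \<kappa> * stark_g f z (-\<kappa>) = tau\<^sup>2 * (amp kp * amp km * (Xm / Xp) * am * (Xp\<^sup>2 * ap + \<i> * bp))"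
    unfolding A am(1) using q_eq by (simp add: field_simps power2_eq_square)
  also have "\<dots> = - (tau ^ 5) * (amp kp * amp km * ((Xm / Xp) * am * (\<i> * (Xp\<^sup>2 * ap) - bp)))"
    unfolding tau2_eq using q_eq by (simp add: field_simps)
  finally have eq: "(2 * of_real \<eta> * kp + (\<i> * (Xp\<^sup>2 * ap\<^sup>2) - ap * bp)) * (2 * of_real \<eta> * km + (\<i> * (Xm\<^sup>2 * am\<^sup>2) - am * bm))
      - ((Xm / Xp) * am * (\<i> * (Xp\<^sup>2 * ap) - bp))\<^sup>2 = 0"
    using diag[OF scaled(5)[OF kp_hyps]] diag[OF scaled(5)[OF km_hyps]] q_eq
    by (intro det_zero_expand[OF det]) (simp_all add: A ap(1) am(1))
  have sq: "(Xm / Xp)\<^sup>2 = 1 / q" "Xp\<^sup>2 = q * Xm\<^sup>2" unfolding q_eq(1) using q_eq by (simp_all add: power_divide)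
  have "F2 ap am bp bm + \<i> * Xm\<^sup>2 * N ap am bp bm = 0"
    using eq[unfolded power_mult_distrib sq] q_eq(2) unfolding F2_def N_def by (simp add: field_simps power2_eq_square)
  thus ?thesis using that ap am bp bm by (auto simp: near1_def)
qed

end

section \<open>Size estimates that exclude zeros\<close>

lemma sin_ge_half:
  fixes x :: real
  assumes "0 \<le> x" "x \<le> pi / 2"
  shows "x / 2 \<le> sin x"
proof -
  have "\<bar>sin x - (\<Sum>k<3. sin_coeff k * x ^ k)\<bar> \<le> inverse (fact 3) * \<bar>x\<bar> ^ 3"
    by (rule Maclaurin_sin_bound)
  hence "\<bar>sin x - x\<bar> \<le> x ^ 3 / 6"
    using assms(1) by (simp add: eval_nat_numeral sin_coeff_def field_simps)
  hence "x - x ^ 3 / 6 \<le> sin x" by linarith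
  moreover have "x ^ 3 \<le> 3 * x"
  proof -
    have "x \<le> 17 / 10" using assms pi_less_4 pi_approx(2) by simp
    hence "x\<^sup>2 \<le> (17 / 10)\<^sup>2" using assms by (intro power_mono) auto
    hence "x * x\<^sup>2 \<le> x * 3" using assms by (intro mult_left_mono) (auto simp: power2_eq_square)
    thus ?thesis by (simp add: power3_eq_cube power2_eq_square mult_ac)
  qed
  ultimately show ?thesis by simp
qed

lemma norm_le_2: "cmod (a - 1) \<le> d \<Longrightarrow> d \<le> 1 \<Longrightarrow> cmod a \<le> 2"
  using norm_triangle_ineq[of "a - 1" 1] by simp

context stark_regime
begin

lemma rho_T: "1 \<le> \<rho> * T" "\<rho> \<le> T"
proof -
  have "f \<le> \<epsilon> * \<rho>" by (rule f_le_rho)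
  also have "\<dots> \<le> 1 * \<rho>" using eps rho(1) by (intro mult_right_mono) auto
  finally have "T * f \<le> T * \<rho>" using T(4) by (intro mult_left_mono) auto
  moreover have "1 \<le> T * f" using T(1) pos by (simp add: field_simps)
  ultimately show "1 \<le> \<rho> * T" by (simp add: mult.commute)
  have "T * 1 \<le> T * T" using T(4) by (intro mult_left_mono) auto
  hence "\<rho>\<^sup>2 \<le> T\<^sup>2" using T(2) by (simp add: power2_eq_square)
  thus "\<rho> \<le> T" by (rule power2_le_imp_le) (use T(4) in auto)
qed

text \<open>\<open>F2\<close> contains \<open>1 / q\<close>, and \<open>q\<close> can be
  exponentially small for large \<open>\<rho>\<close>; only \<open>q * F2\<close> is bounded by a
  power of \<open>T\<close>.\<close>

lemma F_upper:
  assumes near: "near1 ap am bp bm"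
    and q: "cmod q \<le> 1" and e: "(9 * \<eta>\<^sup>2 + 48) * \<epsilon> \<le> 1"
  shows "cmod (F1 ap am bp bm) \<le> T\<^sup>2" "cmod (q * F2 ap am bp bm) \<le> T\<^sup>2"
proof -
  note a = near1D[OF near]
  note n = a[THEN norm_le_2, OF delta(4)]
  have prod: "cmod (ap * bp) \<le> 2 * 2" "cmod (am * bm) \<le> 2 * 2" "cmod (ap\<^sup>2) \<le> 2\<^sup>2" "cmod (bm\<^sup>2) \<le> 2\<^sup>2" "cmod (am\<^sup>2) \<le> 2\<^sup>2" "cmod (bp\<^sup>2) \<le> 2\<^sup>2"
    unfolding norm_mult norm_power by (intro mult_mono power_mono n norm_ge_zero; simp)+
  have k: "cmod (2 * of_real \<eta> * kp) \<le> 2 * \<eta> * (101 / 100 * \<rho>)" "cmod (2 * of_real \<eta> * km) \<le> 2 * \<eta> * (101 / 100 * \<rho>)"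
    using norm_k pos by (simp_all add: norm_mult)
  let ?b = "2 * \<eta> * (101 / 100 * \<rho>) + 2 * 2"
  have b0: "0 \<le> ?b" using pos rho(1) by simp
  have fac: "cmod (2 * of_real \<eta> * kp + ap * bp) \<le> ?b" "cmod (2 * of_real \<eta> * km + am * bm) \<le> ?b"
    "cmod (2 * of_real \<eta> * kp - ap * bp) \<le> ?b" "cmod (2 * of_real \<eta> * km - am * bm) \<le> ?b"
    by (intro order.trans[OF norm_triangle_ineq] order.trans[OF norm_triangle_ineq4] add_mono k prod)+
  have final: "?b * ?b + 16 \<le> T\<^sup>2"
  proof -
    have "0 \<le> (2 * \<eta> * (101 / 100 * \<rho>) - 4)\<^sup>2" by simp
    hence "?b * ?b + 16 \<le> 2 * (2 * \<eta> * (101 / 100 * \<rho>))\<^sup>2 + 48" by (simp add: power2_eq_square algebra_simps)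
    also have "\<dots> = 10201 / 1250 * (\<eta>\<^sup>2 * \<rho>\<^sup>2) + 48 * 1" by (simp add: power_mult_distrib power_divide)
    also have "\<dots> \<le> 9 * (\<eta>\<^sup>2 * T) + 48 * T"
      using T(2,4) by (intro add_mono mult_mono mult_left_mono) auto
    also have "\<dots> = (9 * \<eta>\<^sup>2 + 48) * T" by (simp add: algebra_simps)
    also have "\<dots> \<le> T * T" using T_I[OF e] T(4) by (intro mult_right_mono) auto
    finally show ?thesis by (simp add: power2_eq_square)
  qed
  have "cmod (F1 ap am bp bm) \<le> cmod ((2 * of_real \<eta> * kp + ap * bp) * (2 * of_real \<eta> * km + am * bm)) + cmod (q * ap\<^sup>2 * bm\<^sup>2)"
    unfolding F1_def by (rule norm_triangle_ineq4)
  also have "\<dots> \<le> ?b * ?b + 1 * 2\<^sup>2 * 2\<^sup>2"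
    unfolding norm_mult using fac prod q b0 by (intro add_mono mult_mono) auto
  finally show "cmod (F1 ap am bp bm) \<le> T\<^sup>2" using final by simp
  have "q * F2 ap am bp bm = q * ((2 * of_real \<eta> * kp - ap * bp) * (2 * of_real \<eta> * km - am * bm)) - am\<^sup>2 * bp\<^sup>2"
    unfolding F2_def using q_eq(2) by (simp add: algebra_simps)
  hence "cmod (q * F2 ap am bp bm) \<le> cmod (q * ((2 * of_real \<eta> * kp - ap * bp) * (2 * of_real \<eta> * km - am * bm))) + cmod (am\<^sup>2 * bp\<^sup>2)"
    by (simp only: norm_triangle_ineq4)
  also have "\<dots> \<le> 1 * (?b * ?b) + 2\<^sup>2 * 2\<^sup>2"
    unfolding norm_mult using fac prod q b0 by (intro add_mono mult_mono) auto
  finally show "cmod (q * F2 ap am bp bm) \<le> T\<^sup>2" using final by simp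
qed

text \<open>Multiplication by \<open>q\<close> turns \<open>Xm\<^sup>2\<close> into
  \<open>Xp\<^sup>2\<close>. Then the term with \<open>N\<close> is at least
  \<open>T ^ 6 / T ^ 3\<close>, too large to be cancelled by \<open>q * F\<close>, which is at most
  \<open>T\<^sup>2\<close>.\<close>

lemma no_zero_if_Xp_large:
  assumes X: "T ^ 6 \<le> (cmod Xp)\<^sup>2" and q: "cmod q \<le> 1"
    and N: "1 / T ^ 3 \<le> cmod (N ap am bp bm)"
    and F: "cmod (q * F) \<le> T\<^sup>2 \<or> cmod F \<le> T\<^sup>2"
  shows "F + \<i> * Xm\<^sup>2 * N ap am bp bm \<noteq> 0"
proof
  assume "F + \<i> * Xm\<^sup>2 * N ap am bp bm = 0"
  hence "F = - (\<i> * Xm\<^sup>2 * N ap am bp bm)" by (simp add: eq_neg_iff_add_eq_0)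
  hence eq: "cmod F = (cmod Xm)\<^sup>2 * cmod (N ap am bp bm)" by (simp add: norm_mult norm_power)
  have Xpq: "(cmod Xp)\<^sup>2 = cmod q * (cmod Xm)\<^sup>2"
    unfolding q_eq(1) using q_eq by (simp add: norm_power norm_divide power_divide)
  have qF: "cmod (q * F) \<le> T\<^sup>2"
    using F
  proof
    assume "cmod F \<le> T\<^sup>2"
    moreover have "cmod (q * F) \<le> 1 * cmod F" unfolding norm_mult using q by (intro mult_right_mono) auto
    ultimately show ?thesis by simp
  qed
  have "T ^ 6 * (1 / T ^ 3) \<le> (cmod Xp)\<^sup>2 * cmod (N ap am bp bm)"
    using X N T(4) by (intro mult_mono) auto
  also have "\<dots> = cmod (q * F)" unfolding Xpq norm_mult eq by simp
  also note qF
  also have "T ^ 6 * (1 / T ^ 3) = T\<^sup>2 * T" using T(4) by (simp add: eval_nat_numeral)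
  finally have "T\<^sup>2 * T \<le> T\<^sup>2 * 1" by simp
  thus False using T(4) by simp
qed

lemma Re_k_lower:
  assumes "Re (k\<^sup>2) \<ge> 0" "Re k > 0" "Im k > 0" "99 / 100 * \<rho> \<le> cmod k"
  shows "2 / 3 * \<rho> \<le> Re k" "Im k \<le> Re k"
proof -
  have sq: "(Im k)\<^sup>2 \<le> (Re k)\<^sup>2" using assms(1) by (simp add: power2_eq_square)
  thus "Im k \<le> Re k" by (rule power2_le_imp_le) (use assms in auto)
  have "(99 / 100 * \<rho>)\<^sup>2 \<le> (cmod k)\<^sup>2" using assms(4) rho(1) by (intro power_mono) auto
  hence "(99 / 100 * \<rho>)\<^sup>2 \<le> 2 * (Re k)\<^sup>2" using sq by (simp add: cmod_power2)
  moreover have "(99 / 100 * \<rho>)\<^sup>2 = 9801 / 10000 * \<rho>\<^sup>2" "(2 / 3 * \<rho>)\<^sup>2 = 4 / 9 * \<rho>\<^sup>2"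
    by (simp_all add: power_mult_distrib power_divide)
  ultimately have "(2 / 3 * \<rho>)\<^sup>2 \<le> (Re k)\<^sup>2" using zero_le_power2[of \<rho>] by linarith
  thus "2 / 3 * \<rho> \<le> Re k" by (rule power2_le_imp_le) (use assms in auto)
qed

text \<open>The term with \<open>N\<close> is at most \<open>T\<^sup>2 / T ^ 6\<close>, while
  \<open>F1\<close> is at least \<open>\<eta> * \<rho>\<close>: the roots \<open>kp\<close> and
  \<open>km\<close> lie within 45 degrees of the real axis, so every summand of \<open>F0\<close>,
  the value of \<open>F1\<close> at correction factors 1, has nonnegative real part.\<close>

lemma no_zero_if_Xm_small:
  assumes X: "(cmod Xm)\<^sup>2 \<le> 1 / T ^ 6"
    and R: "Re (kp\<^sup>2) \<ge> 0" "Re (km\<^sup>2) \<ge> 0"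
    and near: "near1 ap am bp bm"
    and e: "450 * \<epsilon> \<le> \<eta>" "(17 * \<eta> + 32) * \<epsilon> \<le> 1"
  shows "F1 ap am bp bm + \<i> * Xm\<^sup>2 * N ap am bp bm \<noteq> 0"
proof
  note a = near1D[OF near]
  assume "F1 ap am bp bm + \<i> * Xm\<^sup>2 * N ap am bp bm = 0"
  hence "F1 ap am bp bm = - (\<i> * Xm\<^sup>2 * N ap am bp bm)" by (simp add: eq_neg_iff_add_eq_0)
  hence eq: "cmod (F1 ap am bp bm) = (cmod Xm)\<^sup>2 * cmod (N ap am bp bm)" by (simp add: norm_mult norm_power)
  note kp = Re_k_lower[OF R(1) k_quadrant(1,2) norm_k(1)]
  note km = Re_k_lower[OF R(2) k_quadrant(3,4) norm_k(3)]
  have q: "cmod q \<le> 1"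
  proof -
    have "2 / 3 * \<rho> \<le> Re m" using kp km by (simp add: m_def)
    moreover have "- (\<rho> / 10000) \<le> Re (d\<^sup>2 / m)" using d2m_le abs_Re_le_cmod[of "d\<^sup>2 / m"] by linarith
    ultimately have "0 \<le> Re m + 1 / 3 * Re (d\<^sup>2 / m)" using rho(1) by linarith
    hence "0 \<le> 2 * \<kappa> * (Re m + 1 / 3 * Re (d\<^sup>2 / m))" using pos by simp
    moreover have "\<Delta> = of_real (2 * \<kappa>) * (m + of_real (1 / 3) * (d\<^sup>2 / m))"
      unfolding Delta_eq by (simp add: algebra_simps)
    hence "Re \<Delta> = 2 * \<kappa> * (Re m + 1 / 3 * Re (d\<^sup>2 / m))"
      by (simp only: plus_complex.sel Re_complex_of_real times_complex.sel Im_complex_of_real mult_zero_left diff_zero)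
    ultimately show ?thesis by (simp add: q_def)
  qed
  note n = a[THEN norm_le_2, OF delta(4)]
  have Nup: "cmod (N ap am bp bm) \<le> T\<^sup>2"
  proof -
    have "cmod (N ap am bp bm) \<le> 2 * \<eta> * (cmod q * (cmod ap)\<^sup>2 * cmod km + (cmod am)\<^sup>2 * cmod kp)
        + (cmod am)\<^sup>2 * cmod ap * cmod bp + cmod q * (cmod ap)\<^sup>2 * cmod am * cmod bm"
    proof -
      have "cmod (2 * of_real \<eta> * (q * ap\<^sup>2 * km + am\<^sup>2 * kp)) = 2 * \<eta> * cmod (q * ap\<^sup>2 * km + am\<^sup>2 * kp)"
        using pos by (simp add: norm_mult)
      also have "\<dots> \<le> 2 * \<eta> * (cmod (q * ap\<^sup>2 * km) + cmod (am\<^sup>2 * kp))"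
        using pos by (intro mult_left_mono norm_triangle_ineq) auto
      finally show ?thesis unfolding N_def
        using norm_triangle_ineq4[of "2 * of_real \<eta> * (q * ap\<^sup>2 * km + am\<^sup>2 * kp) + am\<^sup>2 * ap * bp" "q * ap\<^sup>2 * am * bm"]
          norm_triangle_ineq[of "2 * of_real \<eta> * (q * ap\<^sup>2 * km + am\<^sup>2 * kp)" "am\<^sup>2 * ap * bp"]
        unfolding norm_mult norm_power by linarith
    qed
    also have "\<dots> \<le> 2 * \<eta> * (1 * 2\<^sup>2 * (101 / 100 * \<rho>) + 2\<^sup>2 * (101 / 100 * \<rho>)) + 2\<^sup>2 * 2 * 2 + 1 * 2\<^sup>2 * 2 * 2"
      using n q norm_k pos rho(1) by (intro add_mono mult_mono power_mono mult_nonneg_nonneg) auto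
    also have "\<dots> = 404 / 25 * (\<eta> * \<rho>) + 32 * 1" by simp
    also have "\<dots> \<le> 17 * (\<eta> * T) + 32 * T" using rho_T T(4) pos rho(1) by (intro add_mono mult_mono mult_left_mono) auto
    also have "\<dots> = (17 * \<eta> + 32) * T" by (simp add: algebra_simps)
    also have "\<dots> \<le> T * T" using T_I[OF e(2)] T(4) by (intro mult_right_mono) auto
    finally show ?thesis by (simp add: power2_eq_square)
  qed
  have F: "\<eta> * \<rho> \<le> cmod (F1 ap am bp bm)"
  proof -
    define F0 where "F0 = 4 * of_real (\<eta>\<^sup>2) * (kp * km) + of_real (2 * \<eta>) * (kp + km) + (1 - q)"
    have 2: "cmod (ap * bp - 1) \<le> 3 * \<delta>" "cmod (am * bm - 1) \<le> 3 * \<delta>" "cmod (ap * ap - 1) \<le> 3 * \<delta>" "cmod (bm * bm - 1) \<le> 3 * \<delta>"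
      by (intro norm_mult_diff_1 a delta)+
    have 4: "cmod ((ap * bp) * (am * bm) - 1) \<le> 15 * \<delta>" "cmod ((ap * ap) * (bm * bm) - 1) \<le> 15 * \<delta>"
      by (intro norm_mult_diff_1' 2 delta)+
    have "F1 ap am bp bm - F0 = of_real (2 * \<eta>) * (kp * (am * bm - 1)) + of_real (2 * \<eta>) * (km * (ap * bp - 1))
        + ((ap * bp) * (am * bm) - 1) - q * ((ap * ap) * (bm * bm) - 1)"
      unfolding F1_def F0_def by (simp add: algebra_simps power2_eq_square)
    hence "cmod (F1 ap am bp bm - F0) \<le> cmod (of_real (2 * \<eta>) * (kp * (am * bm - 1))) + cmod (of_real (2 * \<eta>) * (km * (ap * bp - 1)))
        + cmod ((ap * bp) * (am * bm) - 1) + cmod (q * ((ap * ap) * (bm * bm) - 1))"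
      by (simp only: norm_triangle_4)
    also have "\<dots> = 2 * \<eta> * (cmod kp * cmod (am * bm - 1)) + 2 * \<eta> * (cmod km * cmod (ap * bp - 1))
        + cmod ((ap * bp) * (am * bm) - 1) + cmod q * cmod ((ap * ap) * (bm * bm) - 1)"
      using pos by (simp only: norm_mult[of "of_real _"] norm_mult[of q] norm_mult[of kp] norm_mult[of km] norm_of_real abs_of_pos mult_pos_pos zero_less_numeral)
    also have "\<dots> \<le> 2 * \<eta> * ((101 / 100 * \<rho>) * (3 * \<delta>)) + 2 * \<eta> * ((101 / 100 * \<rho>) * (3 * \<delta>)) + 15 * \<delta> + 1 * (15 * \<delta>)"
      using 2 4 q norm_k pos rho(1) delta by (intro add_mono mult_mono mult_left_mono) auto
    also have "\<dots> = 303 / 25 * \<eta> * \<rho> * \<delta> + 30 * \<delta>" by simp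
    also have "\<dots> \<le> 303 / 25 * \<eta> * \<rho> * (15 * (1 / 1000)) + 30 * (15 * \<epsilon> * \<rho>)"
    proof -
      have "\<delta> \<le> 15 * (1 / 1000)" using delta(2) eps(1) by linarith
      thus ?thesis using delta pos rho(1) by (intro add_mono mult_left_mono) auto
    qed
    also have "\<dots> = 909 / 5000 * (\<eta> * \<rho>) + (450 * \<epsilon>) * \<rho>" by simp
    also have "\<dots> \<le> 909 / 5000 * (\<eta> * \<rho>) + \<eta> * \<rho>" using e rho(1) by (intro add_mono mult_right_mono order.refl) auto
    finally have diff: "cmod (F1 ap am bp bm - F0) \<le> 909 / 5000 * (\<eta> * \<rho>) + \<eta> * \<rho>" .
    have "Re F0 = 4 * \<eta>\<^sup>2 * Re (kp * km) + 2 * \<eta> * (Re kp + Re km) + (1 - Re q)"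
      unfolding F0_def by (simp add: algebra_simps)
    moreover have "Re (kp * km) \<ge> 0"
      using mult_mono[OF kp(2) km(2)] k_quadrant by simp
    hence "4 * \<eta>\<^sup>2 * Re (kp * km) \<ge> 0" by (intro mult_nonneg_nonneg) auto
    moreover have "2 * \<eta> * (2 / 3 * \<rho> + 2 / 3 * \<rho>) \<le> 2 * \<eta> * (Re kp + Re km)"
      using kp km pos by (intro mult_left_mono add_mono) auto
    moreover have "2 * \<eta> * (2 / 3 * \<rho> + 2 / 3 * \<rho>) = 8 / 3 * (\<eta> * \<rho>)" by simp
    moreover have "Re q \<le> 1" using complex_Re_le_cmod[of q] q by linarith
    ultimately have "8 / 3 * (\<eta> * \<rho>) \<le> Re F0" by linarith
    hence "8 / 3 * (\<eta> * \<rho>) \<le> cmod F0" using complex_Re_le_cmod[of F0] by linarith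
    moreover have "cmod F0 \<le> cmod (F1 ap am bp bm) + cmod (F1 ap am bp bm - F0)"
      using norm_triangle_ineq4[of "F1 ap am bp bm" "F1 ap am bp bm - F0"] by simp
    moreover have "0 \<le> \<eta> * \<rho>" using pos rho(1) by simp
    ultimately show ?thesis using diff by linarith
  qed
  have "\<eta> * \<rho> \<le> (1 / T ^ 6) * T\<^sup>2"
    using F unfolding eq using X Nup by (meson order.trans mult_mono norm_ge_zero zero_le_power2 order.trans)
  hence "\<eta> * \<rho> * T ^ 4 \<le> 1" using T(4) by (simp add: field_simps eval_nat_numeral)
  moreover have "1 < \<eta> * \<rho> * T ^ 4"
  proof -
    have "450 / \<eta> \<le> T" using e(1) pos by (intro T_I) (simp add: field_simps)
    hence eT: "450 \<le> \<eta> * T" using pos by (simp add: field_simps)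
    have "450 * 1 * 1 * 1 \<le> (\<eta> * T) * (\<rho> * T) * T * T" using eT rho_T(1) T(4) by (intro mult_mono) auto
    thus ?thesis by (simp add: eval_nat_numeral mult_ac)
  qed
  ultimately show False by simp
qed

end

section \<open>The angular regions\<close>

context stark_regime
begin

text \<open>The square root of \<open>- z\<close> in the first quadrant. The sign of
  \<open>Re (k0 ^ 3)\<close> decides whether the exponentials at \<open>kp\<close> and
  \<open>km\<close> are large or small.\<close>

definition "k0 = of_real \<rho> * cis ((pi + Arg z) / 2)"

lemma Arg_z: "- pi < Arg z" "Arg z < 0"
  using z Arg_neg_iff[of z] mpi_less_Arg[of z] by auto

lemma z_polar: "Re z = \<rho>\<^sup>2 * cos (Arg z)" "Im z = \<rho>\<^sup>2 * sin (Arg z)"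
proof -
  have "z = rcis (\<rho>\<^sup>2) (Arg z)" unfolding rho(2) by (rule rcis_cmod_Arg[symmetric])
  thus "Re z = \<rho>\<^sup>2 * cos (Arg z)" "Im z = \<rho>\<^sup>2 * sin (Arg z)" by (metis Re_rcis, metis Im_rcis)
qed

lemma k0: "k0\<^sup>2 = - z" "cmod k0 = \<rho>" "Re k0 > 0" "Im k0 > 0" "Re (k0 ^ 3) = - (\<rho> ^ 3 * sin (3 * (- Arg z) / 2))"
proof -
  have "real 2 * ((pi + Arg z) / 2) = pi + Arg z" by simp
  hence "k0\<^sup>2 = of_real (\<rho>\<^sup>2) * cis (pi + Arg z)"
    unfolding k0_def power_mult_distrib Complex.DeMoivre by (simp only: of_real_power)
  also have "\<dots> = - z" by (simp add: complex_eq_iff z_polar)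
  finally show "k0\<^sup>2 = - z" .
  show "cmod k0 = \<rho>" using rho(1) by (simp add: k0_def norm_mult)
  show "Re k0 > 0" "Im k0 > 0"
    unfolding k0_def using rho(1) Arg_z by (auto intro!: mult_pos_pos cos_gt_zero_pi sin_gt_zero)
  have "k0 ^ 3 = of_real (\<rho> ^ 3) * cis (3 * ((pi + Arg z) / 2))"
    unfolding k0_def power_mult_distrib Complex.DeMoivre by simp
  hence "Re (k0 ^ 3) = \<rho> ^ 3 * cos (3 * ((pi + Arg z) / 2))" by (simp del: of_real_power)
  also have "3 * ((pi + Arg z) / 2) = 3 / 2 * pi - 3 * (- Arg z) / 2" by (simp add: field_simps)
  also have "cos \<dots> = - sin (3 * (- Arg z) / 2)" unfolding cos_diff cos_3over2_pi sin_3over2_pi by simp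
  finally show "Re (k0 ^ 3) = - (\<rho> ^ 3 * sin (3 * (- Arg z) / 2))" by simp
qed

text \<open>\<open>k ^ 3 - k0 ^ 3\<close> is
  \<open>(k\<^sup>2 - k0\<^sup>2) * (k\<^sup>2 + k * k0 + k0\<^sup>2)\<close> divided by
  \<open>k + k0\<close>, a sum without cancellation in the first quadrant.\<close>

lemma cube_near_k0:
  assumes k: "cmod (k\<^sup>2 + z) = \<kappa> * f" "Re k > 0" "Im k > 0" "99 / 100 * \<rho> \<le> cmod k" "cmod k \<le> 101 / 100 * \<rho>"
  shows "\<bar>Re (k ^ 3) - Re (k0 ^ 3)\<bar> \<le> 5 / 2 * \<kappa> * f * \<rho>"
proof -
  have eq: "(k + k0) * (k ^ 3 - k0 ^ 3) = (k\<^sup>2 + z) * (k\<^sup>2 + k * k0 + k0\<^sup>2)"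
  proof -
    have kz: "k\<^sup>2 + z = k\<^sup>2 - k0\<^sup>2" using k0(1) by simp
    show ?thesis unfolding kz by (simp add: algebra_simps power2_eq_square power3_eq_cube)
  qed
  have "(7 / 5 * \<rho>)\<^sup>2 \<le> (cmod (k + k0))\<^sup>2"
  proof -
    have "(99 / 100 * \<rho>)\<^sup>2 + \<rho>\<^sup>2 \<le> (cmod k)\<^sup>2 + (cmod k0)\<^sup>2"
      unfolding k0(2) using k(4) rho(1) by (intro add_mono power_mono) auto
    also have "\<dots> \<le> (cmod (k + k0))\<^sup>2" using k k0 by (intro norm_add_quadrant) auto
    finally have "(99 / 100 * \<rho>)\<^sup>2 + \<rho>\<^sup>2 \<le> (cmod (k + k0))\<^sup>2" .
    moreover have "(99 / 100 * \<rho>)\<^sup>2 = 9801 / 10000 * \<rho>\<^sup>2" "(7 / 5 * \<rho>)\<^sup>2 = 49 / 25 * \<rho>\<^sup>2"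
      by (simp_all add: power_mult_distrib power_divide)
    ultimately show ?thesis using zero_le_power2[of \<rho>] by linarith
  qed
  hence "7 / 5 * \<rho> \<le> cmod (k + k0)" by (rule power2_le_imp_le) simp
  hence "(7 / 5 * \<rho>) * cmod (k ^ 3 - k0 ^ 3) \<le> cmod (k + k0) * cmod (k ^ 3 - k0 ^ 3)" by (rule mult_right_mono) simp
  also have "\<dots> = \<kappa> * f * cmod (k\<^sup>2 + k * k0 + k0\<^sup>2)" unfolding norm_mult[symmetric] eq by (simp add: norm_mult k(1))
  also have "\<dots> \<le> \<kappa> * f * ((101 / 100 * \<rho>)\<^sup>2 + (101 / 100 * \<rho>) * \<rho> + \<rho>\<^sup>2)"
  proof (rule mult_left_mono)
    have "cmod (k\<^sup>2 + k * k0 + k0\<^sup>2) \<le> (cmod k)\<^sup>2 + cmod k * cmod k0 + (cmod k0)\<^sup>2"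
      unfolding norm_power[symmetric] norm_mult[symmetric]
      by (intro order.trans[OF norm_triangle_ineq] add_mono order.refl norm_triangle_ineq)
    also have "\<dots> \<le> (101 / 100 * \<rho>)\<^sup>2 + (101 / 100 * \<rho>) * \<rho> + \<rho>\<^sup>2"
      unfolding k0(2) using k(5) rho(1) by (intro add_mono power_mono mult_right_mono) auto
    finally show "cmod (k\<^sup>2 + k * k0 + k0\<^sup>2) \<le> (101 / 100 * \<rho>)\<^sup>2 + (101 / 100 * \<rho>) * \<rho> + \<rho>\<^sup>2" .
  qed (use pos in auto)
  also have "\<dots> = (7 / 5 * \<rho>) * (30301 / 14000 * (\<kappa> * f * \<rho>))"
    by (simp add: power2_eq_square algebra_simps)
  finally have "cmod (k ^ 3 - k0 ^ 3) \<le> 30301 / 14000 * (\<kappa> * f * \<rho>)" using rho(1) by simp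
  moreover have "\<bar>Re (k ^ 3) - Re (k0 ^ 3)\<bar> \<le> cmod (k ^ 3 - k0 ^ 3)"
    using abs_Re_le_cmod[of "k ^ 3 - k0 ^ 3"] by simp
  moreover have "0 \<le> \<kappa> * f * \<rho>" using pos rho(1) by simp
  ultimately show ?thesis by linarith
qed

lemma norm_exp_cube: "(cmod (exp (- 2 / 3 * (k ^ 3 / of_real f))))\<^sup>2 = exp (- (4 / 3) * (Re (k ^ 3) / f))"
proof -
  have "Re (- 2 / 3 * (k ^ 3 / of_real f)) = - 2 / 3 * (Re (k ^ 3) / f)" by (simp add: Re_divide_of_real)
  thus ?thesis by (simp add: flip: exp_double)
qed

lemma ln_T_exp: "exp (6 * ln T) = T ^ 6"
  using T(4) by (simp add: exp_of_nat_mult[of 6, simplified])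

lemma Re_k_square: "Re (kp\<^sup>2) = - Re z + \<kappa> * f" "Re (km\<^sup>2) = - Re z - \<kappa> * f"
  by (simp_all add: k_square)

lemma k_plus_z: "cmod (kp\<^sup>2 + z) = \<kappa> * f" "cmod (km\<^sup>2 + z) = \<kappa> * f"
  using pos by (simp_all add: k_square norm_mult)

text \<open>The three angular regions are separated by \<open>Arg z = - 2 * pi / 3\<close>, where \<open>exp (- 2 / 3 * kp ^ 3 / f)\<close>
  changes from small to large, and \<open>Arg z = - pi / 3\<close>, where the representation of \<open>Airy\<close> is switched.\<close>

lemma stark_det_nonzero:
  assumes \<rho>0: "\<rho>0 > 0" "100 * \<kappa> * \<rho>0 \<le> 1" "\<rho>0 \<le> 1"
    and e: "2250 * \<epsilon> \<le> \<eta> + \<kappa>" "8 * (2 * \<kappa> + 195 * \<eta> + 450 / \<rho>0) * \<epsilon> \<le> 1" "8 * (2 * \<kappa> + 195 * \<eta> + 450 / \<rho>0) * \<epsilon> \<le> \<kappa>"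
      "(9 * \<eta>\<^sup>2 + 48) * \<epsilon> \<le> 1" "450 * \<epsilon> \<le> \<eta>" "(17 * \<eta> + 32) * \<epsilon> \<le> 1"
    and L: "ln T \<ge> 2 / \<epsilon>"
    and A1: "20 * f * ln T * (1 + \<rho>) / \<rho> ^ 3 \<le> \<bar>Arg z + 2 * pi / 3\<bar>"
    and A2: "20 * f * ln T / \<rho> ^ 3 \<le> \<bar>Arg z\<bar>"
  shows "stark_det \<kappa> \<eta> f z \<noteq> 0"
proof
  assume det: "stark_det \<kappa> \<eta> f z = 0"
  define t where "t = - Arg z"
  have t: "0 < t" "t < pi" using Arg_z by (auto simp: t_def)
  have L0: "0 < 2 / \<epsilon>" "0 < ln T" using L pos by (simp, smt (verit) divide_pos_pos)
  \<comment> \<open>The logarithm also absorbs \<open>\<kappa>\<close>, so the error of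
    \<open>cube_near_k0\<close> takes the form \<open>f * ln T * (1 + \<rho>)\<close> of the angular
    condition.\<close>
  have L\<kappa>: "5 / 2 * \<kappa> \<le> ln T"
  proof -
    define y where "y = 1 / \<epsilon>"
    have "100 * \<kappa> \<le> y" using eps(2) pos by (simp add: y_def field_simps)
    moreover have "2 * y \<le> ln T" using L by (simp add: y_def)
    moreover have "0 < y" using pos by (simp add: y_def)
    ultimately show ?thesis by linarith
  qed
  have t_ge: "20 * f * ln T \<le> t * \<rho> ^ 3" using A2 t rho(1) by (simp add: t_def field_simps)
  have r3: "\<rho> ^ 3 > 0" using rho(1) by simp
  have cube_dist: "\<bar>Re (kp ^ 3) - Re (k0 ^ 3)\<bar> \<le> f * ln T * (1 + \<rho>)" "\<bar>Re (km ^ 3) - Re (k0 ^ 3)\<bar> \<le> f * ln T * (1 + \<rho>)"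
  proof -
    have "5 / 2 * \<kappa> * f * \<rho> \<le> ln T * f * (1 + \<rho>)"
      using L\<kappa> pos rho(1) L0 by (intro mult_mono) auto
    thus "\<bar>Re (kp ^ 3) - Re (k0 ^ 3)\<bar> \<le> f * ln T * (1 + \<rho>)" "\<bar>Re (km ^ 3) - Re (k0 ^ 3)\<bar> \<le> f * ln T * (1 + \<rho>)"
      using cube_near_k0[OF k_plus_z(1) k_quadrant(1,2) norm_k(1,2)] cube_near_k0[OF k_plus_z(2) k_quadrant(3,4) norm_k(3,4)]
      by (simp_all add: mult_ac)
  qed
  \<comment> \<open>Of the margin 15 one unit is lost to the shift by \<open>\<kappa> * f\<close>;
    14 times 4/3 still exceeds 6.\<close>
  have c1: "\<bar>x - y\<bar> \<le> f * ln T * (1 + \<rho>) \<Longrightarrow> y \<le> - (15 * (f * ln T * (1 + \<rho>))) \<Longrightarrow> 6 * ln T \<le> - (4 / 3) * (x / f)" for x y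
  proof -
    assume "\<bar>x - y\<bar> \<le> f * ln T * (1 + \<rho>)" "y \<le> - (15 * (f * ln T * (1 + \<rho>)))"
    hence "x \<le> - (14 * (f * ln T * (1 + \<rho>)))" by linarith
    also have "f * ln T * 1 \<le> f * ln T * (1 + \<rho>)" using pos L0 rho(1) by (intro mult_left_mono) auto
    hence "- (14 * (f * ln T * (1 + \<rho>))) \<le> - (14 * (f * ln T))" by simp
    finally have "x / f \<le> - (14 * (f * ln T)) / f" using pos by (intro divide_right_mono) auto
    hence "x / f \<le> - (14 * ln T)" using pos by simp
    thus ?thesis using L0 by simp
  qed
  have c2: "\<bar>x - y\<bar> \<le> f * ln T * (1 + \<rho>) \<Longrightarrow> y \<ge> 15 * (f * ln T * (1 + \<rho>)) \<Longrightarrow> - (4 / 3) * (x / f) \<le> - (6 * ln T)" for x y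
    using c1[of "- x" "- y"] by (simp add: abs_minus_commute)
  \<comment> \<open>The phase is 3/2 times the deviation of the angle, and the sine is at least half
    of its argument: 20 becomes 15.\<close>
  have sinhalf: "15 * (f * ln T * (1 + \<rho>)) \<le> \<rho> ^ 3 * sin y"
    if "20 * f * ln T * (1 + \<rho>) / \<rho> ^ 3 \<le> 2 / 3 * y" "y \<le> pi / 2" for y
  proof -
    have "0 \<le> 20 * f * ln T * (1 + \<rho>) / \<rho> ^ 3" using pos L0 rho(1) by simp
    hence "0 \<le> y" using that by simp
    hence "y / 2 \<le> sin y" using that(2) by (rule sin_ge_half)
    hence "3 / 4 * c \<le> sin y" if "c \<le> 2 / 3 * y" for c using that by linarith
    from this[OF that(1)] have "3 / 4 * (20 * f * ln T * (1 + \<rho>) / \<rho> ^ 3) \<le> sin y" .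
    hence "\<rho> ^ 3 * (3 / 4 * (20 * f * ln T * (1 + \<rho>) / \<rho> ^ 3)) \<le> \<rho> ^ 3 * sin y" using r3 by (intro mult_left_mono) auto
    thus ?thesis using r3 by (simp add: mult_ac)
  qed
  have Rek0: "Re (k0 ^ 3) = - (\<rho> ^ 3 * sin (3 / 2 * t))" using k0(5) by (simp add: t_def)
  show False
  proof (cases "t \<ge> 2 * pi / 3")
    case True
    have "20 * f * ln T * (1 + \<rho>) / \<rho> ^ 3 \<le> 2 / 3 * (3 / 2 * t - pi)"
      using A1 True by (simp add: t_def abs_if split: if_splits)
    hence "15 * (f * ln T * (1 + \<rho>)) \<le> \<rho> ^ 3 * sin (3 / 2 * t - pi)" by (rule sinhalf) (use t in auto)
    hence "15 * (f * ln T * (1 + \<rho>)) \<le> Re (k0 ^ 3)" unfolding Rek0 by simp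
    from c2[OF cube_dist(2) this] have "(cmod Xm)\<^sup>2 \<le> exp (- (6 * ln T))"
      unfolding Xm_def osc_def norm_exp_cube by simp
    hence X: "(cmod Xm)\<^sup>2 \<le> 1 / T ^ 6" using ln_T_exp by (simp add: exp_minus inverse_eq_divide)
    have "cos t \<le> cos (2 * pi / 3)" using True t by (intro cos_monotone_0_pi_le) auto
    hence "cos (Arg z) \<le> - 1 / 2" by (simp add: t_def cos_120)
    hence "Re z \<le> \<rho>\<^sup>2 * (- 1 / 2)" unfolding z_polar by (intro mult_left_mono) auto
    hence "Re (kp\<^sup>2) \<ge> 0" "Re (km\<^sup>2) \<ge> 0" using kappa_f mult_pos_pos[OF pos(1,3)] zero_le_power2[of \<rho>] unfolding Re_k_square by linarith+
    note R = this
    have "Re kp \<ge> cmod kp / 4" "Re km \<ge> cmod km / 4"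
      using Re_k_lower(1)[OF R(1) k_quadrant(1,2) norm_k(1)] Re_k_lower(1)[OF R(2) k_quadrant(3,4) norm_k(3)] norm_k rho(1)
      by linarith+
    from det_zero_1[OF det this] obtain ap am bp bm where near: "near1 ap am bp bm"
      and 0: "F1 ap am bp bm + \<i> * Xm\<^sup>2 * N ap am bp bm = 0" by blast
    thus False using no_zero_if_Xm_small[OF X R near e(5,6)] by blast
  next
    case False
    \<comment> \<open>The weaker slope 1/4 also covers obtuse angles below
      \<open>2 * pi / 3\<close>, where the sine is at least 3/4 and
      \<open>t \<le> 3\<close>.\<close>
    have sint: "t / 4 \<le> sin t"
    proof (cases "t \<le> pi / 2")
      case True
      thus ?thesis using sin_ge_half[of t] t by simp
    next
      case gt: False
      have "sin (pi / 3) \<le> sin (pi - t)" using False gt by (intro sin_monotone_2pi_le) auto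
      moreover have "t \<le> 3" using False pi_less_4 by simp
      moreover have "3 / 2 \<le> sqrt (3::real)" by (rule real_le_rsqrt) (simp add: power2_eq_square)
      ultimately show ?thesis by (simp add: sin_60)
    qed
    \<comment> \<open>The second angular condition gives
      \<open>\<sigma> * \<rho>\<^sup>2 \<ge> 5 / 3 * f * ln T\<close>, and \<open>L\<close>
      exchanges the logarithm for \<open>2 / \<epsilon>\<close>.\<close>
    have sig: "2 * f \<le> \<epsilon> * \<sigma> * \<rho>\<^sup>2"
    proof -
      have "\<bar>Im z\<bar> = \<rho>\<^sup>2 * sin t"
        unfolding z_polar abs_mult using t sin_gt_zero[of t] by (simp add: t_def)
      hence "\<sigma> * \<rho>\<^sup>2 = \<rho> ^ 3 * sin t / 3" using rho(1) by (simp add: \<sigma>_def power2_eq_square power3_eq_cube)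
      moreover have "\<rho> ^ 3 * (t / 4) \<le> \<rho> ^ 3 * sin t" using sint r3 by (intro mult_left_mono) auto
      ultimately have "20 / 12 * (f * ln T) \<le> \<sigma> * \<rho>\<^sup>2" using t_ge by (simp add: mult_ac)
      moreover have "f * (2 / \<epsilon>) \<le> f * ln T" using L pos by (intro mult_left_mono) auto
      moreover have "0 \<le> f * ln T" using pos L0 by simp
      ultimately have "f * (2 / \<epsilon>) \<le> \<sigma> * \<rho>\<^sup>2" by linarith
      thus ?thesis using pos by (simp add: field_simps)
    qed
    note q = norm_q(2)[OF sig]
    show False
    proof (cases "t \<ge> pi / 3")
      case t3: True
      have "20 * f * ln T * (1 + \<rho>) / \<rho> ^ 3 \<le> 2 / 3 * (pi - 3 / 2 * t)"
        using A1 False by (simp add: t_def abs_if split: if_splits)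
      hence "15 * (f * ln T * (1 + \<rho>)) \<le> \<rho> ^ 3 * sin (pi - 3 / 2 * t)" by (rule sinhalf) (use t3 in auto)
      hence "Re (k0 ^ 3) \<le> - (15 * (f * ln T * (1 + \<rho>)))" unfolding Rek0 by simp
      from c1[OF cube_dist(1) this] have "exp (6 * ln T) \<le> (cmod Xp)\<^sup>2"
        unfolding Xp_def osc_def norm_exp_cube by simp
      hence X: "T ^ 6 \<le> (cmod Xp)\<^sup>2" using ln_T_exp by simp
      have "cos t \<le> cos (pi / 3)" using t3 t by (intro cos_monotone_0_pi_le) auto
      hence "cos (Arg z) \<le> 1 / 2" by (simp add: t_def cos_60)
      hence "Re z \<le> \<rho>\<^sup>2 * (1 / 2)" unfolding z_polar by (intro mult_left_mono) auto
      hence R: "Re (kp\<^sup>2) \<ge> - (51 / 100 * \<rho>\<^sup>2)" "Re (km\<^sup>2) \<ge> - (51 / 100 * \<rho>\<^sup>2)"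
        using kappa_f mult_pos_pos[OF pos(1,3)] zero_le_power2[of \<rho>] unfolding Re_k_square by linarith+
      \<comment> \<open>The angle of \<open>k0\<close> is at most \<open>pi / 3\<close> here, but
        the shift by \<open>\<kappa> * f\<close> can push \<open>kp\<close> and \<open>km\<close>
        beyond it; hence 1/4 instead of 1/2.\<close>
      have wide: "cmod k / 4 \<le> Re k" if "Re (k\<^sup>2) \<ge> - (51 / 100 * \<rho>\<^sup>2)" "Re k > 0" "99 / 100 * \<rho> \<le> cmod k" "cmod k \<le> 101 / 100 * \<rho>" for k
      proof (rule power2_le_imp_le)
        have "(99 / 100 * \<rho>)\<^sup>2 \<le> (cmod k)\<^sup>2" "(cmod k)\<^sup>2 \<le> (101 / 100 * \<rho>)\<^sup>2"
          using that rho(1) by (auto intro!: power_mono)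
        moreover have "(99 / 100 * \<rho>)\<^sup>2 = 9801 / 10000 * \<rho>\<^sup>2" "(101 / 100 * \<rho>)\<^sup>2 = 10201 / 10000 * \<rho>\<^sup>2" "(cmod k / 4)\<^sup>2 = (cmod k)\<^sup>2 / 16"
          by (simp_all add: power_mult_distrib power_divide)
        moreover have "(cmod k)\<^sup>2 = (Re k)\<^sup>2 + (Im k)\<^sup>2" "Re (k\<^sup>2) = (Re k)\<^sup>2 - (Im k)\<^sup>2"
          by (simp add: cmod_power2, simp add: power2_eq_square)
        ultimately show "(cmod k / 4)\<^sup>2 \<le> (Re k)\<^sup>2" using that(1) zero_le_power2[of \<rho>] by linarith
      qed (use that in auto)
      have "Re kp \<ge> cmod kp / 4" "Re km \<ge> cmod km / 4"
        using wide[OF R(1) k_quadrant(1) norm_k(1,2)] wide[OF R(2) k_quadrant(3) norm_k(3,4)] by auto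
      from det_zero_1[OF det this] obtain ap am bp bm where near: "near1 ap am bp bm"
        and 0: "F1 ap am bp bm + \<i> * Xm\<^sup>2 * N ap am bp bm = 0" by blast
      have "F1 ap am bp bm + \<i> * Xm\<^sup>2 * N ap am bp bm \<noteq> 0"
        using N_lower[OF sig near \<rho>0 e(1-3)] F_upper(1)[OF near q e(4)] by (intro no_zero_if_Xp_large X q) auto
      thus False using 0 by blast
    next
      case t3: False
      have "cos (pi / 3) \<le> cos t" using t3 t by (intro cos_monotone_0_pi_le) auto
      hence "1 / 2 \<le> cos (Arg z)" by (simp add: t_def cos_60)
      hence "\<rho>\<^sup>2 * (1 / 2) \<le> Re z" unfolding z_polar by (intro mult_left_mono) auto
      hence R: "Re (kp\<^sup>2) \<le> 0" "Re (km\<^sup>2) \<le> 0"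
        using kappa_f mult_pos_pos[OF pos(1,3)] zero_le_power2[of \<rho>] unfolding Re_k_square by linarith+
      have ImRe: "Re k \<le> Im k" if "Re (k\<^sup>2) \<le> 0" "Im k > 0" for k
      proof (rule power2_le_imp_le)
        show "(Re k)\<^sup>2 \<le> (Im k)\<^sup>2" using that by (simp add: power2_eq_square)
      qed (use that in auto)
      have sec: "Im kp \<ge> Re kp" "Im km \<ge> Re km" using ImRe R k_quadrant by auto
      from det_zero_2[OF det this] obtain ap am bp bm where near: "near1 ap am bp bm"
        and 0: "F2 ap am bp bm + \<i> * Xm\<^sup>2 * N ap am bp bm = 0" by blast
      \<comment> \<open>The cube is estimated from \<open>kp\<close> itself:
        \<open>2 * Re kp * Im kp = \<rho>\<^sup>2 * sin t\<close> holds exactly, so no error of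
        order \<open>\<kappa> * f * \<rho>\<close> arises, and the condition at angle 0 has no
        factor \<open>1 + \<rho>\<close>.\<close>
      have "6 * ln T \<le> - (4 / 3) * (Re (kp ^ 3) / f)"
      proof -
        have im: "2 * Re kp * Im kp = \<rho>\<^sup>2 * sin t"
        proof -
          have "2 * Re kp * Im kp = Im (kp\<^sup>2)" by (simp add: power2_eq_square)
          also have "\<dots> = \<rho>\<^sup>2 * sin t" unfolding k_square by (simp add: z_polar t_def)
          finally show ?thesis .
        qed
        have "Re (kp ^ 3) = - (Re kp * (3 * (Im kp)\<^sup>2 - (Re kp)\<^sup>2))"
          by (simp add: power3_eq_cube power2_eq_square algebra_simps)
        moreover have "Re kp * (2 * (Im kp)\<^sup>2) \<le> Re kp * (3 * (Im kp)\<^sup>2 - (Re kp)\<^sup>2)"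
          using k_quadrant power_mono[OF sec(1), of 2] by (intro mult_left_mono) auto
        moreover have "Re kp * (2 * (Im kp)\<^sup>2) = \<rho>\<^sup>2 * sin t * Im kp"
          unfolding im[symmetric] by (simp add: power2_eq_square)
        moreover have "\<rho>\<^sup>2 * (t / 2) * (69 / 100 * \<rho>) \<le> \<rho>\<^sup>2 * sin t * Im kp"
        proof (intro mult_mono mult_left_mono)
          show "t / 2 \<le> sin t" using t3 t by (intro sin_ge_half) auto
          have "(99 / 100 * \<rho>)\<^sup>2 \<le> (cmod kp)\<^sup>2" using norm_k rho(1) by (intro power_mono) auto
          also have "\<dots> \<le> 2 * (Im kp)\<^sup>2" using power_mono[OF sec(1), of 2] k_quadrant by (simp add: cmod_power2)
          finally have "(99 / 100 * \<rho>)\<^sup>2 \<le> 2 * (Im kp)\<^sup>2" .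
          moreover have "(99 / 100 * \<rho>)\<^sup>2 = 9801 / 10000 * \<rho>\<^sup>2" "(69 / 100 * \<rho>)\<^sup>2 = 4761 / 10000 * \<rho>\<^sup>2"
            by (simp_all add: power_mult_distrib power_divide)
          ultimately have "(69 / 100 * \<rho>)\<^sup>2 \<le> (Im kp)\<^sup>2" using zero_le_power2[of \<rho>] by linarith
          thus "69 / 100 * \<rho> \<le> Im kp" by (rule power2_le_imp_le) (use k_quadrant in auto)
        qed (use t rho(1) sin_gt_zero[of t] in auto)
        moreover have "\<rho>\<^sup>2 * (t / 2) * (69 / 100 * \<rho>) = 69 / 200 * (t * \<rho> ^ 3)" by (simp add: power2_eq_square power3_eq_cube)
        ultimately have "Re (kp ^ 3) \<le> - (69 / 200 * (t * \<rho> ^ 3))" by linarith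
        also have "\<dots> \<le> - (69 / 10 * (f * ln T))" using t_ge by simp
        finally have "Re (kp ^ 3) / f \<le> - (69 / 10 * (f * ln T)) / f" using pos by (intro divide_right_mono) auto
        hence "Re (kp ^ 3) / f \<le> - (69 / 10 * ln T)" using pos by simp
        thus ?thesis using L0 by simp
      qed
      hence "exp (6 * ln T) \<le> (cmod Xp)\<^sup>2" unfolding Xp_def osc_def norm_exp_cube by simp
      hence X: "T ^ 6 \<le> (cmod Xp)\<^sup>2" using ln_T_exp by simp
      have "F2 ap am bp bm + \<i> * Xm\<^sup>2 * N ap am bp bm \<noteq> 0"
        using N_lower[OF sig near \<rho>0 e(1-3)] F_upper(2)[OF near q e(4)] by (intro no_zero_if_Xp_large X q) auto
      thus False using 0 by blast
    qed
  qed
qed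

end

section \<open>Spectral parameters near the origin\<close>

text \<open>Both points move, so differentiability at \<open>a\<close> alone would not suffice.
  Continuity of \<open>F'\<close> makes \<open>F z - F' a * z\<close> Lipschitz near
  \<open>a\<close> with an arbitrarily small constant.\<close>

lemma strict_derivative_sequentially:
  fixes F F' :: "complex \<Rightarrow> complex"
  assumes F: "\<And>z. (F has_field_derivative F' z) (at z)" and cont: "isCont F' a"
    and u: "u \<longlonglongrightarrow> a" and v: "v \<longlonglongrightarrow> a" and ne: "\<And>n. u n \<noteq> v n"
  shows "(\<lambda>n. (F (v n) - F (u n)) / (v n - u n)) \<longlonglongrightarrow> F' a"
proof (rule tendstoI)
  fix e :: real assume e: "e > 0"
  obtain r where r: "r > 0" "\<And>z. dist z a < r \<Longrightarrow> dist (F' z) (F' a) < e / 2"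
    using cont e unfolding continuous_at_eps_delta by (metis half_gt_zero)
  have "eventually (\<lambda>n. dist (u n) a < r) sequentially" "eventually (\<lambda>n. dist (v n) a < r) sequentially"
    using tendstoD[OF u r(1)] tendstoD[OF v r(1)] by auto
  thus "eventually (\<lambda>n. dist ((F (v n) - F (u n)) / (v n - u n)) (F' a) < e) sequentially"
  proof eventually_elim
    case (elim n)
    have "norm ((F (v n) - F' a * v n) - (F (u n) - F' a * u n)) \<le> e / 2 * norm (v n - u n)"
    proof (rule field_differentiable_bound[of "ball a r" _ "\<lambda>z. F' z - F' a"])
      show "((\<lambda>z. F z - F' a * z) has_field_derivative F' z - F' a) (at z within ball a r)" for z
        by (rule has_field_derivative_at_within) (auto intro!: derivative_eq_intros F)
      show "norm (F' z - F' a) \<le> e / 2" if "z \<in> ball a r" for z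
      proof -
        have "dist (F' z) (F' a) \<le> e / 2" using r(2)[of z] that by (simp add: dist_commute less_imp_le)
        thus ?thesis by (simp only: dist_norm)
      qed
    qed (use elim in \<open>auto simp: dist_commute\<close>)
    moreover have "v n - u n \<noteq> 0" using ne[of n] by simp
    hence "(F (v n) - F (u n)) / (v n - u n) - F' a = ((F (v n) - F' a * v n) - (F (u n) - F' a * u n)) / (v n - u n)"
      by (simp add: field_simps)
    ultimately have "norm ((F (v n) - F (u n)) / (v n - u n) - F' a) \<le> e / 2"
      using \<open>v n - u n \<noteq> 0\<close> by (simp add: norm_divide pos_divide_le_eq)
    thus ?case using e by (simp add: dist_norm)
  qed
qed

text \<open>If \<open>\<bar>z\<bar>\<close> is much smaller than \<open>f powr (2/3)\<close>, the Airy functions are evaluated near the origin.\<close>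

lemma stark_det_nonzero_small:
  fixes \<kappa> \<eta> \<beta> :: real
  assumes pos: "\<kappa> > 0" "\<eta> > 0" and \<beta>: "0 < \<beta>" "\<beta> < 1"
  shows "\<exists>f0>0. \<forall>f z. 0 < f \<and> f < f0 \<and> cmod z < f powr (2 / (3 * \<beta>)) \<longrightarrow> stark_det \<kappa> \<eta> f z \<noteq> 0"
proof (rule ccontr)
  assume "\<not> ?thesis"
  hence "\<forall>n. \<exists>f z. 0 < f \<and> f < 1 / real (Suc n) \<and> cmod z < f powr (2 / (3 * \<beta>)) \<and> stark_det \<kappa> \<eta> f z = 0"
    by (metis of_nat_0_less_iff zero_less_Suc zero_less_divide_1_iff)
  then obtain f z where fz: "\<And>n. 0 < f n" "\<And>n. f n < 1 / real (Suc n)" "\<And>n. cmod (z n) < f n powr (2 / (3 * \<beta>))"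
      "\<And>n. stark_det \<kappa> \<eta> (f n) (z n) = 0" by metis
  have "f \<longlonglongrightarrow> 0"
    by (rule tendsto_sandwich[OF _ _ tendsto_const LIMSEQ_Suc[OF lim_1_over_n]])
       (use fz in \<open>auto intro!: always_eventually less_imp_le\<close>)
  define r where "r n = root 3 (f n)" for n
  have r0: "r \<longlonglongrightarrow> 0" unfolding r_def using tendsto_real_root[OF \<open>f \<longlonglongrightarrow> 0\<close>, of 3] by simp
  have rpos: "r n > 0" for n using fz by (simp add: r_def)
  \<comment> \<open>The exponent in the bound for the scaled parameter
    \<open>z * f powr (- 2/3)\<close>; it is positive because \<open>\<beta> < 1\<close>.\<close>
  define p where "p = 2 / (3 * \<beta>) - 2 / 3"
  have p: "p > 0" using \<beta> by (simp add: p_def field_simps)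
  have w0: "(\<lambda>n. of_real (r n) * (z n / of_real (f n))) \<longlonglongrightarrow> 0"
  proof (rule Lim_null_comparison)
    show "(\<lambda>n. f n powr p) \<longlonglongrightarrow> 0" using \<open>f \<longlonglongrightarrow> 0\<close> p fz(1)
      by (intro tendsto_zero_powrI) (auto intro!: always_eventually less_imp_le)
    have "norm (of_real (r n) * (z n / of_real (f n))) \<le> f n powr p" for n
    proof -
      have "norm (of_real (r n) * (z n / of_real (f n))) = r n * (cmod (z n) / f n)"
        using rpos[of n] fz(1)[of n] by (simp add: norm_mult norm_divide)
      also have "\<dots> \<le> r n * (f n powr (2 / (3 * \<beta>)) / f n)"
        using rpos[of n] fz(1,3)[of n] by (intro mult_left_mono divide_right_mono) auto
      also have "\<dots> = f n powr (1 / 3) * (f n powr (2 / (3 * \<beta>)) / f n powr 1)"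
        using fz(1)[of n] by (simp add: r_def root_powr_inverse)
      also have "\<dots> = f n powr (1 / 3 + (2 / (3 * \<beta>) - 1))" by (simp only: powr_add powr_diff)
      also have "1 / 3 + (2 / (3 * \<beta>) - 1) = p" by (simp add: p_def)
      finally show ?thesis .
    qed
    thus "\<forall>\<^sub>F n in sequentially. norm (of_real (r n) * (z n / of_real (f n))) \<le> f n powr p" by simp
  qed
  define u where "u n = stark_arg (f n) (z n) (-\<kappa>)" for n
  define v where "v n = stark_arg (f n) (z n) \<kappa>" for n
  have uv: "u n = of_real (r n) * of_real (- \<kappa>) - of_real (r n) * (z n / of_real (f n))"
    "v n = of_real (r n) * of_real \<kappa> - of_real (r n) * (z n / of_real (f n))" "v n - u n = 2 * of_real \<kappa> * of_real (r n)" for n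
    by (simp_all add: u_def v_def stark_arg_def r_def algebra_simps)
  have rc: "(\<lambda>n. complex_of_real (r n)) \<longlonglongrightarrow> 0" using tendsto_of_real[OF r0, where 'a = complex] by simp
  have u0: "u \<longlonglongrightarrow> 0" and v0: "v \<longlonglongrightarrow> 0"
    using tendsto_diff[OF tendsto_mult[OF rc tendsto_const[of "of_real (- \<kappa>)"]] w0]
      tendsto_diff[OF tendsto_mult[OF rc tendsto_const[of "of_real \<kappa>"]] w0]
    by (simp_all add: uv(1,2)[abs_def] del: of_real_minus)
  have ne: "u n \<noteq> v n" for n
  proof -
    have "v n - u n \<noteq> 0" unfolding uv using rpos[of n] pos by simp
    thus ?thesis by auto
  qed
  define g where "g x = Airy (tau ^ 4 * x)" for x
  define g' where "g' x = tau ^ 4 * Airy' (tau ^ 4 * x)" for x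
  have lin: "((\<lambda>z. tau ^ 4 * z) has_field_derivative tau ^ 4) (at x)" for x
    by (auto intro!: derivative_eq_intros)
  have dg: "(g has_field_derivative g' x) (at x)" for x
    unfolding g_def[abs_def] g'_def by (rule DERIV_cong[OF DERIV_chain2[OF Airy_deriv(1) lin]]) simp
  have cont: "isCont Airy x" "isCont Airy' x" "isCont g x" for x
    using Airy_deriv dg DERIV_isCont by blast+
  have cg': "isCont g' x" for x
    unfolding g'_def by (intro continuous_intros isCont_o2[OF _ cont(2)])
  let ?dA = "\<lambda>n. (Airy (v n) - Airy (u n)) / (v n - u n)" let ?dg = "\<lambda>n. (g (v n) - g (u n)) / (v n - u n)"
  have dA: "?dA \<longlonglongrightarrow> Airy' 0" by (rule strict_derivative_sequentially[OF Airy_deriv(1) cont(2) u0 v0 ne])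
  have dgl: "?dg \<longlonglongrightarrow> g' 0" by (rule strict_derivative_sequentially[OF dg cg' u0 v0 ne])
  have lims: "(\<lambda>n. Airy (u n)) \<longlonglongrightarrow> Airy 0" "(\<lambda>n. Airy (v n)) \<longlonglongrightarrow> Airy 0" "(\<lambda>n. g (u n)) \<longlonglongrightarrow> g 0" "(\<lambda>n. g (v n)) \<longlonglongrightarrow> g 0"
    using isCont_tendsto_compose[OF cont(1) u0] isCont_tendsto_compose[OF cont(1) v0]
      isCont_tendsto_compose[OF cont(3) u0] isCont_tendsto_compose[OF cont(3) v0] by auto
  define W where "W = - 2 * tau ^ 5"
  have W: "W \<noteq> 0" by (simp add: W_def tau_simps)
  have g0: "g 0 = Airy 0" by (simp add: g_def)
  have W0: "Airy 0 * g' 0 - Airy' 0 * g 0 = W" using airy_wronskian[of 0] by (simp add: g_def g'_def W_def)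
  let ?e = "complex_of_real \<eta>"
  \<comment> \<open>As \<open>r\<close> tends to 0 both arguments tend to 0, all kernel entries
    coincide in the limit, and the determinant degenerates. \<open>D\<close> is the determinant
    divided by \<open>r\<close>; the difference quotients turn into the Wronskian at 0, and the
    limit is \<open>2 * W * (Airy 0)\<^sup>2 * (1 / \<eta> + \<kappa> /
    \<eta>\<^sup>2)\<close>.\<close>
  define D where "D n = W\<^sup>2 * of_real (r n) + W * (Airy (v n) * g (v n) + Airy (u n) * g (u n)) / ?e
     + Airy (v n) * g (u n) * (2 * of_real \<kappa>) * (Airy (u n) * ?dg n - ?dA n * g (u n)) / ?e\<^sup>2" for n
  have "D n = 0" for n
  proof -
    have "stark_det \<kappa> \<eta> (f n) (z n) = (W * of_real (r n) + Airy (v n) * g (v n) / ?e) * (W * of_real (r n) + Airy (u n) * g (u n) / ?e)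
        - (Airy (v n) * g (u n) / ?e)\<^sup>2"
      using pos by (simp add: stark_det_def stark_K_def stark_a_def stark_g_def stark_wronskian_def W_def g_def u_def v_def r_def max_def min_def)
    also have "\<dots> = of_real (r n) * (W\<^sup>2 * of_real (r n) + W * (Airy (v n) * g (v n) + Airy (u n) * g (u n)) / ?e)
        + Airy (v n) * g (u n) * (Airy (u n) * (g (v n) - g (u n)) - (Airy (v n) - Airy (u n)) * g (u n)) / ?e\<^sup>2"
      using pos by (simp add: field_simps power2_eq_square)
    also have "Airy (u n) * (g (v n) - g (u n)) - (Airy (v n) - Airy (u n)) * g (u n) = (v n - u n) * (Airy (u n) * ?dg n - ?dA n * g (u n))"
    proof -
      have "(v n - u n) * ?dg n = g (v n) - g (u n)" "(v n - u n) * ?dA n = Airy (v n) - Airy (u n)"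
        using ne[of n] by simp_all
      moreover have "(v n - u n) * (Airy (u n) * ?dg n - ?dA n * g (u n)) = Airy (u n) * ((v n - u n) * ?dg n) - ((v n - u n) * ?dA n) * g (u n)"
        by (simp only: right_diff_distrib mult_ac)
      ultimately show ?thesis by simp
    qed
    also have "of_real (r n) * (W\<^sup>2 * of_real (r n) + W * (Airy (v n) * g (v n) + Airy (u n) * g (u n)) / ?e)
        + Airy (v n) * g (u n) * ((v n - u n) * (Airy (u n) * ?dg n - ?dA n * g (u n))) / ?e\<^sup>2 = of_real (r n) * D n"
      unfolding D_def uv(3) by (simp add: algebra_simps)
    finally show ?thesis using fz(4)[of n] rpos[of n] by simp
  qed
  hence "D = (\<lambda>_. 0)" by auto
  hence "D \<longlonglongrightarrow> 0" by simp
  moreover have "D \<longlonglongrightarrow> W\<^sup>2 * 0 + W * (Airy 0 * g 0 + Airy 0 * g 0) / ?e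
     + Airy 0 * g 0 * (2 * of_real \<kappa>) * (Airy 0 * g' 0 - Airy' 0 * g 0) / ?e\<^sup>2"
    unfolding D_def[abs_def] using pos by (intro tendsto_intros rc lims dA dgl) auto
  ultimately have "W * (Airy 0 * g 0 + Airy 0 * g 0) / ?e + Airy 0 * g 0 * (2 * of_real \<kappa>) * (Airy 0 * g' 0 - Airy' 0 * g 0) / ?e\<^sup>2 = 0"
    using LIMSEQ_unique by fastforce
  hence "2 * W * (Airy 0)\<^sup>2 * (1 / ?e + of_real \<kappa> / ?e\<^sup>2) = 0"
    unfolding W0 unfolding g0 by (simp add: algebra_simps power2_eq_square)
  moreover have "1 / ?e + of_real \<kappa> / ?e\<^sup>2 = of_real (1 / \<eta> + \<kappa> / \<eta>\<^sup>2)" by simp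
  moreover have "1 / \<eta> + \<kappa> / \<eta>\<^sup>2 > 0" using pos by (intro add_pos_pos) auto
  ultimately show False using W Airy_0_nonzero by (simp del: of_real_add of_real_divide)
qed

section \<open>Choice of the thresholds\<close>

lemma eventually_mult_le: "d > 0 \<Longrightarrow> eventually (\<lambda>\<epsilon>. c * \<epsilon> \<le> d) (at_right (0::real))"
proof -
  assume "d > 0"
  moreover have "((\<lambda>\<epsilon>. c * \<epsilon>) \<longlongrightarrow> c * 0) (at_right 0)" by (intro tendsto_intros)
  ultimately have "eventually (\<lambda>\<epsilon>. c * \<epsilon> < d) (at_right (0::real))" by (intro order_tendstoD) auto
  thus ?thesis by eventually_elim simp
qed

theorem theorem1p1:
  fixes \<kappa> \<eta> \<beta> :: real
  assumes "\<kappa> > 0" and "\<eta> > 0" and "0 < \<beta>" and "\<beta> < 1"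
  shows "\<exists>f0>0. \<forall>M>20. \<forall>f. 0 < f \<and> f < f0 \<longrightarrow>
    (\<forall>z\<in>resonances \<kappa> \<eta> f.
       (f powr (2 / (3 * \<beta>)) \<le> cmod z \<and> cmod z \<le> f powr (\<beta> / 2)) \<or>
       z \<in> {z. cmod z > f powr (\<beta> / 2) \<and>
             (\<bar>Arg z + 2 * pi / 3\<bar> <
                (1 / cmod z) * (1 + cmod z powr (- 1 / 2)) * M * f * ln (1 / f + cmod z) \<or>
              \<bar>Arg z\<bar> < cmod z powr (- 3 / 2) * M * f * ln (1 / f + cmod z))})"
proof -
  \<comment> \<open>The border between the two lower bounds for \<open>N\<close>, small enough for
    \<open>N_lower_small_rho\<close>.\<close>
  define \<rho>0 where "\<rho>0 = min 1 (1 / (100 * \<kappa>))"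
  have \<rho>0: "\<rho>0 > 0" "100 * \<kappa> * \<rho>0 \<le> 1" "\<rho>0 \<le> 1"
    using assms(1) by (auto simp: \<rho>0_def min_def field_simps)
  have "eventually (\<lambda>\<epsilon>. 0 < \<epsilon> \<and> \<epsilon> \<le> 1 / 1000 \<and> \<kappa> * \<epsilon> \<le> 1 / 100 \<and> 2250 * \<epsilon> \<le> \<eta> + \<kappa> \<and>
      8 * (2 * \<kappa> + 195 * \<eta> + 450 / \<rho>0) * \<epsilon> \<le> 1 \<and> 8 * (2 * \<kappa> + 195 * \<eta> + 450 / \<rho>0) * \<epsilon> \<le> \<kappa> \<and>
      (9 * \<eta>\<^sup>2 + 48) * \<epsilon> \<le> 1 \<and> 450 * \<epsilon> \<le> \<eta> \<and> (17 * \<eta> + 32) * \<epsilon> \<le> 1) (at_right 0)"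
    using assms eventually_mult_le[of "1/1000" 1] by (intro eventually_conj eventually_mult_le eventually_at_right_less) auto
  then obtain \<epsilon> where \<epsilon>: "0 < \<epsilon>" "\<epsilon> \<le> 1 / 1000" "\<kappa> * \<epsilon> \<le> 1 / 100" "2250 * \<epsilon> \<le> \<eta> + \<kappa>"
      "8 * (2 * \<kappa> + 195 * \<eta> + 450 / \<rho>0) * \<epsilon> \<le> 1" "8 * (2 * \<kappa> + 195 * \<eta> + 450 / \<rho>0) * \<epsilon> \<le> \<kappa>"
      "(9 * \<eta>\<^sup>2 + 48) * \<epsilon> \<le> 1" "450 * \<epsilon> \<le> \<eta>" "(17 * \<eta> + 32) * \<epsilon> \<le> 1"
    using eventually_happens'[OF trivial_limit_at_right_real] by blast
  obtain f1 where f1: "f1 > 0" "\<And>f z. 0 < f \<Longrightarrow> f < f1 \<Longrightarrow> cmod z < f powr (2 / (3 * \<beta>)) \<Longrightarrow> stark_det \<kappa> \<eta> f z \<noteq> 0"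
    using stark_det_nonzero_small[OF assms] by blast
  have "eventually (\<lambda>f. f \<le> \<epsilon> \<and> f powr (1 - \<beta>) \<le> \<epsilon> \<and> 2 / \<epsilon> \<le> ln (1 / f) \<and> f < 1) (at_right 0)"
  proof (intro eventually_conj)
    show "eventually (\<lambda>f. f \<le> \<epsilon>) (at_right 0)" using eventually_mult_le[of \<epsilon> 1] \<epsilon> by simp
    have "((\<lambda>f. f powr (1 - \<beta>)) \<longlongrightarrow> 0) (at_right 0)" using assms by real_asymp
    from order_tendstoD(2)[OF this \<epsilon>(1)] show "eventually (\<lambda>f. f powr (1 - \<beta>) \<le> \<epsilon>) (at_right 0)"
      by eventually_elim simp
    have "filterlim (\<lambda>f::real. ln (1 / f)) at_top (at_right 0)" by real_asymp
    thus "eventually (\<lambda>f. 2 / \<epsilon> \<le> ln (1 / f)) (at_right 0)" by (simp add: filterlim_at_top)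
    show "eventually (\<lambda>f. f < 1) (at_right (0::real))" using eventually_at_right_real[of 0 1] by (auto elim: eventually_mono)
  qed
  then obtain f2 where f2: "f2 > 0" "\<And>f. 0 < f \<Longrightarrow> f < f2 \<Longrightarrow> f \<le> \<epsilon> \<and> f powr (1 - \<beta>) \<le> \<epsilon> \<and> 2 / \<epsilon> \<le> ln (1 / f) \<and> f < 1"
    unfolding eventually_at_right_field by auto
  show ?thesis
  \<comment> \<open>The threshold does not depend on \<open>M\<close>, which enters only through the
    final comparison with 20.\<close>
  proof (intro exI[of _ "min f1 f2"] conjI allI impI ballI)
    show "0 < min f1 f2" using f1 f2 by simp
    fix M f :: real and z
    assume M: "M > 20" and f: "0 < f \<and> f < min f1 f2" and z: "z \<in> resonances \<kappa> \<eta> f"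
    have det: "stark_det \<kappa> \<eta> f z = 0" using f z assms by (intro resonance_imp_stark_det_eq_0) auto
    have imz: "Im z < 0" using z by (simp add: resonances_def)
    have F: "f \<le> \<epsilon>" "f powr (1 - \<beta>) \<le> \<epsilon>" "2 / \<epsilon> \<le> ln (1 / f)" "f < 1" using f2(2)[of f] f by auto
    have lower: "f powr (2 / (3 * \<beta>)) \<le> cmod z" using f1(2)[of f z] f det by force
    show "(f powr (2 / (3 * \<beta>)) \<le> cmod z \<and> cmod z \<le> f powr (\<beta> / 2)) \<or>
       z \<in> {z. cmod z > f powr (\<beta> / 2) \<and>
             (\<bar>Arg z + 2 * pi / 3\<bar> <
                (1 / cmod z) * (1 + cmod z powr (- 1 / 2)) * M * f * ln (1 / f + cmod z) \<or>
              \<bar>Arg z\<bar> < cmod z powr (- 3 / 2) * M * f * ln (1 / f + cmod z))}"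
    proof (rule ccontr)
      assume neg: "\<not> ?thesis"
      hence big: "f powr (\<beta> / 2) < cmod z" using lower by auto
      \<comment> \<open>Above the cutoff \<open>f / (cmod z)\<^sup>2\<close> is at most
        \<open>f powr (1 - \<beta>)\<close>, which tends to 0 because
        \<open>\<beta> < 1\<close>.\<close>
      have "f = f powr (1 - \<beta>) * (f powr (\<beta> / 2))\<^sup>2"
        using f by (simp add: powr_powr flip: powr_add powr_numeral) 
      also have "\<dots> \<le> \<epsilon> * (cmod z)\<^sup>2" using F(2) big \<epsilon>(1) by (intro mult_mono power_mono) auto
      finally have f4: "f \<le> \<epsilon> * (cmod z)\<^sup>2" .
      interpret R: stark_regime \<kappa> \<eta> f \<epsilon> z
        by unfold_locales (use assms f imz F f4 \<epsilon> in auto)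
      have T: "R.T = 1 / f + cmod z" by (simp add: R.T_def R.rho(2))
      have "1 / f \<le> R.T" "0 < 1 / f" using R.T(1) f by auto
      hence L: "2 / \<epsilon> \<le> ln R.T" using F(3) by (smt (verit) ln_mono)
      hence L0: "0 \<le> ln R.T" using \<epsilon>(1) by (smt (verit) divide_pos_pos)
      have cz: "cmod z > 0" using imz by auto
      have p1: "cmod z powr (- 1 / 2) = 1 / R.\<rho>"
        using cz by (simp add: R.\<rho>_def powr_minus_divide powr_half_sqrt)
      have p3: "cmod z powr (- 3 / 2) = 1 / R.\<rho> ^ 3"
      proof -
        have "cmod z powr (- 3 / 2) = (cmod z powr (- 1 / 2)) powr 3" by (simp add: powr_powr)
        thus ?thesis unfolding p1 using R.rho(1) by (simp add: power_divide powr_numeral)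
      qed
      have "\<bar>Arg z + 2 * pi / 3\<bar> \<ge> (1 / cmod z) * (1 + cmod z powr (- 1 / 2)) * M * f * ln (1 / f + cmod z)"
        and "\<bar>Arg z\<bar> \<ge> cmod z powr (- 3 / 2) * M * f * ln (1 / f + cmod z)"
        using neg big by auto
      moreover have "(1 / cmod z) * (1 + cmod z powr (- 1 / 2)) * M * f * ln (1 / f + cmod z) = M * (f * ln R.T * (1 + R.\<rho>) / R.\<rho> ^ 3)"
        unfolding p1 unfolding T[symmetric] unfolding R.rho(2)[symmetric] using R.rho(1) by (simp add: field_simps power2_eq_square power3_eq_cube)
      moreover have "cmod z powr (- 3 / 2) * M * f * ln (1 / f + cmod z) = M * (f * ln R.T / R.\<rho> ^ 3)"
        unfolding p3 T[symmetric] by simp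
      moreover have "20 * (f * ln R.T * (1 + R.\<rho>) / R.\<rho> ^ 3) \<le> M * (f * ln R.T * (1 + R.\<rho>) / R.\<rho> ^ 3)"
        "20 * (f * ln R.T / R.\<rho> ^ 3) \<le> M * (f * ln R.T / R.\<rho> ^ 3)"
        using M f L0 R.rho(1) by (intro mult_right_mono; simp)+
      ultimately have "20 * f * ln R.T * (1 + R.\<rho>) / R.\<rho> ^ 3 \<le> \<bar>Arg z + 2 * pi / 3\<bar>" "20 * f * ln R.T / R.\<rho> ^ 3 \<le> \<bar>Arg z\<bar>"
        by (simp_all add: mult.assoc)
      from R.stark_det_nonzero[OF \<rho>0 \<epsilon>(4-9) L this] det show False by simp
    qed
  qed
qed

end
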